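(* Let $m,n\in\mathbb R$, $\mathcal B>0$, $q=m-n+1$. Let $h_{\rm ss}\in C^4(\mathbb R)$ be a non-constant positive periodic steady state of $h_t=-(h^nh_{xxx})_x-\mathcal B(h^mh_x)_x$, with least period $X$ and area $A_{\rm ss}=\int_0^Xh_{\rm ss}\,dx$. If $-1<q<1$ or $2\le q<3$, or if $1<q<2$ and $E'(\alpha)>0$ for all $\alpha\in(0,1)$, then there exists a zero contact angle droplet steady state $\hat h_{\rm ss}$ of the same equation with length $\hat X<X$ and area $\hat A=A_{\rm ss}$. Furthermore, $\mathcal E(\hat h_{\rm ss})<\mathcal E(h_{\rm ss})$.
   Context: A positive periodic steady state is a positive periodic $C^4$ function with $(h^nh'''+\mathcal B h^mh')'=0$ classically. A droplet steady state is a function that is positive on some interval $(a,b)$ and zero elsewhere, is $C^1$ on $[a,b]$, satisfies the steady state equation $(h^nh'''+\mathcal B h^mh')'=0$ classically on the open interval $(a,b)$, and has equal acute contact angles: $0\le h'(a)=-h'(b)<\infty$ (one-sided derivatives). It has zero contact angle if $h'(a)=h'(b)=0$. Its length is $b-a$ and its area is $\int_a^bh\,dx$. A droplet of length at most $X$ is regarded as a function on one period of the circle of circumference $X$ (zero off $(a,b)$). Energy at period $X$: for nonnegative $\ell\in H^1$ of the circle of circumference $X$, $\mathcal E(\ell)=\int_0^X[\frac12(\ell')^2-H(\ell)]dx$, where $H$ is a fixed function with $H''(y)=\mathcal B y^{q-1}$ for $y>0$, extended continuously to $y=0$ (possible since $q>-1$). The same $H$ is used for both functions. For $\alpha\in(0,1)$,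 $k_\alpha$ is the unique smooth positive periodic solution of $k''+\frac{k^q-1}{q}=0$ (if $q\ne0$) or $k''+\log k=0$ (if $q=0$) with $k(0)=\alpha$, $k'(0)=0$. $P(\alpha)$ is its least period, $A(\alpha)=\int_0^{P(\alpha)}k_\alpha\,dx$, and $E(\alpha)=P(\alpha)^{3-q}A(\alpha)^{q-1}$; these are smooth functions of $\alpha\in(0,1)$. *)

theory Defs
  imports "HOL-Analysis.Analysis"
begin

(* Meaningful for open S only: "deriv" is the two-sided derivative. *)
definition Ck_on :: "nat \<Rightarrow> (real \<Rightarrow> real) \<Rightarrow> real set \<Rightarrow> bool" where
  "Ck_on k f S \<longleftrightarrow>
     (\<forall>j<k. \<forall>x\<in>S. (deriv ^^ j) f field_differentiable (at x)) \<and>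
     continuous_on S ((deriv ^^ k) f)"

definition periodic_with :: "(real \<Rightarrow> real) \<Rightarrow> real \<Rightarrow> bool" where
  "periodic_with f T \<longleftrightarrow> (\<forall>x. f (x + T) = f x)"

definition is_least_period :: "(real \<Rightarrow> real) \<Rightarrow> real \<Rightarrow> bool" where
  "is_least_period f T \<longleftrightarrow>
     0 < T \<and> periodic_with f T \<and> (\<forall>S. 0 < S \<and> S < T \<longrightarrow> \<not> periodic_with f S)"

definition steady_flux :: "real \<Rightarrow> real \<Rightarrow> real \<Rightarrow> (real \<Rightarrow> real) \<Rightarrow> real \<Rightarrow> real" where
  "steady_flux n m B h x = h x powr n * (deriv ^^ 3) h x + B * h x powr m * deriv h x"

definition steady_eq_on :: "real \<Rightarrow> real \<Rightarrow> real \<Rightarrow> (real \<Rightarrow> real) \<Rightarrow> real set \<Rightarrow> bool" where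
  "steady_eq_on n m B h S \<longleftrightarrow>
     (\<forall>x\<in>S. (steady_flux n m B h has_real_derivative 0) (at x))"

definition positive_periodic_steady_state ::
    "real \<Rightarrow> real \<Rightarrow> real \<Rightarrow> (real \<Rightarrow> real) \<Rightarrow> bool" where
  "positive_periodic_steady_state n m B h \<longleftrightarrow>
     Ck_on 4 h UNIV \<and> (\<forall>x. 0 < h x) \<and> (\<exists>T>0. periodic_with h T) \<and>
     steady_eq_on n m B h UNIV"

(* On the open interval a classical solution has a constant flux, hence is automatically C^4.
   Derivatives at the end points are one-sided, as h may have corners there as a function
   on the real line. *)
definition droplet_steady_state ::
    "real \<Rightarrow> real \<Rightarrow> real \<Rightarrow> (real \<Rightarrow> real) \<Rightarrow> real \<Rightarrow> real \<Rightarrow> bool" where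
  "droplet_steady_state n m B h a b \<longleftrightarrow>
     a < b \<and> (\<forall>x\<in>{a<..<b}. 0 < h x) \<and> (\<forall>x. x \<notin> {a<..<b} \<longrightarrow> h x = 0) \<and>
     Ck_on 4 h {a<..<b} \<and> steady_eq_on n m B h {a<..<b} \<and>
     (\<exists>h'. (\<forall>x\<in>{a..b}. (h has_real_derivative h' x) (at x within {a..b})) \<and>
           continuous_on {a..b} h' \<and> 0 \<le> h' a \<and> h' a = - h' b)"

definition zero_contact_angle :: "(real \<Rightarrow> real) \<Rightarrow> real \<Rightarrow> real \<Rightarrow> bool" where
  "zero_contact_angle h a b \<longleftrightarrow>
     (h has_real_derivative 0) (at a within {a..b}) \<and>
     (h has_real_derivative 0) (at b within {a..b})"

(* The X-periodic function agreeing with g on [a, a + X): a droplet supported in [a, b] with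
   b - a \<le> X, viewed on the circle of circumference X. *)
definition on_circle :: "real \<Rightarrow> real \<Rightarrow> (real \<Rightarrow> real) \<Rightarrow> real \<Rightarrow> real" where
  "on_circle X a g x = g (x - X * of_int \<lfloor>(x - a) / X\<rfloor>)"

(* H is only constrained on [0, \<infinity>); it is determined there up to an affine function. *)
definition energy_potential :: "real \<Rightarrow> real \<Rightarrow> (real \<Rightarrow> real) \<Rightarrow> bool" where
  "energy_potential B q H \<longleftrightarrow>
     continuous_on {0..} H \<and>
     (\<exists>H'. \<forall>y>0. (H has_real_derivative H' y) (at y) \<and>
                 (H' has_real_derivative B * y powr (q - 1)) (at y))"

(* Elements of H^1 of the circle are absolutely continuous, and their weak derivative
   is almost everywhere the classical one. *)
definition energy :: "(real \<Rightarrow> real) \<Rightarrow> real \<Rightarrow> (real \<Rightarrow> real) \<Rightarrow> real" where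
  "energy H X l = integral {0..X} (\<lambda>x. (1 / 2) * (deriv l x)\<^sup>2 - H (l x))"

definition is_k :: "real \<Rightarrow> real \<Rightarrow> (real \<Rightarrow> real) \<Rightarrow> bool" where
  "is_k q \<alpha> k \<longleftrightarrow>
     (\<forall>j. Ck_on j k UNIV) \<and> (\<forall>x. 0 < k x) \<and> (\<exists>T>0. periodic_with k T) \<and>
     (\<forall>x. (deriv ^^ 2) k x + (if q = 0 then ln (k x) else (k x powr q - 1) / q) = 0) \<and>
     k 0 = \<alpha> \<and> deriv k 0 = 0"

definition k_sol :: "real \<Rightarrow> real \<Rightarrow> real \<Rightarrow> real" where
  "k_sol q \<alpha> = (THE k. is_k q \<alpha> k)"

definition P_fun :: "real \<Rightarrow> real \<Rightarrow> real" where
  "P_fun q \<alpha> = (THE T. is_least_period (k_sol q \<alpha>) T)"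

definition A_fun :: "real \<Rightarrow> real \<Rightarrow> real" where
  "A_fun q \<alpha> = integral {0..P_fun q \<alpha>} (k_sol q \<alpha>)"

definition E_fun :: "real \<Rightarrow> real \<Rightarrow> real" where
  "E_fun q \<alpha> = P_fun q \<alpha> powr (3 - q) * A_fun q \<alpha> powr (q - 1)"

end

theory Submission
  imports Defs
begin

text \<open>Write \<open>f = frc q\<close>, \<open>G = pot q\<close> with \<open>G' = f\<close>. After scaling, periodic steady states and zero contact
  angle droplets are the orbits of \<open>k'' + f k = 0\<close> on the levels \<open>k'\<^sup>2/2 + G k = G 1 + \<rho>\<^sup>2/2\<close>; the droplet is
  the limiting level \<open>\<rho> = rho0 q\<close> through \<open>k = 0\<close>. In the coordinate \<open>s\<close> with \<open>G (Y s) = G 1 + s\<^sup>2/2\<close> the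
  orbit is a circle \<open>s = -\<rho> cos \<theta>\<close> traversed with \<open>dx = Y' s d\<theta>\<close>, so that period and area are regular
  averages, continuous up to the droplet.

  The action \<open>J(K, \<lambda>)\<close> of the level \<open>K\<close> with multiplier \<open>\<lambda>\<close> has gradient (period, area). Its Hessian
  is the finite part of \<open>-\<integral> l\<^sup>2 / k'\<^sup>3\<close> on affine functions \<open>l\<close>. The function \<open>k'\<^sup>2 f' + f\<^sup>2\<close>, which comes from
  perturbing \<open>k\<close> in the direction \<open>k''\<close>, is orthogonal to all affine functions, and its own finite part is a
  positive multiple of \<open>-\<integral> f''' k'\<^sup>4\<close>, hence nonpositive when \<open>(q - 1)(q - 2) \<ge> 0\<close>. Comparing it with its affine
  interpolant at the turning points exhibits a direction of negative Hessian, while the scaling direction is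
  positive. So the Hessian is indefinite, which says exactly that at fixed area the period decreases as
  \<open>\<rho>\<close> grows; for \<open>1 < q < 2\<close> this is the hypothesis on \<open>E\<close>. At fixed area the energy, padded with \<open>H 0\<close>,
  satisfies \<open>d energy = (H 0 - K) d length\<close> with \<open>K < H 0\<close>, so it decreases as well.\<close>

section \<open>The potential and its amplitude coordinate\<close>

text \<open>Differentiating the period integral of 1/k' in the level produces 1/k'^3, which diverges
  at the turning points; in the angle variable the derivative is regular and appears as a finite
  part. The scaling direction is the affine function \<open>E\<close>: if k is replaced by s k(x/r)
  with r^2 = s^(1-q), then at s = 1 level and multiplier move with velocities (q+1)K and 1, while
  period and area scale like s^((1-q)/2) and s^((3-q)/2). This gives two of the three Hessian
  entries in the basis 1, \<open>E\<close> explicitly; the unknown one is the derivative of the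
  period. Twice the Hessian determinant is period times area times the logarithmic derivative of
  period^(3-q) area^(q-1) in the level, so one negative direction is enough. The range 1 < q < 2 is
  exceptional because f''' = (q-1)(q-2) y^(q-3) is negative there. At the droplet itself the force
  is unbounded for q <= 0, so all derivatives are taken for amplitudes strictly below
  \<open>rho0 q\<close> and the droplet is reached by continuity alone.\<close>

definition frc :: "real \<Rightarrow> real \<Rightarrow> real" where
  "frc q y = (if q = 0 then ln y else (y powr q - 1) / q)"

text \<open>The constant of integration makes \<open>pot q 0 = 0\<close>, so that the droplet orbit
  has level 0 and all periodic orbits have negative level.\<close>

definition pot :: "real \<Rightarrow> real \<Rightarrow> real" where
  "pot q y = (if q = 0 then y * ln y - y else (y powr (q + 1) / (q + 1) - y) / q)"

lemma frc_deriv: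
  assumes "0 < y" shows "(frc q has_real_derivative y powr (q - 1)) (at y)"
proof (cases "q = 0")
  case True
  have e: "frc q = ln" using True by (auto simp: frc_def fun_eq_iff)
  have "y powr (q - 1) = inverse y" using True assms by (simp add: powr_minus)
  with DERIV_ln[OF assms] show ?thesis by (simp add: e)
next
  case False
  have e: "frc q = (\<lambda>y. (y powr q - 1) / q)" using False by (auto simp: frc_def fun_eq_iff)
  show ?thesis unfolding e using assms False
    by (auto intro!: derivative_eq_intros)
qed

lemma pot_deriv:
  assumes "0 < y" "-1 < q" shows "(pot q has_real_derivative frc q y) (at y)"
proof (cases "q = 0")
  case True
  have e: "pot q = (\<lambda>y. y * ln y - y)" using True by (auto simp: pot_def fun_eq_iff)
  show ?thesis unfolding e using True assms by (auto intro!: derivative_eq_intros simp: frc_def)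
next
  case False
  have e: "pot q = (\<lambda>y. (y powr (q + 1) / (q + 1) - y) / q)"
    using False by (auto simp: pot_def fun_eq_iff)
  show ?thesis unfolding e using assms False
    by (auto intro!: derivative_eq_intros simp: frc_def)
qed

lemma frc_1 [simp]: "frc q 1 = 0" by (simp add: frc_def)

lemma pot_0 [simp]: "pot q 0 = 0" by (simp add: pot_def)

lemma pot_1: "-1 < q \<Longrightarrow> pot q 1 = - 1 / (q + 1)"
proof (cases "q = 0")
  case False
  assume "-1 < q"
  then have "1 / (q + 1) - 1 = q * (- 1 / (q + 1))" by (simp add: field_simps)
  then show ?thesis using False by (simp add: pot_def)
qed (simp add: pot_def)

text \<open>Infinitesimal form of \<open>pot_scale\<close> at \<open>s = 1\<close>: the left side is
  the defect of \<open>pot q\<close> from homogeneity of degree \<open>q + 1\<close>, and it has the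
  same form for \<open>q = 0\<close>.\<close>

lemma pot_euler:
  assumes "0 < y" "-1 < q" shows "y = y * frc q y - (q + 1) * pot q y"
proof -
  have "y powr (q + 1) = y * y powr q" using assms by (simp add: powr_add)
  moreover have "q + 1 \<noteq> 0" using assms by simp
  ultimately have "q \<noteq> 0 \<Longrightarrow> (q + 1) * pot q y = (y * y powr q - (q + 1) * y) / q"
    by (simp add: pot_def diff_divide_distrib right_diff_distrib)
  then show ?thesis by (cases "q = 0") (simp_all add: pot_def frc_def field_simps)
qed

lemma frc_strict_mono:
  assumes "0 < x" "x < y" shows "frc q x < frc q y"
proof (rule DERIV_pos_imp_increasing[OF assms(2)])
  show "\<exists>d. (frc q has_real_derivative d) (at z) \<and> 0 < d" if "x \<le> z" "z \<le> y" for z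
    using frc_deriv[of z q] that assms by (intro exI[of _ "z powr (q - 1)"]) auto
qed

text \<open>A dilation of heights multiplies the force and adds a constant. The constant acts as a
  Lagrange multiplier, which is how a nonzero multiplier is reduced to the normalized
  equation.\<close>

lemma frc_scale:
  assumes "0 < s" "0 < y" shows "frc q (s * y) = s powr q * frc q y + frc q s"
  using assms by (auto simp: frc_def ln_mult powr_mult field_simps)

lemma pot_scale:
  assumes "0 < s" "0 \<le> y" shows "pot q (s * y) = s powr (q + 1) * pot q y + s * frc q s * y"
proof -
  define z where "z = s powr (q + 1) * y powr (q + 1) / (q + 1)"
  consider "y = 0" | "0 < y" "q = 0" | "0 < y" "q \<noteq> 0" using assms by linarith
  then show ?thesis
  proof cases
    case 3
    have "s powr (q + 1) = s * s powr q" using assms by (simp add: powr_add)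
    then have "s powr (q + 1) * pot q y + s * frc q s * y
        = (z - s * s powr q * y) / q + s * ((s powr q - 1) / q) * y"
      using 3 by (simp add: pot_def frc_def z_def right_diff_distrib)
    also have "\<dots> = (z - s * y) / q" using 3 by (simp add: field_simps)
    also have "\<dots> = pot q (s * y)" using 3 assms by (simp add: pot_def z_def powr_mult)
    finally show ?thesis by simp
  next
    case 2
    then show ?thesis using assms by (auto simp: frc_def pot_def ln_mult field_simps)
  qed simp
qed

text \<open>Comes from \<open>ln z \<le> z\<close> at \<open>z = 1 / sqrt y\<close>; it gives the
  continuity of \<open>pot 0\<close> at height 0.\<close>

lemma xlnx_bound:
  assumes "0 \<le> y" "y \<le> 1" shows "\<bar>y * ln y\<bar> \<le> 2 * sqrt y"
proof (cases "y = 0")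
  case False
  then have y: "0 < y" using assms by simp
  have "ln (1 / sqrt y) \<le> 1 / sqrt y" using y ln_less_self[of "1 / sqrt y"]
    by (simp del: ln_div add: less_imp_le)
  moreover have "ln (1 / sqrt y) = - ln y / 2" using y by (simp add: ln_div ln_sqrt)
  ultimately have "- ln y \<le> 2 / sqrt y" by simp
  with y have "y * (- ln y) \<le> y * (2 / sqrt y)" using y by (intro mult_left_mono) auto
  also have "y * (2 / sqrt y) = 2 * sqrt y" using y
    by (metis mult.commute mult.assoc less_imp_le real_div_sqrt times_divide_eq_right)
  finally have 1: "- (y * ln y) \<le> 2 * sqrt y" by simp
  have "ln y \<le> 0" using y assms by simp
  then have "y * ln y \<le> 0" using y by (simp add: mult_le_0_iff)
  with 1 show ?thesis by simp
qed simp

lemma pot_cont: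
  assumes "-1 < q" shows "continuous_on {0..} (pot q)"
proof -
  have "((pot q) \<longlongrightarrow> pot q 0) (at 0 within {0..})"
  proof (cases "q = 0")
    case True
    have "((\<lambda>y::real. y * ln y) \<longlongrightarrow> 0) (at 0 within {0..})"
    proof (rule Lim_null_comparison)
      show "\<forall>\<^sub>F y in at 0 within {0..}. norm (y * ln y) \<le> 2 * sqrt y"
        unfolding eventually_at by (rule exI[of _ 1]) (auto intro!: xlnx_bound)
      have "((\<lambda>y. 2 * sqrt y) \<longlongrightarrow> 2 * sqrt 0) (at 0 within {0..})"
        by (intro tendsto_intros)
      then show "((\<lambda>y. 2 * sqrt y) \<longlongrightarrow> 0) (at 0 within {0..})" by simp
    qed
    then have "((\<lambda>y::real. y * ln y - y) \<longlongrightarrow> 0 - 0) (at 0 within {0..})"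
      by (intro tendsto_diff) (auto intro!: tendsto_eq_intros)
    moreover have "pot q = (\<lambda>y. y * ln y - y)" using True by (auto simp: pot_def fun_eq_iff)
    ultimately show ?thesis by simp
  next
    case False
    have "continuous_on {0..} (\<lambda>y::real. (y powr (q + 1) / (q + 1) - y) / q)"
      using assms False by (intro continuous_intros continuous_on_powr') auto
    moreover have "pot q = (\<lambda>y. (y powr (q + 1) / (q + 1) - y) / q)"
      using False by (auto simp: pot_def fun_eq_iff)
    ultimately have "continuous_on {0..} (pot q)" by metis
    then show ?thesis unfolding continuous_on_def by blast
  qed
  note 0 = this
  have 1: "((pot q) \<longlongrightarrow> pot q y) (at y within {0..})" if "y \<noteq> 0" "y \<ge> 0" for y
    using pot_deriv[of y q] that assms
    by (metis DERIV_isCont continuous_at_imp_continuous_at_within continuous_within order_le_less)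
  show ?thesis unfolding continuous_on_def
  proof
    fix y :: real assume "y \<in> {0..}"
    then show "((pot q) \<longlongrightarrow> pot q y) (at y within {0..})" using 0 1[of y] by (cases "y = 0") auto
  qed
qed

section \<open>The signed amplitude as a coordinate on heights\<close>

definition gap :: "real \<Rightarrow> real \<Rightarrow> real" where
  "gap q y = 2 * (pot q y + 1 / (q + 1))"

definition amp :: "real \<Rightarrow> real \<Rightarrow> real" where
  "amp q y = sgn (y - 1) * sqrt (gap q y)"

definition rho0 :: "real \<Rightarrow> real" where
  "rho0 q = sqrt (2 / (q + 1))"

lemma gap_1: "-1 < q \<Longrightarrow> gap q 1 = 0"
  by (simp add: gap_def pot_1)

lemma gap_deriv: "-1 < q \<Longrightarrow> 0 < y \<Longrightarrow> (gap q has_real_derivative 2 * frc q y) (at y)"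
  unfolding gap_def by (auto intro!: derivative_eq_intros pot_deriv)

lemma gap_cont: "-1 < q \<Longrightarrow> continuous_on {0..} (gap q)"
  unfolding gap_def by (intro continuous_intros pot_cont)

lemma frc_neg: "0 < y \<Longrightarrow> y < 1 \<Longrightarrow> frc q y < 0"
  using frc_strict_mono[of y 1 q] by simp

lemma frc_pos: "1 < y \<Longrightarrow> 0 < frc q y"
  using frc_strict_mono[of 1 y q] by simp

lemma gap_decreasing:
  assumes "-1 < q" "0 \<le> x" "x < y" "y \<le> 1" shows "gap q y < gap q x"
proof (rule DERIV_neg_imp_decreasing_open[OF assms(3)])
  show "\<exists>d. (gap q has_real_derivative d) (at z) \<and> d < 0" if "x < z" "z < y" for z
    using gap_deriv[of q z] frc_neg[of z q] that assms by (intro exI[of _ "2 * frc q z"]) auto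
  show "continuous_on {x..y} (gap q)"
    using gap_cont[OF assms(1)] by (rule continuous_on_subset) (use assms in auto)
qed

lemma gap_increasing:
  assumes "-1 < q" "1 \<le> x" "x < y" shows "gap q x < gap q y"
proof (rule DERIV_pos_imp_increasing_open[OF assms(3)])
  show "\<exists>d. (gap q has_real_derivative d) (at z) \<and> d > 0" if "x < z" "z < y" for z
    using gap_deriv[of q z] frc_pos[of z q] that assms by (intro exI[of _ "2 * frc q z"]) auto
  show "continuous_on {x..y} (gap q)"
    using gap_cont[OF assms(1)] by (rule continuous_on_subset) (use assms in auto)
qed

lemma gap_pos: "-1 < q \<Longrightarrow> 0 \<le> y \<Longrightarrow> y \<noteq> 1 \<Longrightarrow> 0 < gap q y"
  using gap_decreasing[of q y 1] gap_increasing[of q 1 y] by (auto simp: gap_1 not_less neq_iff)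

lemma gap_nonneg: "-1 < q \<Longrightarrow> 0 \<le> y \<Longrightarrow> 0 \<le> gap q y"
  using gap_pos[of q y] gap_1[of q] by (cases "y = 1") auto

lemma amp_sq: "-1 < q \<Longrightarrow> 0 \<le> y \<Longrightarrow> (amp q y)\<^sup>2 = gap q y"
  using gap_nonneg[of q y] by (auto simp: amp_def power_mult_distrib sgn_if gap_1)

lemma amp_0: "-1 < q \<Longrightarrow> amp q 0 = - rho0 q"
  by (simp add: amp_def gap_def rho0_def)

lemma rho0_pos: "-1 < q \<Longrightarrow> 0 < rho0 q"
  by (simp add: rho0_def)

lemma rho0_sq: "-1 < q \<Longrightarrow> (rho0 q)\<^sup>2 = 2 / (q + 1)"
  by (simp add: rho0_def)

lemma amp_1 [simp]: "amp q 1 = 0" by (simp add: amp_def)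

lemma amp_strict_mono:
  assumes q: "-1 < q" and "0 \<le> x" "x < y" shows "amp q x < amp q y"
proof -
  consider "y \<le> 1" | "1 \<le> x" | "x < 1" "1 < y" by linarith
  then show ?thesis
  proof cases
    case 1
    then show ?thesis using gap_decreasing[OF q assms(2,3)] gap_pos[OF q, of x] assms gap_1[OF q]
      by (cases "y = 1") (auto simp: amp_def)
  next
    case 2
    then show ?thesis using gap_increasing[OF q 2 assms(3)] gap_pos[OF q, of y] assms gap_1[OF q]
      by (cases "x = 1") (auto simp: amp_def)
  next
    case 3
    have "amp q x < 0" "0 < amp q y" using gap_pos[OF q, of x] gap_pos[OF q, of y] 3 assms
      by (auto simp: amp_def)
    then show ?thesis by linarith
  qed
qed

lemma amp_cont:
  assumes q: "-1 < q" shows "continuous_on {0..} (amp q)"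
proof -
  have 1: "continuous_on {0..1} (\<lambda>y. - sqrt (gap q y))" "continuous_on {1..} (\<lambda>y. sqrt (gap q y))"
    by (intro continuous_intros continuous_on_subset[OF gap_cont[OF q]]; auto)+
  have "continuous_on ({0..1} \<union> {1..}) (\<lambda>y. if y \<le> 1 then - sqrt (gap q y) else sqrt (gap q y))"
    by (rule continuous_on_If) (use 1 gap_1[OF q] in auto)
  moreover have "{0..1} \<union> {1..} = {0::real..}" by auto
  moreover have "amp q = (\<lambda>y. if y \<le> 1 then - sqrt (gap q y) else sqrt (gap q y))"
    using gap_1[OF q] by (auto simp: amp_def sgn_if fun_eq_iff)
  ultimately show ?thesis by simp
qed

text \<open>Convexity of the potential beyond height 1. For \<open>q < 0\<close> the force is
  bounded above and the potential grows only linearly, so a linear lower bound is the right tool for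
  all \<open>q\<close> at once.\<close>

lemma gap_tangent:
  assumes q: "-1 < q" and "2 \<le> y" shows "2 * frc q 2 * (y - 2) \<le> gap q y"
proof (cases "y = 2")
  case False
  then have "2 < y" using assms by simp
  have "\<exists>z. z > 2 \<and> z < y \<and> gap q y - gap q 2 = (y - 2) * (2 * frc q z)"
    by (rule MVT2[OF \<open>2 < y\<close>]) (use q in \<open>auto intro!: gap_deriv\<close>)
  then obtain z where z: "z > 2" "z < y" "gap q y - gap q 2 = (y - 2) * (2 * frc q z)" by blast
  have "(y - 2) * (2 * frc q 2) \<le> (y - 2) * (2 * frc q z)"
    using frc_strict_mono[of 2 z q] z by (intro mult_left_mono) auto
  then show ?thesis using z gap_nonneg[OF q, of 2] by (simp add: algebra_simps)
qed (use gap_nonneg[OF q, of 2] in auto)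

lemma amp_surj:
  assumes q: "-1 < q" and s: "- rho0 q \<le> s" shows "\<exists>y\<ge>0. amp q y = s"
proof -
  \<comment> \<open>At \<open>b\<close> the tangent bound of \<open>gap_tangent\<close> reaches the
    value \<open>s\<^sup>2\<close>.\<close>
  define b where "b = 2 + s\<^sup>2 / (2 * frc q 2)"
  have f2: "0 < frc q 2" by (rule frc_pos) simp
  have b: "2 \<le> b" using f2 by (simp add: b_def)
  have "s\<^sup>2 \<le> gap q b" using gap_tangent[OF q b] f2 by (simp add: b_def)
  then have "s \<le> sqrt (gap q b)" by (simp add: real_le_rsqrt)
  then have "s \<le> amp q b" using b by (simp add: amp_def)
  moreover have "amp q 0 \<le> s" using s amp_0[OF q] by simp
  ultimately have "\<exists>y. 0 \<le> y \<and> y \<le> b \<and> amp q y = s"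
    using b by (intro IVT' continuous_on_subset[OF amp_cont[OF q]]) auto
  then show ?thesis by blast
qed

section \<open>Smoothness of the amplitude across the equilibrium height 1\<close>

definition tay :: "real \<Rightarrow> nat \<Rightarrow> real \<Rightarrow> real" where
  "tay q i y = integral {0..1} (\<lambda>t. (1 - t) * t ^ i * (1 + t * (y - 1)) powr (q - 1 - real i))"

lemma tay_base_pos:
  fixes t y :: real
  assumes "0 \<le> t" "t \<le> 1" "0 < y" shows "0 < 1 + t * (y - 1)"
proof -
  have "1 + t * (y - 1) = (1 - t) + t * y" by (simp add: algebra_simps)
  moreover have "0 < (1 - t) + t * y" using assms by (cases "t = 0") (auto intro!: add_nonneg_pos)
  ultimately show ?thesis by simp
qed

text \<open>Each derivative in \<open>y\<close> brings out one more factor \<open>t\<close> and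
  lowers the exponent by one. The index \<open>i\<close> thus runs through the derivatives of the
  remainder integral \<open>tay q 0\<close>, up to constant factors.\<close>

lemma tay_deriv:
  assumes "0 < y"
  shows "(tay q i has_real_derivative (q - 1 - real i) * tay q (Suc i) y) (at y)"
proof -
  have "((\<lambda>y. integral (cbox 0 1) (\<lambda>t. (1 - t) * t ^ i * (1 + t * (y - 1)) powr (q - 1 - real i)))
      has_field_derivative integral (cbox 0 1)
        (\<lambda>t. (q - 1 - real i) * ((1 - t) * t ^ Suc i * (1 + t * (y - 1)) powr (q - 1 - real (Suc i)))))
      (at y within {0<..})"
  proof (rule leibniz_rule_field_derivative)
    fix x t :: real assume x: "x \<in> {0<..}" and t: "t \<in> cbox 0 1"
    have p: "0 < 1 + t * (x - 1)" using tay_base_pos x t by auto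
    have e: "q - 1 - real (Suc i) = q - 1 - real i - 1" by simp
    show "((\<lambda>x. (1 - t) * t ^ i * (1 + t * (x - 1)) powr (q - 1 - real i)) has_field_derivative
        (q - 1 - real i) * ((1 - t) * t ^ Suc i * (1 + t * (x - 1)) powr (q - 1 - real (Suc i))))
        (at x within {0<..})"
      unfolding e using p by (auto intro!: derivative_eq_intros simp: field_simps)
  next
    fix x :: real assume x: "x \<in> {0<..}"
    show "(\<lambda>t. (1 - t) * t ^ i * (1 + t * (x - 1)) powr (q - 1 - real i)) integrable_on cbox 0 1"
      using tay_base_pos[of _ x] x
      by (intro integrable_continuous continuous_intros) (auto simp: less_imp_neq[symmetric])
  next
    show "continuous_on ({0<..} \<times> cbox 0 1)
        (\<lambda>(x, t). (q - 1 - real i) * ((1 - t) * t ^ Suc i * (1 + t * (x - 1)) powr (q - 1 - real (Suc i))))"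
      unfolding case_prod_beta using tay_base_pos
      by (intro continuous_intros) (auto simp: less_imp_neq[symmetric])
  qed (use assms in auto)
  then have "((\<lambda>y. integral {0..1} (\<lambda>t. (1 - t) * t ^ i * (1 + t * (y - 1)) powr (q - 1 - real i)))
      has_field_derivative (q - 1 - real i) * tay q (Suc i) y) (at y within {0<..})"
    by (simp add: tay_def)
  moreover have "at y within {0<..} = at y" using assms by (intro at_within_open) auto
  ultimately show ?thesis by (simp add: tay_def[abs_def])
qed

lemma tay_pos:
  assumes "0 < y" shows "0 < tay q 0 y"
proof -
  define h where "h = (\<lambda>t. (1 - t) * (1 + t * (y - 1)) powr (q - 1))"
  have c: "continuous_on {0..1} h" unfolding h_def using tay_base_pos[of _ y] assms
    by (intro continuous_intros) (auto simp: less_imp_neq[symmetric])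
  have n: "h x \<ge> 0" if "x \<in> {0..1}" for x using that by (auto simp: h_def)
  have "integral {0..1} h \<noteq> 0"
    using integral_eq_0_iff[OF c _ n] by (auto simp: h_def intro!: bexI[of _ 0])
  moreover have "0 \<le> integral {0..1} h" by (rule integral_nonneg) (use c n in \<open>auto intro: integrable_continuous_interval\<close>)
  ultimately show ?thesis by (simp add: tay_def h_def)
qed

text \<open>Taylor's formula with integral remainder at the equilibrium \<open>y = 1\<close>; it exhibits
  \<^term>\<open>amp q\<close> as a smooth function across \<open>y = 1\<close>.\<close>

lemma gap_taylor:
  assumes q: "-1 < q" and y: "0 < y" shows "gap q y = 2 * (y - 1)\<^sup>2 * tay q 0 y"
proof -
  \<comment> \<open>An antiderivative in \<open>t\<close> along the segment from 1 to
    \<open>y\<close>: in its derivative the two terms with \<open>frc q\<close> cancel and only the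
    remainder integrand is left.\<close>
  define \<Phi> where "\<Phi> = (\<lambda>t. (1 - t) * (y - 1) * frc q (1 + t * (y - 1)) + pot q (1 + t * (y - 1)))"
  have "((\<lambda>t. (y - 1)\<^sup>2 * ((1 - t) * (1 + t * (y - 1)) powr (q - 1))) has_integral \<Phi> 1 - \<Phi> 0) {0..1}"
  proof (rule fundamental_theorem_of_calculus)
    fix t :: real assume "t \<in> {0..1}"
    then have p: "0 < 1 + t * (y - 1)" using tay_base_pos y by auto
    have f: "((\<lambda>t. frc q (1 + t * (y - 1))) has_real_derivative
        (1 + t * (y - 1)) powr (q - 1) * (y - 1)) (at t within {0..1})"
      by (rule DERIV_chain2[where f = "frc q" and g = "\<lambda>t. 1 + t * (y - 1)", OF frc_deriv[OF p]])
        (auto intro!: derivative_eq_intros)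
    have g: "((\<lambda>t. pot q (1 + t * (y - 1))) has_real_derivative
        frc q (1 + t * (y - 1)) * (y - 1)) (at t within {0..1})"
      by (rule DERIV_chain2[where f = "pot q" and g = "\<lambda>t. 1 + t * (y - 1)", OF pot_deriv[OF p q]])
        (auto intro!: derivative_eq_intros)
    have "(\<Phi> has_real_derivative (y - 1)\<^sup>2 * ((1 - t) * (1 + t * (y - 1)) powr (q - 1))) (at t within {0..1})"
      unfolding \<Phi>_def
      by (rule derivative_eq_intros f g refl)+ (simp add: algebra_simps power2_eq_square)
    then show "(\<Phi> has_vector_derivative (y - 1)\<^sup>2 * ((1 - t) * (1 + t * (y - 1)) powr (q - 1))) (at t within {0..1})"
      by (simp add: has_real_derivative_iff_has_vector_derivative)
  qed simp
  then have "integral {0..1} (\<lambda>t. (y - 1)\<^sup>2 * ((1 - t) * (1 + t * (y - 1)) powr (q - 1))) = \<Phi> 1 - \<Phi> 0"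
    by (rule integral_unique)
  then have "(y - 1)\<^sup>2 * tay q 0 y = \<Phi> 1 - \<Phi> 0" by (simp add: tay_def)
  also have "\<dots> = pot q y - pot q 1" by (simp add: \<Phi>_def)
  finally show ?thesis by (simp add: gap_def pot_1[OF q])
qed

lemma amp_taylor:
  assumes q: "-1 < q" and y: "0 < y" shows "amp q y = (y - 1) * sqrt (2 * tay q 0 y)"
proof -
  have "sqrt (gap q y) = \<bar>y - 1\<bar> * sqrt (2 * tay q 0 y)"
    using gap_taylor[OF q y] by (simp add: real_sqrt_mult)
  then show ?thesis by (simp add: amp_def sgn_if)
qed

text \<open>Away from 1 this is \<open>frc q y / amp q y\<close>, by \<open>amp_damp\<close>. The
  expression through \<open>tay\<close> keeps its meaning at \<open>y = 1\<close>, where that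
  quotient is 0/0.\<close>

definition damp :: "real \<Rightarrow> real \<Rightarrow> real" where
  "damp q y = sqrt (2 * tay q 0 y) + (y - 1) * ((q - 1) * tay q 1 y / sqrt (2 * tay q 0 y))"

lemma amp_deriv:
  assumes q: "-1 < q" and y: "0 < y" shows "(amp q has_real_derivative damp q y) (at y)"
proof -
  have "((\<lambda>y. (y - 1) * sqrt (2 * tay q 0 y)) has_real_derivative damp q y) (at y)"
    using tay_pos[OF y, of q]
    by (auto intro!: derivative_eq_intros tay_deriv[OF y, of q 0, simplified] simp: damp_def field_simps)
  moreover have "\<forall>\<^sub>F z in nhds y. amp q z = (z - 1) * sqrt (2 * tay q 0 z)"
    using eventually_nhds_in_open[of "{0<..}" y] y
    by (auto elim!: eventually_mono intro!: amp_taylor[OF q])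
  ultimately show ?thesis by (subst DERIV_cong_ev[OF refl _ refl])
qed

lemma amp_damp:
  assumes q: "-1 < q" and y: "0 < y" shows "amp q y * damp q y = frc q y"
proof -
  have "((\<lambda>y. (amp q y)\<^sup>2) has_real_derivative 2 * (amp q y * damp q y)) (at y)"
    using amp_deriv[OF q y] by (auto intro!: derivative_eq_intros)
  moreover have "\<forall>\<^sub>F z in nhds y. (amp q z)\<^sup>2 = gap q z"
    using eventually_nhds_in_open[of "{0<..}" y] y
    by (auto elim!: eventually_mono intro!: amp_sq[OF q])
  ultimately have "(gap q has_real_derivative 2 * (amp q y * damp q y)) (at y)"
    by (subst (asm) DERIV_cong_ev[OF refl _ refl])
  with gap_deriv[OF q y] show ?thesis by (auto dest: DERIV_unique)
qed

lemma damp_1: "damp q 1 > 0"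
  using tay_pos[of 1 q] by (simp add: damp_def)

lemma damp_pos:
  assumes q: "-1 < q" and y: "0 < y" shows "0 < damp q y"
proof (cases "y = 1")
  case False
  have "0 < frc q y * amp q y"
    using frc_neg[of y q] frc_pos[of y q] amp_strict_mono[OF q, of y 1] amp_strict_mono[OF q, of 1 y] False y
    by (cases "y < 1") (auto simp: mult_neg_neg)
  then have "0 < (amp q y)\<^sup>2 * damp q y"
    by (simp add: power2_eq_square amp_damp[OF q y, symmetric] mult_ac)
  then show ?thesis by (simp add: zero_less_mult_iff)
qed (simp add: damp_1)

definition damp2 :: "real \<Rightarrow> real \<Rightarrow> real" where
  "damp2 q y = (let R = tay q 0 y; w = sqrt (2 * R); R1 = (q - 1) * tay q 1 y; R2 = (q - 2) * (q - 1) * tay q 2 y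
     in 2 * R1 / w + (y - 1) * (R2 / w - R1\<^sup>2 / (w * w * w)))"

lemma damp_deriv:
  assumes y: "0 < y" shows "(damp q has_real_derivative damp2 q y) (at y)"
proof -
  have p: "0 < tay q 0 y" using tay_pos[OF y] .
  have d0: "(tay q 0 has_real_derivative (q - 1) * tay q 1 y) (at y)"
    using tay_deriv[OF y, of q 0] by simp
  have d1: "(tay q 1 has_real_derivative (q - 2) * tay q 2 y) (at y)"
    using tay_deriv[OF y, of q 1] by (simp add: numeral_2_eq_2)
  define w where "w = (\<lambda>y. sqrt (2 * tay q 0 y))"
  have w: "w y > 0" using p by (simp add: w_def)
  have wy: "sqrt (2 * tay q 0 y) = w y" by (simp add: w_def)
  have dw: "(w has_real_derivative (q - 1) * tay q 1 y / w y) (at y)"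
    unfolding w_def using p by (auto intro!: derivative_eq_intros d0 simp: field_simps)
  define r where "r = (\<lambda>y. (q - 1) * tay q 1 y / w y)"
  define r' where "r' = ((q - 1) * ((q - 2) * tay q 2 y) * w y - (q - 1) * tay q 1 y * r y) / (w y * w y)"
  have r: "(r has_real_derivative r') (at y)"
    unfolding r_def r'_def by (rule DERIV_divide[OF DERIV_cmult[OF d1] dw]) (use w in simp)
  have "((\<lambda>y. w y + (y - 1) * r y) has_real_derivative r y + (r y + (y - 1) * r')) (at y)"
    by (rule derivative_eq_intros dw[folded r_def] r refl)+ (simp add: r_def)
  moreover have "r y + (r y + (y - 1) * r') = damp2 q y"
    using w unfolding damp2_def Let_def wy r_def r'_def
    by (simp add: diff_divide_distrib power2_eq_square mult.commute mult.left_commute)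
  ultimately have "((\<lambda>y. w y + (y - 1) * ((q - 1) * tay q 1 y / w y)) has_real_derivative damp2 q y) (at y)"
    unfolding r_def by simp
  then show ?thesis unfolding w_def damp_def[abs_def] .
qed

lemma tay_cont: "continuous_on {0<..} (tay q i)"
  by (rule DERIV_continuous_on, rule has_field_derivative_at_within[OF tay_deriv]) auto

lemma damp2_cont: "continuous_on {0<..} (damp2 q)"
proof -
  have "tay q 0 y \<noteq> 0" if "y \<in> {0<..}" for y using tay_pos[of y q] that by auto
  then show ?thesis unfolding damp2_def Let_def
    by (intro continuous_intros tay_cont) auto
qed

section \<open>The height as a function of the amplitude, and its derivatives\<close>

definition yof :: "real \<Rightarrow> real \<Rightarrow> real" where
  "yof q s = (THE y. 0 \<le> y \<and> amp q y = s)"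

lemma amp_inj: "-1 < q \<Longrightarrow> 0 \<le> x \<Longrightarrow> 0 \<le> y \<Longrightarrow> amp q x = amp q y \<Longrightarrow> x = y"
  using amp_strict_mono[of q x y] amp_strict_mono[of q y x] by linarith

lemma yof_amp: "-1 < q \<Longrightarrow> 0 \<le> y \<Longrightarrow> yof q (amp q y) = y"
  unfolding yof_def by (rule the_equality) (auto intro: amp_inj)

lemma amp_yof: "-1 < q \<Longrightarrow> - rho0 q \<le> s \<Longrightarrow> amp q (yof q s) = s"
  using amp_surj[of q s] yof_amp by metis

lemma yof_nonneg: "-1 < q \<Longrightarrow> - rho0 q \<le> s \<Longrightarrow> 0 \<le> yof q s"
  using amp_surj[of q s] yof_amp by metis

lemma yof_strict_mono:
  assumes "-1 < q" "- rho0 q \<le> s" "s < t" shows "yof q s < yof q t"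
proof (rule ccontr)
  assume n: "\<not> ?thesis"
  have "amp q (yof q t) \<le> amp q (yof q s)"
    using n amp_strict_mono[of q "yof q t" "yof q s"] yof_nonneg[of q t] assms
    by (cases "yof q t = yof q s") auto
  then show False using amp_yof[of q s] amp_yof[of q t] assms by simp
qed

lemma yof_left: "-1 < q \<Longrightarrow> yof q (- rho0 q) = 0"
  using yof_amp[of q 0] by (simp add: amp_0)

lemma yof_0: "-1 < q \<Longrightarrow> yof q 0 = 1"
  using yof_amp[of q 1] by simp

lemma yof_pos: "-1 < q \<Longrightarrow> - rho0 q < s \<Longrightarrow> 0 < yof q s"
  using yof_strict_mono[of q "- rho0 q" s] by (simp add: yof_left)

lemma yof_cont:
  assumes q: "-1 < q" shows "continuous_on {- rho0 q..} (yof q)"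
proof -
  \<comment> \<open>Continued below \<open>- rho0 q\<close> by a line of slope 1, \<open>z\<close>
    becomes a monotone map onto the whole real line, and such a map is continuous.\<close>
  define z where "z = (\<lambda>s. if - rho0 q \<le> s then yof q s else s + rho0 q)"
  have "surj z"
  proof (rule surjI)
    fix y show "z (if 0 \<le> y then amp q y else y - rho0 q) = y"
    proof (cases "0 \<le> y")
      case True
      have "- rho0 q \<le> amp q y" using amp_strict_mono[OF q, of 0 y] True amp_0[OF q] by (cases "y = 0") auto
      then show ?thesis using True by (simp add: z_def yof_amp[OF q])
    qed (auto simp: z_def)
  qed
  moreover have "z x \<le> z y" if "x \<le> y" for x y
    using that yof_strict_mono[OF q, of x y] yof_nonneg[OF q, of y]
    by (cases "x = y") (auto simp: z_def)
  ultimately have "continuous_on UNIV z" by (intro continuous_onI_mono) auto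
  then have "continuous_on {- rho0 q..} z" by (rule continuous_on_subset) auto
  then show ?thesis by (rule continuous_on_eq) (auto simp: z_def)
qed

text \<open>\<^term>\<open>uof q\<close> is the derivative of \<^term>\<open>yof q\<close>; its value at \<open>- rho0 q\<close>, where
  \<^term>\<open>yof q\<close> vanishes, is the limit of \<open>s / frc q (yof q s)\<close>, which is \<open>0\<close> for \<open>q \<le> 0\<close>.\<close>

definition uof :: "real \<Rightarrow> real \<Rightarrow> real" where
  "uof q s = (if s = - rho0 q then max q 0 * rho0 q else 1 / damp q (yof q s))"

lemma uof_pos: "-1 < q \<Longrightarrow> - rho0 q < s \<Longrightarrow> 0 < uof q s"
  using damp_pos[of q "yof q s"] yof_pos[of q s] by (simp add: uof_def)

lemma uof_nonneg: "-1 < q \<Longrightarrow> - rho0 q \<le> s \<Longrightarrow> 0 \<le> uof q s"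
  using uof_pos[of q s] rho0_pos[of q] by (cases "s = - rho0 q") (auto simp: uof_def)

lemma frc_yof_uof: "-1 < q \<Longrightarrow> - rho0 q < s \<Longrightarrow> frc q (yof q s) * uof q s = s"
  using amp_damp[of q "yof q s"] damp_pos[of q "yof q s"] yof_pos[of q s] amp_yof[of q s]
  by (simp add: uof_def field_simps)

lemma yof_deriv:
  assumes q: "-1 < q" and s: "- rho0 q < s" shows "(yof q has_real_derivative uof q s) (at s)"
proof -
  have "(yof q has_real_derivative inverse (damp q (yof q s))) (at s)"
  proof (rule DERIV_inverse_function[where a = "- rho0 q" and b = "s + 1" and f = "amp q"])
    show "(amp q has_real_derivative damp q (yof q s)) (at (yof q s))"
      by (rule amp_deriv[OF q yof_pos[OF q s]])
    show "isCont (yof q) s"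
      using continuous_on_interior[OF yof_cont[OF q]] s by simp
  qed (use s q amp_yof damp_pos[OF q yof_pos[OF q s]] in auto)
  then show ?thesis using s by (simp add: uof_def inverse_eq_divide)
qed

definition uof' :: "real \<Rightarrow> real \<Rightarrow> real" where
  "uof' q s = - (damp2 q (yof q s) * uof q s) / (damp q (yof q s))\<^sup>2"

lemma uof_deriv:
  assumes q: "-1 < q" and s: "- rho0 q < s" shows "(uof q has_real_derivative uof' q s) (at s)"
proof -
  have p: "0 < damp q (yof q s)" by (rule damp_pos[OF q yof_pos[OF q s]])
  have "((\<lambda>s. damp q (yof q s)) has_real_derivative damp2 q (yof q s) * uof q s) (at s)"
    by (rule DERIV_chain2[OF damp_deriv[OF yof_pos[OF q s]] yof_deriv[OF q s]])
  then have "((\<lambda>s. 1 / damp q (yof q s)) has_real_derivative uof' q s) (at s)"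
    using p by (auto intro!: derivative_eq_intros simp: uof'_def power2_eq_square)
  moreover have "\<forall>\<^sub>F t in nhds s. uof q t = 1 / damp q (yof q t)"
    using eventually_mono[OF eventually_nhds_in_open[of "{- rho0 q<..}" s],
        of "\<lambda>t. uof q t = 1 / damp q (yof q t)"] s by (auto simp: uof_def)
  ultimately show ?thesis by (subst DERIV_cong_ev[OF refl _ refl])
qed

lemma frc_tendsto_0:
  assumes "0 < q" shows "(frc q \<longlongrightarrow> - 1 / q) (at_right 0)"
proof -
  have "((\<lambda>y. (y powr q - 1) / q) \<longlongrightarrow> (0 - 1) / q) (at_right 0)"
    using assms by (intro tendsto_intros tendsto_zero_powrI[where b = q])
      (auto simp: eventually_at_right_field intro: exI[of _ 1])
  moreover have "frc q = (\<lambda>y. (y powr q - 1) / q)" using assms by (auto simp: frc_def fun_eq_iff)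
  ultimately show ?thesis by simp
qed

text \<open>For \<open>q < 0\<close> the bound \<open>frc q y \<le> ln y\<close> is
  \<open>1 + x \<le> exp x\<close> at \<open>x = q * ln y\<close>, divided by the negative number
  \<open>q\<close>. The blow-up of the force is why \<open>uof q\<close> vanishes at the contact
  point when \<open>q \<le> 0\<close>.\<close>

lemma frc_at_bot:
  assumes "q \<le> 0" shows "filterlim (frc q) at_bot (at_right 0)"
proof -
  have "frc q y \<le> ln y" if "0 < y" for y
  proof (cases "q = 0")
    case False
    have "1 + q * ln y \<le> y powr q" using exp_ge_add_one_self[of "q * ln y"] that by (simp add: powr_def)
    then have "ln y * q \<le> y powr q - 1" by (simp add: mult.commute)
    then show ?thesis using assms False by (simp add: frc_def neg_divide_le_eq neg_le_divide_eq)
  qed (simp add: frc_def)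
  then have "eventually (\<lambda>y. frc q y \<le> ln y) (at_right 0)"
    by (auto simp: eventually_at_right_field intro: exI[of _ 1])
  then show ?thesis using filterlim_at_bot_mono[OF ln_at_0] by auto
qed

lemma yof_at_right_0:
  assumes q: "-1 < q" shows "filterlim (yof q) (at_right 0) (at_right (- rho0 q))"
proof -
  have "(yof q \<longlongrightarrow> 0) (at (- rho0 q) within {- rho0 q..})"
    using yof_cont[OF q] yof_left[OF q] unfolding continuous_on_def by (metis atLeast_iff order_refl)
  then have "(yof q \<longlongrightarrow> 0) (at_right (- rho0 q))" by (rule tendsto_within_subset) auto
  moreover have "\<forall>\<^sub>F s in at_right (- rho0 q). yof q s \<in> {0<..} \<and> yof q s \<noteq> 0"
    using yof_pos[OF q] by (auto simp: eventually_at_right_field less_imp_neq[symmetric] intro!: exI[of _ 0] rho0_pos[OF q])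
  ultimately show ?thesis by (simp add: filterlim_at)
qed

lemma uof_cont:
  assumes q: "-1 < q" shows "continuous_on {- rho0 q..} (uof q)"
proof -
  have e: "\<forall>\<^sub>F s in at_right (- rho0 q). s / frc q (yof q s) = uof q s"
  proof -
    have "s / frc q (yof q s) = uof q s" if "- rho0 q < s" "s < 0" for s
    proof -
      have "frc q (yof q s) \<noteq> 0"
        using frc_neg[of "yof q s" q] yof_pos[OF q] yof_strict_mono[OF q, of s 0] that yof_0[OF q] by auto
      then show ?thesis using frc_yof_uof[OF q that(1)] by (simp add: field_simps)
    qed
    then show ?thesis using rho0_pos[OF q] by (auto simp: eventually_at_right_field intro!: exI[of _ 0])
  qed
  have id: "((\<lambda>s. s) \<longlongrightarrow> - rho0 q) (at_right (- rho0 q))" by (rule tendsto_ident_at)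
  have "((\<lambda>s. s / frc q (yof q s)) \<longlongrightarrow> uof q (- rho0 q)) (at_right (- rho0 q))"
  proof (cases "0 < q")
    case True
    have "((\<lambda>s. s / frc q (yof q s)) \<longlongrightarrow> - rho0 q / (- 1 / q)) (at_right (- rho0 q))"
      using True by (intro tendsto_divide id filterlim_compose[OF frc_tendsto_0 yof_at_right_0[OF q]]) auto
    then show ?thesis using True by (simp add: uof_def mult.commute)
  next
    case False
    have "((\<lambda>s. s / frc q (yof q s)) \<longlongrightarrow> 0) (at_right (- rho0 q))"
      using False by (intro tendsto_divide_0[OF id]
        filterlim_mono[OF filterlim_compose[OF frc_at_bot yof_at_right_0[OF q]] at_bot_le_at_infinity order_refl]) auto
    then show ?thesis using False by (simp add: uof_def)
  qed
  then have "(uof q \<longlongrightarrow> uof q (- rho0 q)) (at_right (- rho0 q))"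
    using e by (rule Lim_transform_eventually)
  then have 0: "(uof q \<longlongrightarrow> uof q (- rho0 q)) (at (- rho0 q) within {- rho0 q..})"
    by (simp add: at_within_Ici_at_right)
  show ?thesis unfolding continuous_on_def
  proof
    fix s assume "s \<in> {- rho0 q..}"
    then consider "s = - rho0 q" | "- rho0 q < s" by force
    then show "(uof q \<longlongrightarrow> uof q s) (at s within {- rho0 q..})"
    proof cases
      case 2
      then show ?thesis using DERIV_isCont[OF uof_deriv[OF q 2]]
        by (metis continuous_at_imp_continuous_at_within continuous_within)
    qed (use 0 in simp)
  qed
qed

lemma uof'_cont:
  assumes q: "-1 < q" shows "continuous_on {- rho0 q<..} (uof' q)"
proof -
  have y: "continuous_on {- rho0 q<..} (yof q)" "continuous_on {- rho0 q<..} (uof q)"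
    by (rule continuous_on_subset[OF yof_cont[OF q]] continuous_on_subset[OF uof_cont[OF q]]; auto)+
  have s: "yof q ` {- rho0 q<..} \<subseteq> {0<..}" using yof_pos[OF q] by auto
  have "continuous_on {0<..} (damp q)"
    by (rule DERIV_continuous_on, rule has_field_derivative_at_within[OF damp_deriv]) auto
  then show ?thesis unfolding uof'_def
    using damp_pos[OF q] yof_pos[OF q]
    by (intro continuous_intros continuous_on_compose2[OF damp2_cont y(1) s] y
      continuous_on_compose2[OF _ y(1) s]) (auto simp: less_imp_neq[symmetric])
qed

lemma pot_yof:
  assumes q: "-1 < q" and s: "- rho0 q \<le> s" shows "pot q (yof q s) = s\<^sup>2 / 2 - 1 / (q + 1)"
proof -
  have "s\<^sup>2 = gap q (yof q s)" using amp_sq[OF q yof_nonneg[OF q s]] amp_yof[OF q s] by simp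
  then have "s\<^sup>2 = 2 * (pot q (yof q s) + 1 / (q + 1))" by (simp add: gap_def)
  then show ?thesis by (metis add_diff_cancel_right' nonzero_mult_div_cancel_left zero_neq_numeral)
qed

section \<open>Averages over a cycle\<close>

definition cyc :: "real \<Rightarrow> (real \<Rightarrow> real) \<Rightarrow> real" where
  "cyc \<rho> g = integral {0..2 * pi} (\<lambda>t. g (- \<rho> * cos t))"

definition C1_on :: "real \<Rightarrow> (real \<Rightarrow> real) \<Rightarrow> bool" where
  "C1_on R g \<longleftrightarrow> (\<forall>s\<in>{-R<..<R}. (g has_real_derivative deriv g s) (at s)) \<and>
     continuous_on {-R<..<R} (deriv g)"

text \<open>The finite part of the divergent integral of \<open>g (- \<rho> cos t) / (\<rho>\<^sup>2 sin\<^sup>2 t)\<close> over a cycle,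
  defined by integrating by parts against \<open>- cot t\<close> and dropping the boundary terms.\<close>

definition fp :: "real \<Rightarrow> (real \<Rightarrow> real) \<Rightarrow> real" where
  "fp \<rho> g = - cyc \<rho> (\<lambda>s. s * deriv g s) / \<rho>\<^sup>2"

lemma C1_onI:
  assumes "\<And>s. s \<in> {-R<..<R} \<Longrightarrow> (g has_real_derivative g' s) (at s)" "continuous_on {-R<..<R} g'"
  shows "C1_on R g"
proof -
  have d: "deriv g s = g' s" if "s \<in> {-R<..<R}" for s using assms(1)[OF that] by (rule DERIV_imp_deriv)
  have "continuous_on {-R<..<R} (deriv g)" by (rule continuous_on_eq[OF assms(2)]) (simp add: d)
  then show ?thesis using assms(1) d by (auto simp: C1_on_def)
qed

lemma C1_on_deriv: "C1_on R g \<Longrightarrow> s \<in> {-R<..<R} \<Longrightarrow> (g has_real_derivative deriv g s) (at s)"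
  by (auto simp: C1_on_def)

lemma C1_on_cont': "C1_on R g \<Longrightarrow> continuous_on {-R<..<R} (deriv g)"
  by (auto simp: C1_on_def)

lemma C1_on_cont: "C1_on R g \<Longrightarrow> continuous_on {-R<..<R} g"
  by (rule DERIV_continuous_on, rule has_field_derivative_at_within, erule C1_on_deriv)

named_theorems C1_intros

lemma C1_on_const [C1_intros]: "C1_on R (\<lambda>s. c)"
  by (rule C1_onI[where g' = "\<lambda>s. 0"]) auto

lemma C1_on_id [C1_intros]: "C1_on R (\<lambda>s. s)"
  by (rule C1_onI[where g' = "\<lambda>s. 1"]) auto

lemma C1_on_add [C1_intros]:
  assumes "C1_on R f" "C1_on R g" shows "C1_on R (\<lambda>s. f s + g s)"
  by (rule C1_onI[where g' = "\<lambda>s. deriv f s + deriv g s"])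
    (use assms in \<open>auto intro!: continuous_intros C1_on_cont' derivative_eq_intros C1_on_deriv\<close>)

lemma C1_on_mult [C1_intros]:
  assumes "C1_on R f" "C1_on R g" shows "C1_on R (\<lambda>s. f s * g s)"
proof (rule C1_onI[where g' = "\<lambda>s. f s * deriv g s + deriv f s * g s"])
  show "continuous_on {-R<..<R} (\<lambda>s. f s * deriv g s + deriv f s * g s)"
    by (intro continuous_on_add continuous_on_mult C1_on_cont C1_on_cont' assms)
qed (rule DERIV_mult'; rule C1_on_deriv; use assms in auto)

lemma C1_on_uminus [C1_intros]: "C1_on R f \<Longrightarrow> C1_on R (\<lambda>s. - f s)"
  using C1_on_mult[OF C1_on_const[of R "-1"], of f] by simp

lemma C1_on_diff [C1_intros]: "C1_on R f \<Longrightarrow> C1_on R g \<Longrightarrow> C1_on R (\<lambda>s. f s - g s)"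
  using C1_on_add[OF _ C1_on_uminus, of R f g] by simp

lemma C1_on_power [C1_intros]: "C1_on R f \<Longrightarrow> C1_on R (\<lambda>s. f s ^ n)"
  by (induction n) (auto intro: C1_intros)

lemma neg_rho_cos:
  fixes \<rho> t :: real assumes "0 \<le> \<rho>" shows "- \<rho> * cos t \<in> {-\<rho>..\<rho>}"
proof -
  have "\<bar>\<rho> * cos t\<bar> \<le> \<rho>" using assms by (simp add: abs_mult mult_left_le)
  then show ?thesis by auto
qed

lemma neg_rho_cos_less:
  fixes \<rho> t :: real assumes "0 \<le> \<rho>" "\<rho> < R" shows "- \<rho> * cos t \<in> {-R<..<R}"
proof -
  have "- \<rho> \<le> - \<rho> * cos t" "- \<rho> * cos t \<le> \<rho>"
    using neg_rho_cos[OF assms(1)] unfolding atLeastAtMost_iff by blast+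
  then show ?thesis using assms unfolding greaterThanLessThan_iff by linarith
qed

lemma cyc_integrand_cont:
  fixes \<rho> :: real
  assumes "0 \<le> \<rho>" "continuous_on {-\<rho>..\<rho>} g"
  shows "continuous_on S (\<lambda>t. g (- \<rho> * cos t))"
proof (rule continuous_on_compose2[OF assms(2)])
  show "(\<lambda>t. - \<rho> * cos t) ` S \<subseteq> {-\<rho>..\<rho>}" using neg_rho_cos[OF assms(1)] by blast
qed (intro continuous_intros)

lemma cyc_integrable:
  fixes \<rho> :: real and g :: "real \<Rightarrow> real"
  assumes "0 \<le> \<rho>" "continuous_on {-\<rho>..\<rho>} g"
  shows "(\<lambda>t. g (- \<rho> * cos t)) integrable_on {a..b}"
  by (intro integrable_continuous_interval cyc_integrand_cont assms)

lemma cyc_cong: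
  assumes "0 \<le> \<rho>" "\<And>s. s \<in> {-\<rho>..\<rho>} \<Longrightarrow> f s = g s" shows "cyc \<rho> f = cyc \<rho> g"
  unfolding cyc_def by (intro integral_cong assms(2) neg_rho_cos assms(1))

lemma cyc_add:
  assumes "0 \<le> \<rho>" "continuous_on {-\<rho>..\<rho>} f" "continuous_on {-\<rho>..\<rho>} g"
  shows "cyc \<rho> (\<lambda>s. f s + g s) = cyc \<rho> f + cyc \<rho> g"
  unfolding cyc_def by (rule integral_add) (intro cyc_integrable assms)+

lemma cyc_diff:
  assumes "0 \<le> \<rho>" "continuous_on {-\<rho>..\<rho>} f" "continuous_on {-\<rho>..\<rho>} g"
  shows "cyc \<rho> (\<lambda>s. f s - g s) = cyc \<rho> f - cyc \<rho> g"
  unfolding cyc_def by (rule integral_diff) (intro cyc_integrable assms)+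

lemma cyc_cmult: "cyc \<rho> (\<lambda>s. c * g s) = c * cyc \<rho> g"
  unfolding cyc_def by simp

lemma cyc_nonneg:
  assumes "0 \<le> \<rho>" "continuous_on {-\<rho>..\<rho>} g" "\<And>s. s \<in> {-\<rho>..\<rho>} \<Longrightarrow> 0 \<le> g s"
  shows "0 \<le> cyc \<rho> g"
  unfolding cyc_def
  by (intro integral_nonneg cyc_integrable assms) (use neg_rho_cos[OF assms(1)] assms(3) in blast)

lemma cyc_pos:
  assumes "0 \<le> \<rho>" "continuous_on {-\<rho>..\<rho>} g" "\<And>s. s \<in> {-\<rho>..\<rho>} \<Longrightarrow> 0 \<le> g s"
    and "r \<in> {-\<rho>..\<rho>}" "g r \<noteq> 0"
  shows "0 < cyc \<rho> g"
proof -
  have "\<exists>t\<in>{0..2*pi}. - \<rho> * cos t = r"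
  proof (cases "\<rho> = 0")
    case True then show ?thesis using assms(4) by (auto intro!: bexI[of _ 0])
  next
    case False
    then have "\<bar>- r / \<rho>\<bar> \<le> 1" using assms by (auto simp: abs_le_iff divide_simps)
    then have b: "- 1 \<le> - r / \<rho>" "- r / \<rho> \<le> 1" by linarith+
    then have "cos (arccos (- r / \<rho>)) = - r / \<rho>" "0 \<le> arccos (- r / \<rho>)" "arccos (- r / \<rho>) \<le> 2 * pi"
      using arccos_lbound[OF b] arccos_ubound[OF b] by (auto simp only: cos_arccos)
    then show ?thesis using False by (intro bexI[of _ "arccos (- r / \<rho>)"]) auto
  qed
  then have "\<not> (\<forall>t\<in>{0..2*pi}. g (- \<rho> * cos t) = 0)" using assms(5) by blast
  moreover have "(integral {0..2*pi} (\<lambda>t. g (- \<rho> * cos t)) = 0) \<longleftrightarrow> (\<forall>t\<in>{0..2*pi}. g (- \<rho> * cos t) = 0)"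
    by (rule integral_eq_0_iff)
      (use cyc_integrand_cont[OF assms(1,2)] assms(3) neg_rho_cos[OF assms(1)] in \<open>auto\<close>)
  ultimately show ?thesis using cyc_nonneg[OF assms(1-3)] unfolding cyc_def by linarith
qed

locale cycle = fixes R \<rho> :: real assumes rho: "0 < \<rho>" "\<rho> < R"
begin

lemma Icc: "{-\<rho>..\<rho>} \<subseteq> {-R<..<R}" using rho by auto

lemma ccont: "C1_on R g \<Longrightarrow> continuous_on {-\<rho>..\<rho>} g"
  using C1_on_cont continuous_on_subset Icc by blast

lemma ccont': "C1_on R g \<Longrightarrow> continuous_on {-\<rho>..\<rho>} (deriv g)"
  using C1_on_cont' continuous_on_subset Icc by blast

lemma comp_deriv:
  assumes "C1_on R g"
  shows "((\<lambda>t. g (- \<rho> * cos t)) has_real_derivative deriv g (- \<rho> * cos t) * (\<rho> * sin t)) (at t)"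
proof (rule DERIV_chain2[where f = g and g = "\<lambda>t. - \<rho> * cos t"])
  show "(g has_real_derivative deriv g (- \<rho> * cos t)) (at (- \<rho> * cos t))"
    by (rule C1_on_deriv[OF assms neg_rho_cos_less]) (use rho in auto)
qed (auto intro!: derivative_eq_intros)

text \<open>\<open>- \<rho> * sin t * g\<close> has as its derivative in the angle the difference of
  the two integrands, and it vanishes at \<open>0\<close> and \<open>2 * pi\<close>; so integration
  by parts over a cycle leaves no boundary term.\<close>

lemma cyc_parts:
  assumes "C1_on R g"
  shows "cyc \<rho> (\<lambda>s. s * g s) = cyc \<rho> (\<lambda>s. (\<rho>\<^sup>2 - s\<^sup>2) * deriv g s)"
proof -
  let ?s = "\<lambda>t. - \<rho> * cos t"
  have "((\<lambda>t. ?s t * g (?s t) - (\<rho>\<^sup>2 - (?s t)\<^sup>2) * deriv g (?s t)) has_integral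
      (- \<rho> * sin (2 * pi) * g (?s (2 * pi))) - (- \<rho> * sin 0 * g (?s 0))) {0..2 * pi}"
  proof (rule fundamental_theorem_of_calculus)
    fix t :: real
    have w: "\<rho>\<^sup>2 - (- \<rho> * cos t)\<^sup>2 = \<rho> * sin t * (\<rho> * sin t)"
    proof -
      have "\<rho>\<^sup>2 - (- \<rho> * cos t)\<^sup>2 = \<rho>\<^sup>2 * (1 - (cos t)\<^sup>2)" by (simp add: power_mult_distrib algebra_simps)
      also have "\<dots> = \<rho> * sin t * (\<rho> * sin t)"
        using sin_squared_eq[of t] by (simp add: power2_eq_square)
      finally show ?thesis .
    qed
    have "((\<lambda>t. - \<rho> * sin t * g (?s t)) has_real_derivative
        ?s t * g (?s t) - (\<rho>\<^sup>2 - (?s t)\<^sup>2) * deriv g (?s t)) (at t)"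
      unfolding w by (rule derivative_eq_intros comp_deriv[OF assms] refl)+ (simp add: algebra_simps)
    then show "((\<lambda>t. - \<rho> * sin t * g (?s t)) has_vector_derivative
        ?s t * g (?s t) - (\<rho>\<^sup>2 - (?s t)\<^sup>2) * deriv g (?s t)) (at t within {0..2 * pi})"
      unfolding has_real_derivative_iff_has_vector_derivative[symmetric]
      by (rule has_field_derivative_at_within)
  qed simp
  then have "cyc \<rho> (\<lambda>s. s * g s - (\<rho>\<^sup>2 - s\<^sup>2) * deriv g s) = 0"
    by (simp add: cyc_def integral_unique)
  moreover have "cyc \<rho> (\<lambda>s. s * g s - (\<rho>\<^sup>2 - s\<^sup>2) * deriv g s)
      = cyc \<rho> (\<lambda>s. s * g s) - cyc \<rho> (\<lambda>s. (\<rho>\<^sup>2 - s\<^sup>2) * deriv g s)"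
    using rho by (intro cyc_diff continuous_intros ccont' ccont assms) auto
  ultimately show ?thesis by simp
qed

lemma fp_cong:
  assumes "\<And>s. s \<in> {-R<..<R} \<Longrightarrow> f s = g s" shows "fp \<rho> f = fp \<rho> g"
proof -
  have "deriv f s = deriv g s" if "s \<in> {-\<rho>..\<rho>}" for s
    using assms Icc that
    by (intro deriv_cong_ev eventually_mono[OF eventually_nhds_in_open[of "{-R<..<R}" s]]) auto
  then show ?thesis unfolding fp_def using rho by (subst cyc_cong[of \<rho>]) auto
qed

lemma deriv_add':
  assumes "C1_on R f" "C1_on R g" "s \<in> {-R<..<R}"
  shows "deriv (\<lambda>s. f s + g s) s = deriv f s + deriv g s"
  using assms by (intro DERIV_imp_deriv DERIV_add C1_on_deriv)

lemma deriv_mult':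
  assumes "C1_on R f" "C1_on R g" "s \<in> {-R<..<R}"
  shows "deriv (\<lambda>s. f s * g s) s = f s * deriv g s + deriv f s * g s"
  using assms by (intro DERIV_imp_deriv DERIV_mult' C1_on_deriv)

lemma fp_add:
  assumes "C1_on R f" "C1_on R g" shows "fp \<rho> (\<lambda>s. f s + g s) = fp \<rho> f + fp \<rho> g"
proof -
  have "cyc \<rho> (\<lambda>s. s * deriv (\<lambda>s. f s + g s) s) = cyc \<rho> (\<lambda>s. s * deriv f s + s * deriv g s)"
    by (rule cyc_cong) (use rho Icc deriv_add'[OF assms] in \<open>auto simp: distrib_left\<close>)
  also have "\<dots> = cyc \<rho> (\<lambda>s. s * deriv f s) + cyc \<rho> (\<lambda>s. s * deriv g s)"
    using rho by (intro cyc_add continuous_intros ccont' assms) auto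
  finally show ?thesis unfolding fp_def by (simp add: add_divide_distrib diff_divide_distrib)
qed

lemma fp_cmult:
  assumes "C1_on R f" shows "fp \<rho> (\<lambda>s. c * f s) = c * fp \<rho> f"
proof -
  have "cyc \<rho> (\<lambda>s. s * deriv (\<lambda>s. c * f s) s) = cyc \<rho> (\<lambda>s. c * (s * deriv f s))"
    by (rule cyc_cong) (use rho Icc deriv_mult'[OF C1_on_const assms] in auto)
  then show ?thesis unfolding fp_def by (simp add: cyc_cmult)
qed

text \<open>A factor \<open>s\<close> turns the singular weight into a multiple of the derivative of
  \<open>1 / sin t\<close>, and the remaining \<open>1 / sin t\<close> is cancelled by the
  derivative of \<open>g (- \<rho> * cos t)\<close>. This rule and \<open>fp_w\<close> carry all
  explicit evaluations of finite parts below.\<close>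

lemma fp_s:
  assumes "C1_on R g" shows "fp \<rho> (\<lambda>s. s * g s) = - cyc \<rho> (deriv g)"
proof -
  have "cyc \<rho> (\<lambda>s. s * deriv (\<lambda>s. s * g s) s) = cyc \<rho> (\<lambda>s. s * g s + s\<^sup>2 * deriv g s)"
    by (rule cyc_cong)
      (use rho Icc deriv_mult'[OF C1_on_id assms] in \<open>auto simp: algebra_simps power2_eq_square\<close>)
  also have "\<dots> = cyc \<rho> (\<lambda>s. s * g s) + cyc \<rho> (\<lambda>s. s\<^sup>2 * deriv g s)"
    using rho by (intro cyc_add continuous_intros ccont' ccont assms) auto
  also have "\<dots> = cyc \<rho> (\<lambda>s. (\<rho>\<^sup>2 - s\<^sup>2) * deriv g s + s\<^sup>2 * deriv g s)"
    using rho unfolding cyc_parts[OF assms]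
    by (intro cyc_add[symmetric] continuous_intros ccont' ccont assms) auto
  also have "(\<lambda>s. (\<rho>\<^sup>2 - s\<^sup>2) * deriv g s + s\<^sup>2 * deriv g s) = (\<lambda>s. \<rho>\<^sup>2 * deriv g s)"
    by (simp add: algebra_simps)
  finally have "cyc \<rho> (\<lambda>s. s * deriv (\<lambda>s. s * g s) s) = \<rho>\<^sup>2 * cyc \<rho> (deriv g)"
    unfolding cyc_cmult .
  then show ?thesis using rho by (simp add: fp_def)
qed

text \<open>On the cycle \<open>\<rho>\<^sup>2 - s\<^sup>2\<close> is
  \<open>\<rho>\<^sup>2 * (sin t)\<^sup>2\<close>, which cancels the singular denominator: the
  finite part is a convergent integral here.\<close>

lemma fp_w:
  assumes "C1_on R g" shows "fp \<rho> (\<lambda>s. (\<rho>\<^sup>2 - s\<^sup>2) * g s) = cyc \<rho> g"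
proof -
  have w: "C1_on R (\<lambda>s. \<rho>\<^sup>2 - s\<^sup>2)" by (intro C1_intros)
  have dw: "deriv (\<lambda>s. \<rho>\<^sup>2 - s\<^sup>2) s = - 2 * s" for s
    by (rule DERIV_imp_deriv) (auto intro!: derivative_eq_intros)
  have "cyc \<rho> (\<lambda>s. s * deriv (\<lambda>s. (\<rho>\<^sup>2 - s\<^sup>2) * g s) s)
      = cyc \<rho> (\<lambda>s. (\<rho>\<^sup>2 - s\<^sup>2) * deriv (\<lambda>s. s * g s) s - (\<rho>\<^sup>2 - s\<^sup>2) * g s - 2 * (s * (s * g s)))"
  proof (rule cyc_cong)
    fix s assume "s \<in> {-\<rho>..\<rho>}"
    then have s: "s \<in> {-R<..<R}" using Icc by blast
    have 1: "deriv (\<lambda>s. (\<rho>\<^sup>2 - s\<^sup>2) * g s) s = (\<rho>\<^sup>2 - s\<^sup>2) * deriv g s - 2 * s * g s"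
      using deriv_mult'[OF w assms s] by (simp add: dw)
    have 2: "deriv (\<lambda>s. s * g s) s = s * deriv g s + g s"
      using deriv_mult'[OF C1_on_id assms s] by simp
    show "s * deriv (\<lambda>s. (\<rho>\<^sup>2 - s\<^sup>2) * g s) s
        = (\<rho>\<^sup>2 - s\<^sup>2) * deriv (\<lambda>s. s * g s) s - (\<rho>\<^sup>2 - s\<^sup>2) * g s - 2 * (s * (s * g s))"
      unfolding 1 2 by (simp add: algebra_simps)
  qed (use rho in simp)
  also have "\<dots> = cyc \<rho> (\<lambda>s. (\<rho>\<^sup>2 - s\<^sup>2) * deriv (\<lambda>s. s * g s) s - (\<rho>\<^sup>2 - s\<^sup>2) * g s)
      - cyc \<rho> (\<lambda>s. 2 * (s * (s * g s)))"
    using rho by (intro cyc_diff continuous_intros ccont' ccont assms C1_intros) auto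
  also have "cyc \<rho> (\<lambda>s. (\<rho>\<^sup>2 - s\<^sup>2) * deriv (\<lambda>s. s * g s) s - (\<rho>\<^sup>2 - s\<^sup>2) * g s)
      = cyc \<rho> (\<lambda>s. (\<rho>\<^sup>2 - s\<^sup>2) * deriv (\<lambda>s. s * g s) s) - cyc \<rho> (\<lambda>s. (\<rho>\<^sup>2 - s\<^sup>2) * g s)"
    using rho by (intro cyc_diff continuous_intros ccont' ccont assms C1_intros) auto
  also have "cyc \<rho> (\<lambda>s. (\<rho>\<^sup>2 - s\<^sup>2) * deriv (\<lambda>s. s * g s) s) = cyc \<rho> (\<lambda>s. s * (s * g s))"
    by (rule cyc_parts[symmetric]) (intro C1_intros assms)
  also have "cyc \<rho> (\<lambda>s. s * (s * g s)) - cyc \<rho> (\<lambda>s. (\<rho>\<^sup>2 - s\<^sup>2) * g s) - cyc \<rho> (\<lambda>s. 2 * (s * (s * g s)))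
      = - (cyc \<rho> (\<lambda>s. s * (s * g s)) + cyc \<rho> (\<lambda>s. (\<rho>\<^sup>2 - s\<^sup>2) * g s))"
    by (simp add: cyc_cmult)
  also have "cyc \<rho> (\<lambda>s. s * (s * g s)) + cyc \<rho> (\<lambda>s. (\<rho>\<^sup>2 - s\<^sup>2) * g s)
      = cyc \<rho> (\<lambda>s. s * (s * g s) + (\<rho>\<^sup>2 - s\<^sup>2) * g s)"
    using rho by (intro cyc_add[symmetric] continuous_intros ccont' ccont assms C1_intros) auto
  also have "(\<lambda>s. s * (s * g s) + (\<rho>\<^sup>2 - s\<^sup>2) * g s) = (\<lambda>s. \<rho>\<^sup>2 * g s)"
    by (simp add: algebra_simps power2_eq_square)
  finally have "cyc \<rho> (\<lambda>s. s * deriv (\<lambda>s. (\<rho>\<^sup>2 - s\<^sup>2) * g s) s) = - (\<rho>\<^sup>2 * cyc \<rho> g)"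
    unfolding cyc_cmult .
  then show ?thesis using rho by (simp add: fp_def)
qed

text \<open>At a fixed angle \<open>s = - \<rho> * cos t\<close> moves with velocity
  \<open>s / \<rho>\<close>. The resulting integrand \<open>s * deriv g s / \<rho>\<close> is
  regular at the turning points and is precisely the regularization built into
  \<open>fp\<close>.\<close>

lemma cyc_rho_deriv:
  assumes g: "C1_on R g"
  shows "((\<lambda>\<rho>. cyc \<rho> g) has_real_derivative - \<rho> * fp \<rho> g) (at \<rho>)"
proof -
  have in': "- r * cos t \<in> {-R<..<R}" if "r \<in> {0<..<R}" for r t
    using neg_rho_cos_less[of r R t] that by auto
  have "((\<lambda>\<rho>. integral (cbox 0 (2 * pi)) (\<lambda>t. g (- \<rho> * cos t))) has_field_derivative
      integral (cbox 0 (2 * pi)) (\<lambda>t. deriv g (- \<rho> * cos t) * (- cos t))) (at \<rho> within {0<..<R})"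
  proof (rule leibniz_rule_field_derivative)
    fix r t :: real assume r: "r \<in> {0<..<R}"
    show "((\<lambda>\<rho>. g (- \<rho> * cos t)) has_field_derivative deriv g (- r * cos t) * (- cos t)) (at r within {0<..<R})"
      by (rule DERIV_chain2[where f = g and g = "\<lambda>r. - r * cos t", OF C1_on_deriv[OF g in'[OF r]]])
        (auto intro!: derivative_eq_intros)
  next
    fix r assume "r \<in> {0<..<R}"
    then have "continuous_on {-r..r} g" by (intro continuous_on_subset[OF C1_on_cont[OF g]]) auto
    then show "(\<lambda>t. g (- r * cos t)) integrable_on cbox 0 (2 * pi)"
      using cyc_integrable[of r g 0 "2 * pi"] \<open>r \<in> {0<..<R}\<close> by simp
  next
    show "continuous_on ({0<..<R} \<times> cbox 0 (2 * pi)) (\<lambda>(r, t). deriv g (- r * cos t) * (- cos t))"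
      unfolding case_prod_beta
      by (intro continuous_intros continuous_on_compose2[OF C1_on_cont'[OF g]]) (use in' in auto)
  qed (use rho in auto)
  moreover have "at \<rho> within {0<..<R} = at \<rho>" using rho by (intro at_within_open) auto
  moreover have "integral (cbox 0 (2 * pi)) (\<lambda>t. deriv g (- \<rho> * cos t) * (- cos t))
      = cyc \<rho> (\<lambda>s. (1 / \<rho>) * (s * deriv g s))"
    using rho by (simp add: cyc_def mult.commute)
  moreover have "\<dots> = - \<rho> * fp \<rho> g"
    unfolding cyc_cmult using rho by (simp add: fp_def power2_eq_square)
  ultimately show ?thesis by (simp add: cyc_def[abs_def])
qed

end

section \<open>Finite parts of functions with a double zero at the turning points\<close>

context cycle begin

text \<open>Since \<open>z\<close> vanishes at the turning points,
  \<open>z (- \<rho> * cos t)\<close> vanishes there faster than \<open>sin t\<close>. The boundary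
  terms with the cotangent therefore disappear, and the right side is the convergent integral of
  \<open>g / (sin t)\<^sup>2\<close>, which dominates that of \<open>g\<close>. Half cycles are used
  because the cotangent is singular at \<open>pi\<close> as well.\<close>

lemma cot_parts:
  assumes z: "C1_on R z" and u: "C1_on R u" and "z \<rho> = 0" "z (- \<rho>) = 0"
    and nn: "\<And>s. s \<in> {-\<rho>..\<rho>} \<Longrightarrow> 0 \<le> u s"
    and c: "c = 0 \<or> c = pi"
  defines "g \<equiv> \<lambda>s. z s * z s * u s"
  shows "integral {c..c + pi} (\<lambda>t. g (- \<rho> * cos t))
    \<le> integral {c..c + pi} (\<lambda>t. \<rho> * cos t * deriv g (- \<rho> * cos t))"
proof -
  let ?s = "\<lambda>t. - \<rho> * cos t"
  have g: "C1_on R g" unfolding g_def by (intro C1_intros z u)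
  \<comment> \<open>One factor \<open>z\<close> is paired with \<open>1 / sin t\<close>. Their
    quotient tends to 0 at a turning point, and division by zero yields the same value, so
    \<open>G\<close> is continuous throughout.\<close>
  define G where "G = (\<lambda>t. cos t * z (?s t) * u (?s t) * (z (?s t) / sin t))"
  have sd: "z (?s d) = 0" if "d = c \<or> d = c + pi" for d
    using c that assms(3,4) by auto
  have cont: "isCont (\<lambda>t. h (?s t)) t" if "C1_on R h" for h t
    using comp_deriv[OF that] by (rule DERIV_isCont)
  have Gc: "isCont G t" for t
  proof -
    have r: "((\<lambda>t. z (?s t) / sin t) \<longlongrightarrow> z (?s t) / sin t) (at t)"
    proof (cases "sin t = 0")
      case False
      have "isCont (\<lambda>t. z (?s t) / sin t) t" by (intro continuous_intros cont z False)
      then show ?thesis by (simp add: isCont_def)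
    next
      case True
      then have ct: "cos t = 1 \<or> cos t = -1" by (metis sin_zero_abs_cos_one abs_1 abs_eq_iff)
      then have zt: "z (?s t) = 0" using assms(3,4) by auto
      have "((\<lambda>x. (z (?s x) - z (?s t)) / (x - t)) \<longlongrightarrow> 0) (at t)"
        using comp_deriv[OF z, of t] True by (simp add: has_field_derivative_iff)
      moreover have "((\<lambda>x. (sin x - sin t) / (x - t)) \<longlongrightarrow> cos t) (at t)"
        using DERIV_sin[of t] by (simp add: has_field_derivative_iff)
      ultimately have "((\<lambda>x. ((z (?s x) - z (?s t)) / (x - t)) / ((sin x - sin t) / (x - t))) \<longlongrightarrow> 0 / cos t) (at t)"
        by (rule tendsto_divide) (use ct in auto)
      moreover have "\<forall>\<^sub>F x in at t. ((z (?s x) - z (?s t)) / (x - t)) / ((sin x - sin t) / (x - t)) = z (?s x) / sin x"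
        unfolding eventually_at_filter by (rule always_eventually) (simp add: zt[simplified] True)
      ultimately show ?thesis by (simp add: True Lim_transform_eventually)
    qed
    have "((\<lambda>t. cos t * z (?s t) * u (?s t)) \<longlongrightarrow> cos t * z (?s t) * u (?s t)) (at t)"
      using cont[OF z, of t] cont[OF u, of t] by (intro tendsto_intros) (auto simp: isCont_def)
    from tendsto_mult[OF this r] show ?thesis by (simp add: isCont_def G_def)
  qed
  have G0: "G c = 0" "G (c + pi) = 0" using sd[of c] sd[of "c + pi"] by (simp_all add: G_def)
  have Geq: "G t = cos t / sin t * g (?s t)" for t by (simp add: G_def g_def)
  have "((\<lambda>t. \<rho> * cos t * deriv g (?s t) - g (?s t) / (sin t)\<^sup>2) has_integral G (c + pi) - G c) {c..c + pi}"
  proof (rule fundamental_theorem_of_calculus_interior)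
    fix t assume "t \<in> {c<..<c + pi}"
    then have sn: "sin t \<noteq> 0" using c sin_gt_zero[of t] sin_gt_zero[of "t - pi"] by (auto simp: sin_diff)
    have "((\<lambda>t. cos t / sin t * g (?s t)) has_real_derivative
        (- sin t * sin t - cos t * cos t) / (sin t * sin t) * g (?s t)
          + deriv g (?s t) * (\<rho> * sin t) * (cos t / sin t)) (at t)"
      by (rule derivative_eq_intros comp_deriv[OF g] refl sn)+ (simp add: mult.commute)
    moreover have "(- sin t * sin t - cos t * cos t) / (sin t * sin t) * g (?s t)
          + deriv g (?s t) * (\<rho> * sin t) * (cos t / sin t)
        = \<rho> * cos t * deriv g (?s t) - g (?s t) / (sin t)\<^sup>2"
    proof -
      have "- sin t * sin t - cos t * cos t = - 1"
        using sin_cos_squared_add[of t] by (simp add: power2_eq_square)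
      then show ?thesis using sn by (simp add: power2_eq_square mult_ac)
    qed
    ultimately have "(G has_real_derivative \<rho> * cos t * deriv g (?s t) - g (?s t) / (sin t)\<^sup>2) (at t)"
      by (simp add: Geq[abs_def])
    then show "(G has_vector_derivative \<rho> * cos t * deriv g (?s t) - g (?s t) / (sin t)\<^sup>2) (at t)"
      by (simp add: has_real_derivative_iff_has_vector_derivative)
  qed (use Gc in \<open>auto intro: continuous_at_imp_continuous_on\<close>)
  then have 1: "((\<lambda>t. \<rho> * cos t * deriv g (?s t) - g (?s t) / (sin t)\<^sup>2) has_integral 0) {c..c + pi}"
    by (simp add: G0)
  have "(\<lambda>t. (\<lambda>s. - s * deriv g s) (?s t)) integrable_on {c..c + pi}"
    using rho by (intro cyc_integrable continuous_intros ccont' g) auto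
  then have 2: "((\<lambda>t. \<rho> * cos t * deriv g (?s t)) has_integral
      integral {c..c + pi} (\<lambda>t. \<rho> * cos t * deriv g (?s t))) {c..c + pi}"
    by (simp add: has_integral_integral)
  have 3: "((\<lambda>t. g (?s t)) has_integral integral {c..c + pi} (\<lambda>t. g (?s t))) {c..c + pi}"
    using cyc_integrable[OF _ ccont[OF g], of c "c + pi"] rho by (simp add: has_integral_integral)
  have 4: "((\<lambda>t. g (?s t) / (sin t)\<^sup>2) has_integral
      integral {c..c + pi} (\<lambda>t. \<rho> * cos t * deriv g (?s t))) {c..c + pi}"
    using has_integral_diff[OF 2 1] by simp
  show ?thesis
  proof (rule has_integral_le[OF 3 4])
    fix t :: real
    have gn: "0 \<le> g (?s t)" unfolding g_def using nn neg_rho_cos[of \<rho> t] rho by auto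
    show "g (?s t) \<le> g (?s t) / (sin t)\<^sup>2"
    proof (cases "sin t = 0")
      case True
      then have "cos t = 1 \<or> cos t = -1" by (metis sin_zero_abs_cos_one abs_1 abs_eq_iff)
      then show ?thesis using assms(3,4) by (auto simp: g_def True)
    next
      case False
      have "(sin t)\<^sup>2 \<le> 1" using abs_sin_le_one[of t] by (simp add: abs_square_le_1)
      then have "g (?s t) * (sin t)\<^sup>2 \<le> g (?s t)" using gn mult_left_le by blast
      then show ?thesis using False by (simp add: le_divide_eq)
    qed
  qed
qed

lemma fp_square_ge:
  assumes z: "C1_on R z" and u: "C1_on R u" and "z \<rho> = 0" "z (- \<rho>) = 0"
    and nn: "\<And>s. s \<in> {-\<rho>..\<rho>} \<Longrightarrow> 0 \<le> u s"
  shows "cyc \<rho> (\<lambda>s. z s * z s * u s) / \<rho>\<^sup>2 \<le> fp \<rho> (\<lambda>s. z s * z s * u s)"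
proof -
  let ?g = "\<lambda>s. z s * z s * u s"
  have g: "C1_on R ?g" by (intro C1_intros z u)
  have split: "integral {0..2 * pi} (\<lambda>t. h (- \<rho> * cos t))
      = integral {0..0 + pi} (\<lambda>t. h (- \<rho> * cos t)) + integral {pi..pi + pi} (\<lambda>t. h (- \<rho> * cos t))"
    if "continuous_on {-\<rho>..\<rho>} h" for h :: "real \<Rightarrow> real"
    using Henstock_Kurzweil_Integration.integral_combine[of 0 pi "2 * pi" "\<lambda>t. h (- \<rho> * cos t)"]
      cyc_integrable[OF _ that, of 0 "2 * pi"] rho by simp
  have "cyc \<rho> ?g \<le> integral {0..2 * pi} (\<lambda>t. (\<lambda>s. - s * deriv ?g s) (- \<rho> * cos t))"
    unfolding cyc_def
    using split[OF ccont[OF g]] split[of "\<lambda>s. - s * deriv ?g s"]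
      cot_parts[OF assms, of 0] cot_parts[OF assms, of pi]
    by (simp add: continuous_intros ccont'[OF g])
  also have "\<dots> = - cyc \<rho> (\<lambda>s. s * deriv ?g s)" by (simp add: cyc_def)
  finally show ?thesis unfolding fp_def by (rule divide_right_mono) simp
qed

end

section \<open>The Hessian of the action\<close>

definition period :: "real \<Rightarrow> real \<Rightarrow> real" where
  "period q \<rho> = cyc \<rho> (uof q)"

definition mass :: "real \<Rightarrow> real \<Rightarrow> real" where
  "mass q \<rho> = cyc \<rho> (\<lambda>s. yof q s * uof q s)"

definition kinetic :: "real \<Rightarrow> real \<Rightarrow> real" where
  "kinetic q \<rho> = cyc \<rho> (\<lambda>s. (\<rho>\<^sup>2 - s\<^sup>2) * uof q s) / 2"

definition level :: "real \<Rightarrow> real \<Rightarrow> real" where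
  "level q \<rho> = \<rho>\<^sup>2 / 2 - 1 / (q + 1)"

text \<open>A derivative with respect to the level, not to \<open>\<rho>\<close>; since
  \<open>d level = \<rho> d\<rho>\<close>, \<open>period_deriv\<close> carries a factor
  \<open>\<rho>\<close>.\<close>

definition dperiod :: "real \<Rightarrow> real \<Rightarrow> real" where
  "dperiod q \<rho> = - fp \<rho> (uof q)"

text \<open>By \<open>fp_area\<close> this is
  \<open>- fp \<rho> (\<lambda>s. yof q s * uof q s)\<close>. The form comes from writing the height
  as \<open>E - (q + 1) * level\<close>: the derivative of the period along the scaling direction
  \<open>E\<close> is known exactly.\<close>

definition dmass :: "real \<Rightarrow> real \<Rightarrow> real" where
  "dmass q \<rho> = (1 - q) / 2 * period q \<rho> - (q + 1) * level q \<rho> * dperiod q \<rho>"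

locale film_cycle = cycle "rho0 q" \<rho> for q \<rho> +
  assumes q: "-1 < q"
begin

abbreviation "Y \<equiv> yof q"
abbreviation "U \<equiv> uof q"
abbreviation "F \<equiv> \<lambda>s. frc q (yof q s)"

lemma Y_C1 [C1_intros]: "C1_on (rho0 q) Y"
  by (rule C1_onI[where g' = U]) (auto intro!: yof_deriv q intro: continuous_on_subset[OF uof_cont[OF q]])

lemma U_C1 [C1_intros]: "C1_on (rho0 q) U"
  by (rule C1_onI[where g' = "uof' q"]) (auto intro!: uof_deriv q intro: continuous_on_subset[OF uof'_cont[OF q]])

lemma Y_pos: "s \<in> {-rho0 q<..<rho0 q} \<Longrightarrow> 0 < Y s"
  using yof_pos[OF q] by auto

lemma U_pos: "s \<in> {-rho0 q<..<rho0 q} \<Longrightarrow> 0 < U s"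
  using uof_pos[OF q] by auto

lemma deriv_Y: "s \<in> {-rho0 q<..<rho0 q} \<Longrightarrow> deriv Y s = U s"
  by (intro DERIV_imp_deriv yof_deriv q) auto

lemma powr_Y_deriv:
  assumes "s \<in> {-rho0 q<..<rho0 q}"
  shows "((\<lambda>s. Y s powr a) has_real_derivative a * Y s powr (a - 1) * U s) (at s)"
  using DERIV_powr[OF yof_deriv[OF q], of s "\<lambda>_. a" 0] Y_pos[OF assms] assms
  by (auto simp: field_simps powr_diff)

lemma powr_Y_C1 [C1_intros]: "C1_on (rho0 q) (\<lambda>s. Y s powr a)"
proof (rule C1_onI[OF powr_Y_deriv])
  show "continuous_on {-rho0 q<..<rho0 q} (\<lambda>s. a * Y s powr (a - 1) * U s)"
    using Y_pos by (intro continuous_intros C1_on_cont Y_C1 U_C1) (auto simp: less_imp_neq[symmetric])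
qed

lemma F_deriv:
  assumes "s \<in> {-rho0 q<..<rho0 q}"
  shows "(F has_real_derivative Y s powr (q - 1) * U s) (at s)"
  by (rule DERIV_chain2[OF frc_deriv[OF Y_pos[OF assms]] yof_deriv[OF q]]) (use assms in auto)

lemma F_C1 [C1_intros]: "C1_on (rho0 q) F"
  by (rule C1_onI[OF F_deriv], assumption, rule C1_on_cont, intro C1_intros)

lemma F_U: "s \<in> {-rho0 q<..<rho0 q} \<Longrightarrow> F s * U s = s"
  using frc_yof_uof[OF q] by auto

abbreviation "per \<equiv> period q \<rho>"
abbreviation "area \<equiv> mass q \<rho>"
abbreviation "act \<equiv> kinetic q \<rho>"
abbreviation "kap \<equiv> level q \<rho>"
text \<open>The scaling direction: the velocity at dilation factor 1 of level and multiplier,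
  combined into an affine function of the height. It is unrelated to \<open>E_fun\<close>.\<close>

definition "E s = Y s + (q + 1) * kap"

lemma E_C1 [C1_intros]: "C1_on (rho0 q) E"
  unfolding E_def by (intro C1_intros)

text \<open>This is \<open>pot_euler\<close> along the orbit. The right side is a multiple of
  \<open>s\<close> plus a multiple of \<open>\<rho>\<^sup>2 - s\<^sup>2\<close>, the two shapes that
  \<open>fp_s\<close> and \<open>fp_w\<close> evaluate.\<close>

lemma euler_U:
  assumes "s \<in> {-rho0 q<..<rho0 q}"
  shows "E s * U s = s * Y s + (\<rho>\<^sup>2 - s\<^sup>2) * ((q + 1) / 2 * U s)"
proof -
  have "Y s = Y s * F s - (q + 1) * (s\<^sup>2 / 2 - 1 / (q + 1))"
    using pot_euler[OF Y_pos[OF assms] q] pot_yof[OF q, of s] assms by simp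
  then have "Y s * U s = Y s * (F s * U s) - (q + 1) * (s\<^sup>2 / 2 - 1 / (q + 1)) * U s"
    by (metis left_diff_distrib mult.assoc)
  then show ?thesis unfolding E_def level_def F_U[OF assms] using q
    by (simp add: field_simps)
qed

lemma kap_neg: "kap < 0"
proof -
  have "\<rho>\<^sup>2 < (rho0 q)\<^sup>2" using rho by (simp add: power_strict_mono)
  then show ?thesis using q by (simp add: level_def rho0_sq)
qed

lemma in_R: "s \<in> {-\<rho>..\<rho>} \<Longrightarrow> s \<in> {-rho0 q<..<rho0 q}"
  using Icc by blast

lemma per_pos: "0 < per" unfolding period_def
  by (rule cyc_pos[of \<rho> _ 0]) (use rho U_pos[OF in_R] in \<open>auto intro!: ccont C1_intros simp: less_imp_le less_imp_neq[symmetric]\<close>)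

lemma area_pos: "0 < area" unfolding mass_def
  by (rule cyc_pos[of \<rho> _ 0]) (use rho U_pos[OF in_R] Y_pos[OF in_R] in
     \<open>auto intro!: ccont C1_intros simp: less_imp_le less_imp_neq[symmetric]\<close>)

lemma act_nonneg: "0 \<le> act"
proof -
  have "0 \<le> cyc \<rho> (\<lambda>s. (\<rho>\<^sup>2 - s\<^sup>2) * U s)"
  proof (rule cyc_nonneg)
    fix s assume s: "s \<in> {-\<rho>..\<rho>}"
    then have "s\<^sup>2 \<le> \<rho>\<^sup>2" using rho by (intro abs_le_square_iff[THEN iffD1]) auto
    then show "0 \<le> (\<rho>\<^sup>2 - s\<^sup>2) * U s" using U_pos[OF in_R[OF s]] by simp
  qed (use rho in \<open>auto intro!: ccont C1_intros\<close>)
  then show ?thesis by (simp add: kinetic_def)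
qed

text \<open>A virial identity: \<open>euler_U\<close> averaged over the cycle, with the term in
  \<open>s\<close> rewritten by \<open>cyc_parts\<close>.\<close>

lemma area_act: "area = (q + 3) * act - (q + 1) * kap * per"
proof -
  have "cyc \<rho> (\<lambda>s. E s * U s) = cyc \<rho> (\<lambda>s. s * Y s + (q + 1) / 2 * ((\<rho>\<^sup>2 - s\<^sup>2) * U s))"
    by (rule cyc_cong) (use rho euler_U[OF in_R] in auto)
  also have "\<dots> = cyc \<rho> (\<lambda>s. s * Y s) + cyc \<rho> (\<lambda>s. (q + 1) / 2 * ((\<rho>\<^sup>2 - s\<^sup>2) * U s))"
    using rho by (intro cyc_add ccont C1_intros) auto
  also have "cyc \<rho> (\<lambda>s. s * Y s) = cyc \<rho> (\<lambda>s. (\<rho>\<^sup>2 - s\<^sup>2) * deriv Y s)"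
    by (intro cyc_parts C1_intros)
  also have "\<dots> = 2 * act" unfolding kinetic_def using rho deriv_Y[OF in_R]
    by (subst cyc_cong[where g = "\<lambda>s. (\<rho>\<^sup>2 - s\<^sup>2) * U s"]) auto
  also have "cyc \<rho> (\<lambda>s. (q + 1) / 2 * ((\<rho>\<^sup>2 - s\<^sup>2) * U s)) = (q + 1) * act"
    unfolding cyc_cmult kinetic_def by simp
  finally have 1: "cyc \<rho> (\<lambda>s. E s * U s) = (q + 3) * act" by (simp add: algebra_simps)
  have "cyc \<rho> (\<lambda>s. E s * U s) = cyc \<rho> (\<lambda>s. Y s * U s + (q + 1) * kap * U s)"
    by (simp add: E_def distrib_right)
  also have "\<dots> = area + cyc \<rho> (\<lambda>s. (q + 1) * kap * U s)" unfolding mass_def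
    using rho by (intro cyc_add ccont C1_intros) auto
  also have "\<dots> = area + (q + 1) * kap * per" by (simp add: cyc_cmult period_def)
  finally show ?thesis using 1 by simp
qed

abbreviation "pk \<equiv> dperiod q \<rho>"
abbreviation "ak \<equiv> dmass q \<rho>"
text \<open>The second derivative of the action along \<open>E\<close>, assembled from the exponents
  \<open>(3 - q) / 2\<close> and \<open>(1 - q) / 2\<close> with which area and period
  scale.\<close>

definition "T = ((3 - q) * area - (q\<^sup>2 - 1) * kap * per) / 2"

lemma fp_E:
  assumes "C1_on (rho0 q) l"
  shows "fp \<rho> (\<lambda>s. E s * (l s * U s)) = (q + 1) / 2 * cyc \<rho> (\<lambda>s. l s * U s) - cyc \<rho> (deriv (\<lambda>s. Y s * l s))"
proof -
  have "fp \<rho> (\<lambda>s. E s * (l s * U s))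
      = fp \<rho> (\<lambda>s. s * (Y s * l s) + (q + 1) / 2 * ((\<rho>\<^sup>2 - s\<^sup>2) * (l s * U s)))"
  proof (rule fp_cong)
    fix s assume s: "s \<in> {-rho0 q<..<rho0 q}"
    have "E s * (l s * U s) = (E s * U s) * l s" by simp
    also have "\<dots> = s * (Y s * l s) + (q + 1) / 2 * ((\<rho>\<^sup>2 - s\<^sup>2) * (l s * U s))"
      unfolding euler_U[OF s] by (simp add: field_simps)
    finally show "E s * (l s * U s) = s * (Y s * l s) + (q + 1) / 2 * ((\<rho>\<^sup>2 - s\<^sup>2) * (l s * U s))" .
  qed
  also have "\<dots> = fp \<rho> (\<lambda>s. s * (Y s * l s)) + (q + 1) / 2 * fp \<rho> (\<lambda>s. (\<rho>\<^sup>2 - s\<^sup>2) * (l s * U s))"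
    by (subst fp_add; (subst fp_cmult)?; (intro C1_intros assms refl)?)
  also have "\<dots> = (q + 1) / 2 * cyc \<rho> (\<lambda>s. l s * U s) - cyc \<rho> (deriv (\<lambda>s. Y s * l s))"
    by (subst fp_s; (subst fp_w)?; (intro C1_intros assms)?; simp)
  finally show ?thesis .
qed

lemma fp_E1: "fp \<rho> (\<lambda>s. E s * U s) = (q - 1) / 2 * per"
proof -
  have "cyc \<rho> (deriv Y) = per" unfolding period_def using rho by (intro cyc_cong deriv_Y in_R) auto
  moreover have "deriv (\<lambda>s. Y s * 1) = deriv Y" by simp
  ultimately show ?thesis using fp_E[OF C1_on_const, of 1] by (simp add: period_def[symmetric] algebra_simps)
qed

lemma fp_EE: "fp \<rho> (\<lambda>s. E s * (E s * U s)) = - T"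
proof -
  have dE: "deriv E s = U s" if "s \<in> {-rho0 q<..<rho0 q}" for s
    unfolding E_def using that q by (intro DERIV_imp_deriv) (auto intro!: derivative_eq_intros yof_deriv)
  have EU: "cyc \<rho> (\<lambda>s. E s * U s) = area + (q + 1) * kap * per"
  proof -
    have "cyc \<rho> (\<lambda>s. E s * U s) = cyc \<rho> (\<lambda>s. Y s * U s + (q + 1) * kap * U s)"
      by (simp add: E_def distrib_right)
    also have "\<dots> = area + cyc \<rho> (\<lambda>s. (q + 1) * kap * U s)" unfolding mass_def
      using rho by (intro cyc_add ccont C1_intros) auto
    finally show ?thesis by (simp add: cyc_cmult period_def)
  qed
  have "cyc \<rho> (deriv (\<lambda>s. Y s * E s)) = cyc \<rho> (\<lambda>s. Y s * U s + E s * U s)"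
    by (rule cyc_cong) (use rho deriv_mult'[OF Y_C1 E_C1] in_R dE deriv_Y in \<open>auto simp: mult.commute\<close>)
  also have "\<dots> = area + cyc \<rho> (\<lambda>s. E s * U s)" unfolding mass_def
    using rho by (intro cyc_add ccont C1_intros) auto
  finally have "fp \<rho> (\<lambda>s. E s * (E s * U s))
      = (q + 1) / 2 * (area + (q + 1) * kap * per) - (area + (area + (q + 1) * kap * per))"
    using fp_E[OF E_C1] EU by simp
  also have "\<dots> = - T" by (simp add: T_def field_simps power2_eq_square)
  finally show ?thesis .
qed

lemma fp_area: "- fp \<rho> (\<lambda>s. Y s * U s) = ak"
proof -
  have "fp \<rho> (\<lambda>s. E s * U s) = fp \<rho> (\<lambda>s. Y s * U s + (q + 1) * kap * U s)"
    by (simp add: E_def distrib_right)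
  also have "\<dots> = fp \<rho> (\<lambda>s. Y s * U s) + (q + 1) * kap * fp \<rho> U"
    by (subst fp_add; (subst fp_cmult)?; (intro C1_intros refl)?)
  finally show ?thesis unfolding fp_E1 by (simp add: dmass_def dperiod_def field_simps)
qed

text \<open>For \<open>q > 1\<close> both contributions have the right sign because the level is
  negative. For \<open>q \<le> 1\<close> the identity \<open>area_act\<close> eliminates the level
  and leaves the area plus a nonnegative multiple of the kinetic term.\<close>

lemma T_pos: assumes "q < 3" shows "0 < T"
proof (cases "1 < q")
  case True
  have "(q\<^sup>2 - 1) * kap * per \<le> 0"
    using True kap_neg per_pos by (intro mult_nonpos_nonneg mult_nonneg_nonpos) (auto simp: power2_eq_square mult_ge1_I)
  moreover have "0 < (3 - q) * area" using assms area_pos by simp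
  ultimately show ?thesis by (simp add: T_def)
next
  case False
  have "(q + 1) * kap * per = (q + 3) * act - area" using area_act by simp
  moreover have "(q\<^sup>2 - 1) * kap * per = (q - 1) * ((q + 1) * kap * per)"
    by (simp add: power2_eq_square algebra_simps)
  ultimately have "2 * T = (3 - q) * area - (q - 1) * ((q + 3) * act - area)"
    by (simp add: T_def)
  also have "\<dots> = 2 * area + (1 - q) * (q + 3) * act" by (simp add: algebra_simps)
  also have "\<dots> > 0" using area_pos act_nonneg False q by (intro add_pos_nonneg mult_nonneg_nonneg) auto
  finally show ?thesis by simp
qed

lemma period_deriv: "(period q has_real_derivative \<rho> * pk) (at \<rho>)"
  using cyc_rho_deriv[OF U_C1] by (simp add: period_def[abs_def] dperiod_def)

lemma mass_deriv: "(mass q has_real_derivative \<rho> * ak) (at \<rho>)"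
proof -
  have "((\<lambda>\<rho>. cyc \<rho> (\<lambda>s. Y s * U s)) has_real_derivative - \<rho> * fp \<rho> (\<lambda>s. Y s * U s)) (at \<rho>)"
    by (intro cyc_rho_deriv C1_intros)
  then show ?thesis by (simp add: mass_def[abs_def] fp_area[symmetric])
qed

end

section \<open>The direction generated by the acceleration\<close>

context film_cycle begin

text \<open>The function k'^2 f' + f^2 along the orbit, where
  \<open>\<rho>\<^sup>2 - s\<^sup>2\<close> is the squared velocity.\<close>

definition "lst s = (\<rho>\<^sup>2 - s\<^sup>2) * Y s powr (q - 1) + F s * F s"

lemma lst_C1 [C1_intros]: "C1_on (rho0 q) lst"
  unfolding lst_def by (intro C1_intros)

lemma deriv_F: "s \<in> {-rho0 q<..<rho0 q} \<Longrightarrow> deriv F s = Y s powr (q - 1) * U s"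
  using F_deriv by (rule DERIV_imp_deriv)

lemma lst_U:
  assumes "s \<in> {-rho0 q<..<rho0 q}"
  shows "lst s * U s = s * F s + (\<rho>\<^sup>2 - s\<^sup>2) * (Y s powr (q - 1) * U s)"
proof -
  have "lst s * U s = (F s * U s) * F s + (\<rho>\<^sup>2 - s\<^sup>2) * (Y s powr (q - 1) * U s)"
    by (simp add: lst_def algebra_simps)
  then show ?thesis unfolding F_U[OF assms] .
qed

text \<open>The derivative of \<open>F * F\<close> is \<open>2 * s * Y s powr (q - 1)\<close>
  because \<open>F * U = s\<close>, and it cancels the derivative of the factor
  \<open>\<rho>\<^sup>2 - s\<^sup>2\<close>. Only the term with f'' survives.\<close>

lemma lst_deriv:
  assumes s: "s \<in> {-rho0 q<..<rho0 q}"
  shows "(lst has_real_derivative (\<rho>\<^sup>2 - s\<^sup>2) * ((q - 1) * Y s powr (q - 2) * U s)) (at s)"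
proof -
  have "((\<lambda>s. (\<rho>\<^sup>2 - s\<^sup>2) * Y s powr (q - 1) + F s * F s) has_real_derivative
      (- 2 * s) * Y s powr (q - 1) + (\<rho>\<^sup>2 - s\<^sup>2) * ((q - 1) * Y s powr (q - 1 - 1) * U s)
      + 2 * ((F s * U s) * Y s powr (q - 1))) (at s)"
    by (rule derivative_eq_intros powr_Y_deriv[OF s] F_deriv[OF s] refl)+ (simp add: mult_ac)
  then show ?thesis unfolding F_U[OF s] lst_def[abs_def] by simp
qed

text \<open>After \<open>fp_s\<close> and \<open>fp_w\<close> the terms with f' cancel. What remains
  is the integral over a period of k'' times the slope of \<open>l\<close> in the height: zero for
  constants, and for the height itself the integral of k'', which is zero too.\<close>

lemma fp_lst:
  assumes l: "C1_on (rho0 q) l"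
  shows "fp \<rho> (\<lambda>s. lst s * (l s * U s)) = - cyc \<rho> (\<lambda>s. F s * deriv l s)"
proof -
  have "fp \<rho> (\<lambda>s. lst s * (l s * U s))
      = fp \<rho> (\<lambda>s. s * (F s * l s) + (\<rho>\<^sup>2 - s\<^sup>2) * (Y s powr (q - 1) * U s * l s))"
  proof (rule fp_cong)
    fix s assume s: "s \<in> {-rho0 q<..<rho0 q}"
    have "lst s * (l s * U s) = (lst s * U s) * l s" by simp
    also have "\<dots> = s * (F s * l s) + (\<rho>\<^sup>2 - s\<^sup>2) * (Y s powr (q - 1) * U s * l s)"
      unfolding lst_U[OF s] by (simp add: algebra_simps)
    finally show "lst s * (l s * U s) = s * (F s * l s) + (\<rho>\<^sup>2 - s\<^sup>2) * (Y s powr (q - 1) * U s * l s)" .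
  qed
  also have "\<dots> = fp \<rho> (\<lambda>s. s * (F s * l s)) + fp \<rho> (\<lambda>s. (\<rho>\<^sup>2 - s\<^sup>2) * (Y s powr (q - 1) * U s * l s))"
    by (intro fp_add C1_intros l)
  also have "fp \<rho> (\<lambda>s. s * (F s * l s)) = - cyc \<rho> (deriv (\<lambda>s. F s * l s))"
    by (intro fp_s C1_intros l)
  also have "fp \<rho> (\<lambda>s. (\<rho>\<^sup>2 - s\<^sup>2) * (Y s powr (q - 1) * U s * l s)) = cyc \<rho> (\<lambda>s. Y s powr (q - 1) * U s * l s)"
    by (intro fp_w C1_intros l)
  also have "cyc \<rho> (deriv (\<lambda>s. F s * l s)) = cyc \<rho> (\<lambda>s. F s * deriv l s + Y s powr (q - 1) * U s * l s)"
    by (rule cyc_cong) (use rho deriv_mult'[OF F_C1 l in_R] deriv_F[OF in_R] in auto)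
  also have "\<dots> = cyc \<rho> (\<lambda>s. F s * deriv l s) + cyc \<rho> (\<lambda>s. Y s powr (q - 1) * U s * l s)"
    using rho by (intro cyc_add continuous_on_mult[OF ccont ccont'] ccont C1_intros l) auto
  finally show ?thesis by simp
qed

lemma fp_lst_1: "fp \<rho> (\<lambda>s. lst s * U s) = 0"
  using fp_lst[OF C1_on_const, of 1] by (simp add: cyc_def)

lemma fp_lst_Y: "fp \<rho> (\<lambda>s. lst s * (Y s * U s)) = 0"
proof -
  have "cyc \<rho> (\<lambda>s. F s * deriv Y s) = cyc \<rho> (\<lambda>s. s * 1)"
    by (rule cyc_cong) (use rho deriv_Y[OF in_R] F_U[OF in_R] in auto)
  also have "\<dots> = 0" using cyc_parts[OF C1_on_const, of 1] by (simp add: cyc_def)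
  finally show ?thesis using fp_lst[OF Y_C1] by simp
qed

text \<open>The hypothesis is the sign of f'''. Integrating \<open>s * g s\<close> by parts returns
  the same average with factor -2 together with \<open>cyc \<rho> k\<close>, so the finite part is
  minus one third of the integral of f''' k'^4.\<close>

lemma fp_lst_lst:
  assumes "0 \<le> (q - 1) * (q - 2)"
  shows "fp \<rho> (\<lambda>s. lst s * (lst s * U s)) \<le> 0"
proof -
  define g where "g = (\<lambda>s. (\<rho>\<^sup>2 - s\<^sup>2) * ((q - 1) * Y s powr (q - 2)))"
  define k where "k = (\<lambda>s. (\<rho>\<^sup>2 - s\<^sup>2) * ((\<rho>\<^sup>2 - s\<^sup>2) * ((q - 1) * (q - 2) * Y s powr (q - 3) * U s)))"
  have g: "C1_on (rho0 q) g" unfolding g_def by (intro C1_intros)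
  have gc: "C1_on (rho0 q) (\<lambda>s. s * g s)" by (intro C1_intros g)
  have k: "C1_on (rho0 q) k" unfolding k_def by (intro C1_intros)
  have dg: "deriv g s = - 2 * s * ((q - 1) * Y s powr (q - 2)) + (\<rho>\<^sup>2 - s\<^sup>2) * ((q - 1) * (q - 2) * Y s powr (q - 3) * U s)"
    if s: "s \<in> {-rho0 q<..<rho0 q}" for s
    unfolding g_def
    by (rule DERIV_imp_deriv, (rule derivative_eq_intros powr_Y_deriv[OF s] refl)+) (simp add: mult_ac)
  have "cyc \<rho> (\<lambda>s. F s * deriv lst s) = cyc \<rho> (\<lambda>s. s * g s)"
  proof (rule cyc_cong)
    fix s assume "s \<in> {-\<rho>..\<rho>}"
    then have s: "s \<in> {-rho0 q<..<rho0 q}" by (rule in_R)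
    have "F s * deriv lst s = (F s * U s) * g s"
      unfolding DERIV_imp_deriv[OF lst_deriv[OF s]] g_def by (simp add: mult_ac)
    then show "F s * deriv lst s = s * g s" unfolding F_U[OF s] .
  qed (use rho in simp)
  then have 1: "fp \<rho> (\<lambda>s. lst s * (lst s * U s)) = - cyc \<rho> (\<lambda>s. s * g s)"
    using fp_lst[OF lst_C1] by simp
  have "cyc \<rho> (\<lambda>s. s * g s) = cyc \<rho> (\<lambda>s. (\<rho>\<^sup>2 - s\<^sup>2) * deriv g s)"
    by (rule cyc_parts[OF g])
  also have "\<dots> = cyc \<rho> (\<lambda>s. k s - 2 * (s * g s))"
  proof (rule cyc_cong)
    fix s assume s: "s \<in> {-\<rho>..\<rho>}"
    show "(\<rho>\<^sup>2 - s\<^sup>2) * deriv g s = k s - 2 * (s * g s)"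
      unfolding dg[OF in_R[OF s]] by (simp add: k_def g_def algebra_simps)
  qed (use rho in simp)
  also have "\<dots> = cyc \<rho> k - 2 * cyc \<rho> (\<lambda>s. s * g s)"
    unfolding cyc_cmult[symmetric] using rho by (intro cyc_diff ccont C1_intros k gc) auto
  finally have "3 * cyc \<rho> (\<lambda>s. s * g s) = cyc \<rho> k" by simp
  moreover have "0 \<le> cyc \<rho> k"
  proof (rule cyc_nonneg)
    fix s assume s: "s \<in> {-\<rho>..\<rho>}"
    have "k s = (\<rho>\<^sup>2 - s\<^sup>2)\<^sup>2 * ((q - 1) * (q - 2)) * (Y s powr (q - 3) * U s)"
      by (simp add: k_def power2_eq_square)
    then show "0 \<le> k s" using assms U_pos[OF in_R[OF s]] by simp
  qed (use rho ccont[OF k] in auto)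
  ultimately show ?thesis using 1 by simp
qed

text \<open>The affine function \<open>a + b E\<close> agreeing with \<^term>\<open>lst\<close> at the turning points is a negative
  direction of the Hessian of the action, because \<^term>\<open>lst\<close> is orthogonal to all affine functions.\<close>

lemma hessian_negative:
  assumes q1: "q \<noteq> 1" and q2: "0 \<le> (q - 1) * (q - 2)"
  obtains a b where "a\<^sup>2 * pk + a * b * ((1 - q) * per) + b\<^sup>2 * T < 0"
proof -
  define b where "b = (lst \<rho> - lst (- \<rho>)) / (Y \<rho> - Y (- \<rho>))"
  define a where "a = lst \<rho> - b * E \<rho>"
  define z where "z = (\<lambda>s. lst s - (a + b * E s))"
  have Yne: "Y \<rho> \<noteq> Y (- \<rho>)" using yof_strict_mono[OF q, of "- \<rho>" \<rho>] rho by simp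
  have z1: "z \<rho> = 0" by (simp add: z_def a_def)
  have "b * (E \<rho> - E (- \<rho>)) = lst \<rho> - lst (- \<rho>)" using Yne by (simp add: b_def E_def)
  then have z2: "z (- \<rho>) = 0" by (simp add: z_def a_def algebra_simps)
  have zC: "C1_on (rho0 q) z" unfolding z_def by (intro C1_intros)
  have "0 < cyc \<rho> (\<lambda>s. z s * z s * U s)"
  proof -
    have "\<exists>r\<in>{-\<rho>..\<rho>}. z r \<noteq> 0"
    proof (rule ccontr)
      \<comment> \<open>If \<open>z\<close> vanished on the whole orbit, differentiating and
        dividing by \<open>U\<close> would make \<open>(\<rho>\<^sup>2 - s\<^sup>2) * f''\<close>
        constant. It tends to 0 at \<open>s = \<rho>\<close>, but equals
        \<open>\<rho>\<^sup>2 * (q - 1)\<close> at \<open>s = 0\<close>, where the height is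
        1.\<close>
      assume "\<not> ?thesis"
      then have z0: "z s = 0" if "s \<in> {-\<rho>..\<rho>}" for s using that by blast
      have "(\<rho>\<^sup>2 - s\<^sup>2) * ((q - 1) * Y s powr (q - 2)) = b" if s: "s \<in> {-\<rho><..<\<rho>}" for s
      proof -
        have sR: "s \<in> {-rho0 q<..<rho0 q}" using s rho by auto
        have "(E has_real_derivative U s) (at s)"
          unfolding E_def using sR q by (auto intro!: derivative_eq_intros yof_deriv)
        then have "(z has_real_derivative (\<rho>\<^sup>2 - s\<^sup>2) * ((q - 1) * Y s powr (q - 2) * U s) - b * U s) (at s)"
          unfolding z_def by (auto intro!: derivative_eq_intros lst_deriv[OF sR])
        moreover have "(z has_real_derivative 0) (at s)"
        proof -
          have "\<forall>\<^sub>F x in nhds s. z x = 0"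
            using eventually_nhds_in_open[of "{-\<rho><..<\<rho>}" s] s z0 by (auto elim!: eventually_mono)
          then show ?thesis by (subst DERIV_cong_ev[OF refl _ refl, where g = "\<lambda>_. 0"]) auto
        qed
        ultimately have "(\<rho>\<^sup>2 - s\<^sup>2) * ((q - 1) * Y s powr (q - 2) * U s) - b * U s = 0"
          by (rule DERIV_unique)
        then have "((\<rho>\<^sup>2 - s\<^sup>2) * ((q - 1) * Y s powr (q - 2)) - b) * U s = 0"
          by (simp add: algebra_simps)
        then show ?thesis using U_pos[OF sR] by simp
      qed
      note c = this
      define w where "w = (\<lambda>s. (\<rho>\<^sup>2 - s\<^sup>2) * ((q - 1) * Y s powr (q - 2)))"
      have "C1_on (rho0 q) w" unfolding w_def by (intro C1_intros)
      then have "isCont w \<rho>" using C1_on_deriv[of "rho0 q" w \<rho>] rho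
        by (intro DERIV_isCont[where D = "deriv w \<rho>"]) auto
      then have "(w \<longlongrightarrow> w \<rho>) (at_left \<rho>)" by (metis isCont_def at_le filterlim_mono order_refl subset_UNIV)
      moreover have "\<forall>\<^sub>F s in at_left \<rho>. w s = b"
        using rho c by (auto simp: eventually_at_left_field w_def intro!: exI[of _ "- \<rho>"])
      ultimately have "((\<lambda>s. b) \<longlongrightarrow> w \<rho>) (at_left \<rho>)" by (rule Lim_transform_eventually)
      then have "b = w \<rho>" by (simp add: tendsto_const_iff)
      then have "b = 0" by (simp add: w_def)
      moreover have "b = \<rho>\<^sup>2 * (q - 1)" using c[of 0] rho yof_0[OF q] by simp
      ultimately show False using q1 rho by simp
    qed
    then obtain r where r: "r \<in> {-\<rho>..\<rho>}" "z r \<noteq> 0" by blast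
    show ?thesis
      by (rule cyc_pos[OF _ _ _ r(1)])
        (use rho r U_pos[OF in_R] in \<open>auto intro!: ccont C1_intros zC simp: less_imp_le less_imp_neq[symmetric]\<close>)
  qed
  then have "0 < cyc \<rho> (\<lambda>s. z s * z s * U s) / \<rho>\<^sup>2" using rho by simp
  also have "\<dots> \<le> fp \<rho> (\<lambda>s. z s * z s * U s)"
    by (rule fp_square_ge[OF zC U_C1 z1 z2]) (use U_pos[OF in_R] in \<open>auto simp: less_imp_le\<close>)
  \<comment> \<open>The square of \<open>z\<close> expands into the square of \<open>lst\<close>,
    the products of \<open>lst\<close> with \<open>1\<close> and \<open>Y\<close>, whose finite
    parts vanish, and the square of \<open>a + b * E\<close>, which gives minus the Hessian
    form.\<close>
  also have "(\<lambda>s. z s * z s * U s) = (\<lambda>s. (lst s * (lst s * U s)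
      + (2 * (b * (q + 1) * kap * - 1) + - 2 * a) * (lst s * U s)) + (- 2 * b) * (lst s * (Y s * U s))
      + a\<^sup>2 * U s + (2 * a * b) * (E s * U s) + b\<^sup>2 * (E s * (E s * U s)))"
    unfolding z_def E_def by (simp add: fun_eq_iff algebra_simps power2_eq_square)
  also have "fp \<rho> \<dots> = fp \<rho> (\<lambda>s. lst s * (lst s * U s))
      + (2 * (b * (q + 1) * kap * - 1) + - 2 * a) * fp \<rho> (\<lambda>s. lst s * U s)
      + (- 2 * b) * fp \<rho> (\<lambda>s. lst s * (Y s * U s))
      + a\<^sup>2 * fp \<rho> U + (2 * a * b) * fp \<rho> (\<lambda>s. E s * U s) + b\<^sup>2 * fp \<rho> (\<lambda>s. E s * (E s * U s))"
    by (simp only: fp_add fp_cmult C1_intros)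
  also have "\<dots> = fp \<rho> (\<lambda>s. lst s * (lst s * U s)) - (a\<^sup>2 * pk + a * b * ((1 - q) * per) + b\<^sup>2 * T)"
    unfolding fp_lst_1 fp_lst_Y fp_E1 fp_EE dperiod_def by (simp add: field_simps)
  finally have "a\<^sup>2 * pk + a * b * ((1 - q) * per) + b\<^sup>2 * T < 0" using fp_lst_lst[OF q2] by linarith
  then show ?thesis by (rule that)
qed

text \<open>Completing the square: since \<open>T > 0\<close>, a quadratic form with a negative
  value has negative determinant.\<close>

lemma period_derivative_bound:
  assumes "q \<noteq> 1" "0 \<le> (q - 1) * (q - 2)" "q < 3"
  shows "4 * T * pk < (1 - q)\<^sup>2 * per\<^sup>2"
proof -
  obtain a b where ab: "a\<^sup>2 * pk + a * b * ((1 - q) * per) + b\<^sup>2 * T < 0"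
    using hessian_negative[OF assms(1,2)] .
  have T: "0 < T" by (rule T_pos[OF assms(3)])
  then have a: "a \<noteq> 0" using ab by (auto simp: mult_less_0_iff)
  have "4 * T * (a\<^sup>2 * pk + a * b * ((1 - q) * per) + b\<^sup>2 * T) < 0" using ab T by (simp add: mult_less_0_iff)
  moreover have "4 * T * (a\<^sup>2 * pk + a * b * ((1 - q) * per) + b\<^sup>2 * T)
      = a\<^sup>2 * (4 * T * pk - (1 - q)\<^sup>2 * per\<^sup>2) + (2 * b * T + a * ((1 - q) * per))\<^sup>2"
    by (simp add: power2_eq_square algebra_simps)
  ultimately have "a\<^sup>2 * (4 * T * pk - (1 - q)\<^sup>2 * per\<^sup>2) < 0"
    using zero_le_power2[of "2 * b * T + a * ((1 - q) * per)"] by linarith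
  then show ?thesis using a by (simp add: mult_less_0_iff)
qed

text \<open>Multiplied by period and area, the left side becomes
  \<open>2 * T * pk - (1 - q)\<^sup>2 * per\<^sup>2 / 2\<close>, twice the determinant of the
  Hessian in the basis 1, \<open>E\<close>.\<close>

lemma log_derivative_negative:
  assumes "q \<noteq> 1" "0 \<le> (q - 1) * (q - 2)" "q < 3"
  shows "(3 - q) * pk / per + (q - 1) * ak / area < 0"
proof -
  have "(3 - q) * pk * area + (q - 1) * ak * per = 2 * T * pk - (1 - q)\<^sup>2 * per\<^sup>2 / 2"
    by (simp add: dmass_def T_def field_simps power2_eq_square)
  also have "\<dots> < 0" using period_derivative_bound[OF assms] by simp
  finally have "((3 - q) * pk * area + (q - 1) * ak * per) / (per * area) < 0"
    using per_pos area_pos by (simp add: divide_neg_pos)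
  moreover have "((3 - q) * pk * area + (q - 1) * ak * per) / (per * area)
      = (3 - q) * pk / per + (q - 1) * ak / area"
    using per_pos area_pos by (simp add: field_simps)
  ultimately show ?thesis by simp
qed

end

section \<open>Orbits and the steady state equation\<close>

locale orbit =
  fixes q \<rho> :: real
  assumes q: "-1 < q" and rho: "0 < \<rho>" "\<rho> \<le> rho0 q"
begin

definition "rate t = uof q (- \<rho> * cos t)"
text \<open>Elapsed time at angle \<open>\<theta>\<close>, with sign: for negative
  \<open>\<theta>\<close> the interval \<open>{0..\<theta>}\<close> is empty and the second integral
  supplies the value.\<close>

definition "clk \<theta> = integral {0..\<theta>} rate - integral {\<theta>..0} rate"
definition "ang x = (THE \<theta>. clk \<theta> = x)"
definition "K x = yof q (- \<rho> * cos (ang x))"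
definition "L x = \<rho> * sin (ang x)"

lemma arg_ge: "- rho0 q \<le> - \<rho> * cos t"
proof -
  have "- \<rho> \<le> - \<rho> * cos t"
    using neg_rho_cos[OF less_imp_le[OF rho(1)], of t] unfolding atLeastAtMost_iff by blast
  then show ?thesis using rho by linarith
qed

lemma arg_gt:
  assumes "cos t \<noteq> 1" shows "- rho0 q < - \<rho> * cos t"
proof -
  have "cos t < 1" using assms cos_le_one[of t] by linarith
  then have "\<rho> * cos t < \<rho>" using rho by simp
  then show ?thesis using rho by linarith
qed

lemma arg_gt': "\<rho> < rho0 q \<Longrightarrow> - rho0 q < - \<rho> * cos t"
  using neg_rho_cos_less[of \<rho> "rho0 q" t] rho by auto

lemma rate_cont: "continuous_on S rate"
  unfolding rate_def
  by (rule continuous_on_compose2[OF uof_cont[OF q]]) (use arg_ge in \<open>auto intro!: continuous_intros\<close>)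

lemma rate_integrable: "rate integrable_on {a..b}"
  by (intro integrable_continuous_interval rate_cont)

lemma rate_nonneg: "0 \<le> rate t"
  unfolding rate_def by (rule uof_nonneg[OF q arg_ge])

lemma rate_pos: "cos t \<noteq> 1 \<Longrightarrow> 0 < rate t"
  unfolding rate_def by (rule uof_pos[OF q arg_gt])

lemma clk_diff:
  assumes "a \<le> b" shows "clk b - clk a = integral {a..b} rate"
proof -
  have c: "integral {x..y} rate + integral {y..z} rate = integral {x..z} rate" if "x \<le> y" "y \<le> z" for x y z
    using that by (intro Henstock_Kurzweil_Integration.integral_combine rate_integrable) auto
  have e: "integral {x..y} rate = 0" if "y \<le> x" for x y
    using that by (cases "x = y") auto
  consider "b \<le> 0" | "a \<le> 0" "0 \<le> b" | "0 \<le> a" using assms by linarith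
  then show ?thesis
  proof cases
    case 1 then show ?thesis using assms c[of a b 0] e[of a 0] e[of b 0] by (simp add: clk_def)
  next
    case 2 then show ?thesis using c[of a 0 b] e[of a 0] e[of 0 b] by (simp add: clk_def)
  next
    case 3 then show ?thesis using assms c[of 0 a b] e[of 0 a] e[of 0 b] by (simp add: clk_def)
  qed
qed

lemma clk_0 [simp]: "clk 0 = 0"
  by (simp add: clk_def)

lemma clk_deriv: "(clk has_real_derivative rate \<theta>) (at \<theta>)"
proof -
  have "((\<lambda>x. integral {\<theta> - 1..x} rate) has_real_derivative rate \<theta>) (at \<theta> within {\<theta> - 1..\<theta> + 1})"
    by (rule integral_has_real_derivative[OF rate_cont]) auto
  moreover have "at \<theta> within {\<theta> - 1..\<theta> + 1} = at \<theta>" by (rule at_within_interior) auto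
  ultimately have "((\<lambda>x. integral {\<theta> - 1..x} rate) has_real_derivative rate \<theta>) (at \<theta>)" by simp
  then have "((\<lambda>x. integral {\<theta> - 1..x} rate + clk (\<theta> - 1)) has_real_derivative rate \<theta>) (at \<theta>)"
    by (auto intro!: derivative_eq_intros)
  moreover have "\<forall>\<^sub>F x in nhds \<theta>. clk x = integral {\<theta> - 1..x} rate + clk (\<theta> - 1)"
  proof (rule eventually_mono[OF eventually_nhds_in_open[of "{\<theta> - 1<..}"]])
    fix x assume "x \<in> {\<theta> - 1<..}"
    then show "clk x = integral {\<theta> - 1..x} rate + clk (\<theta> - 1)" using clk_diff[of "\<theta> - 1" x] by simp
  qed auto
  ultimately show ?thesis by (subst DERIV_cong_ev[OF refl _ refl])
qed

lemma cos_ne_1_dense: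
  fixes a b :: real
  assumes "a < b" shows "\<exists>t\<in>{a..b}. cos t \<noteq> 1"
proof (rule ccontr)
  assume "\<not> ?thesis"
  \<comment> \<open>Capped at length 1, the interval is shorter than \<open>2 * pi\<close> and
    cannot have a multiple of \<open>2 * pi\<close> at both ends.\<close>
  then have *: "cos a = 1" "cos (min b (a + 1)) = 1" using assms by auto
  then obtain n m :: int where n: "a = of_int n * 2 * pi" and m: "min b (a + 1) = of_int m * 2 * pi"
    unfolding cos_one_2pi_int by blast
  define d where "d = min b (a + 1) - a"
  have d: "0 < d" "d \<le> 1" using assms by (auto simp: d_def)
  have e: "d = of_int (m - n) * (2 * pi)" using n m by (simp add: d_def algebra_simps)
  then have "0 < m - n" using d by (simp add: zero_less_mult_iff)
  then have "1 * (2 * pi) \<le> of_int (m - n) * (2 * pi)" by (intro mult_right_mono) auto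
  then show False using e d pi_gt3 by linarith
qed

text \<open>For \<open>\<rho> = rho0 q\<close> and \<open>q \<le> 0\<close> the rate is zero
  wherever \<open>cos t = 1\<close>. It is still nonnegative, continuous and not identically zero on
  any interval, which makes the clock invertible.\<close>

lemma clk_strict_mono:
  assumes "a < b" shows "clk a < clk b"
proof -
  have "integral {a..b} rate \<noteq> 0"
    using integral_eq_0_iff[OF rate_cont assms rate_nonneg] cos_ne_1_dense[OF assms] rate_pos
    by (metis less_irrefl)
  moreover have "0 \<le> integral {a..b} rate" by (intro integral_nonneg rate_integrable rate_nonneg)
  ultimately show ?thesis using clk_diff[of a b] assms by simp
qed

definition "P = period q \<rho>"

lemma clk_2pi: "clk (2 * pi) = P"
  using clk_diff[of 0 "2 * pi"] by (simp add: P_def period_def cyc_def rate_def[abs_def])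

lemma P_pos: "0 < P"
  using clk_strict_mono[of 0 "2 * pi"] by (simp add: clk_2pi)

lemma clk_shift: "clk (\<theta> + 2 * pi) = clk \<theta> + P"
proof -
  have "((\<lambda>\<theta>. clk (\<theta> + 2 * pi) - clk \<theta>) has_real_derivative 0) (at \<theta>)" for \<theta>
  proof -
    have "((\<lambda>\<theta>. clk (\<theta> + 2 * pi)) has_real_derivative rate (\<theta> + 2 * pi)) (at \<theta>)"
      using clk_deriv[of "\<theta> + 2 * pi"] by (simp add: DERIV_shift)
    then show ?thesis using clk_deriv[of \<theta>]
      by (auto intro!: derivative_eq_intros simp: rate_def)
  qed
  then have "clk (\<theta> + 2 * pi) - clk \<theta> = clk (0 + 2 * pi) - clk 0"
    by (rule DERIV_isconst_all[rule_format, where f = "\<lambda>\<theta>. clk (\<theta> + 2 * pi) - clk \<theta>"])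
  then show ?thesis by (simp add: clk_2pi)
qed

lemma clk_shift_nat: "clk (\<theta> + 2 * pi * of_nat n) = clk \<theta> + P * of_nat n"
proof (induction n)
  case (Suc n)
  have "clk (\<theta> + 2 * pi * of_nat (Suc n)) = clk (\<theta> + 2 * pi * of_nat n + 2 * pi)"
    by (simp add: algebra_simps)
  then show ?case unfolding clk_shift Suc by (simp add: algebra_simps)
qed simp

lemma clk_surj: "\<exists>\<theta>. clk \<theta> = x"
proof -
  obtain n :: nat where n: "\<bar>x\<bar> / P < of_nat n" using reals_Archimedean2 by blast
  then have nx: "\<bar>x\<bar> < P * of_nat n" using P_pos by (simp add: field_simps)
  have "clk (2 * pi * of_nat n) = P * of_nat n" using clk_shift_nat[of 0 n] by simp
  moreover have "clk (- (2 * pi * of_nat n)) = - (P * of_nat n)"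
    using clk_shift_nat[of "- (2 * pi * of_nat n)" n] by simp
  moreover have "continuous_on {- (2 * pi * of_nat n)..2 * pi * of_nat n} clk"
    using clk_deriv by (intro continuous_at_imp_continuous_on ballI DERIV_isCont)
  ultimately have "\<exists>\<theta>. - (2 * pi * of_nat n) \<le> \<theta> \<and> \<theta> \<le> 2 * pi * of_nat n \<and> clk \<theta> = x"
    using nx by (intro IVT') auto
  then show ?thesis by blast
qed

lemma clk_inj: "clk a = clk b \<Longrightarrow> a = b"
  using clk_strict_mono[of a b] clk_strict_mono[of b a] by (cases a b rule: linorder_cases) auto

lemma ang_clk [simp]: "ang (clk \<theta>) = \<theta>"
  unfolding ang_def by (rule the_equality) (auto dest: clk_inj)

lemma clk_ang [simp]: "clk (ang x) = x"
  using clk_surj[of x] by auto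

lemma ang_less: "ang x < ang y \<longleftrightarrow> x < y"
  using clk_strict_mono[of "ang x" "ang y"] clk_strict_mono[of "ang y" "ang x"]
  by (cases "ang x" "ang y" rule: linorder_cases) (auto, metis clk_ang less_irrefl)

lemma ang_cont: "continuous_on S ang"
proof -
  have "surj ang" by (rule surjI[of _ clk]) simp
  moreover have "ang x \<le> ang y" if "x \<le> y" for x y using that ang_less[of y x] by (simp add: not_less[symmetric])
  ultimately have "continuous_on UNIV ang" by (intro continuous_onI_mono) auto
  then show ?thesis by (rule continuous_on_subset) simp
qed

lemma ang_0 [simp]: "ang 0 = 0"
  using ang_clk[of 0] by simp

lemma ang_shift: "ang (x + P) = ang x + 2 * pi"
  using ang_clk[of "ang x + 2 * pi"] by (simp add: clk_shift)

lemma K_periodic: "K (x + P) = K x" by (simp add: K_def ang_shift)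

lemma K_cont: "continuous_on S K"
  unfolding K_def
  by (rule continuous_on_compose2[OF yof_cont[OF q]]) (use arg_ge in \<open>auto intro!: continuous_intros ang_cont\<close>)

lemma L_cont: "continuous_on S L"
  unfolding L_def by (intro continuous_intros ang_cont)

lemma K_nonneg: "0 \<le> K x" unfolding K_def by (rule yof_nonneg[OF q arg_ge])

lemma K_pos_iff: "0 < K x \<longleftrightarrow> - rho0 q < - \<rho> * cos (ang x)"
  using yof_pos[OF q, of "- \<rho> * cos (ang x)"] yof_left[OF q] arg_ge[of "ang x"]
  unfolding K_def by (metis less_irrefl order_le_less)

lemma rate_ang_pos: "0 < K x \<Longrightarrow> 0 < rate (ang x)"
  unfolding K_pos_iff rate_def by (rule uof_pos[OF q])

text \<open>Positive height keeps away from the contact points, where the rate may vanish and the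
  angle need not be differentiable in time.\<close>

lemma ang_deriv:
  assumes "0 < K x" shows "(ang has_real_derivative inverse (rate (ang x))) (at x)"
proof (rule DERIV_inverse_function[where f = clk and a = "x - 1" and b = "x + 1"])
  show "isCont ang x" using ang_cont[of UNIV] by (simp add: continuous_on_eq_continuous_at)
qed (use clk_deriv rate_ang_pos[OF assms] in auto)

lemma K_deriv:
  assumes "0 < K x" shows "(K has_real_derivative L x) (at x)"
proof -
  have "((\<lambda>x. - \<rho> * cos (ang x)) has_real_derivative \<rho> * sin (ang x) * inverse (rate (ang x))) (at x)"
    by (auto intro!: derivative_eq_intros ang_deriv[OF assms])
  from DERIV_chain2[OF yof_deriv[OF q assms[unfolded K_pos_iff]] this]
  have "((\<lambda>x. yof q (- \<rho> * cos (ang x))) has_real_derivative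
      rate (ang x) * (\<rho> * sin (ang x) * inverse (rate (ang x)))) (at x)"
    by (simp add: rate_def)
  moreover have "rate (ang x) * (\<rho> * sin (ang x) * inverse (rate (ang x))) = L x"
    using rate_ang_pos[OF assms] by (simp add: L_def)
  ultimately show ?thesis by (simp add: K_def[abs_def])
qed

lemma L_deriv:
  assumes "0 < K x" shows "(L has_real_derivative - frc q (K x)) (at x)"
proof -
  have "(L has_real_derivative \<rho> * cos (ang x) * inverse (rate (ang x))) (at x)"
    unfolding L_def by (auto intro!: derivative_eq_intros ang_deriv[OF assms])
  moreover have "\<rho> * cos (ang x) = - frc q (K x) * rate (ang x)"
    using frc_yof_uof[OF q assms[unfolded K_pos_iff]] by (simp add: K_def rate_def)
  ultimately show ?thesis using rate_ang_pos[OF assms] by (simp add: mult.assoc)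
qed

lemma KL_level: "(L x)\<^sup>2 / 2 + pot q (K x) = level q \<rho>"
proof -
  have "pot q (K x) = (\<rho> * cos (ang x))\<^sup>2 / 2 - 1 / (q + 1)"
    unfolding K_def pot_yof[OF q arg_ge] by simp
  moreover have "(\<rho> * sin (ang x))\<^sup>2 + (\<rho> * cos (ang x))\<^sup>2 = \<rho>\<^sup>2"
    using sin_cos_squared_add[of "ang x"] by (metis distrib_left mult.right_neutral power_mult_distrib)
  ultimately show ?thesis by (simp add: level_def L_def add_divide_distrib[symmetric] diff_add_eq[symmetric])
qed

lemma orbit_integral:
  assumes "continuous_on {0..P} h"
  shows "integral {0..P} h = integral {0..2 * pi} (\<lambda>\<theta>. rate \<theta> * h (clk \<theta>))"
proof -
  have "((\<lambda>\<theta>. rate \<theta> *\<^sub>R h (clk \<theta>)) has_integral integral {clk 0..clk (2 * pi)} h) {0..2 * pi}"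
  proof (rule has_integral_substitution)
    show "clk ` {0..2 * pi} \<subseteq> {0..P}"
      using clk_strict_mono by (force simp: clk_2pi[symmetric] order_le_less)
    show "clk 0 \<le> clk (2 * pi)" using P_pos by (simp add: clk_2pi)
    show "(clk has_real_derivative rate \<theta>) (at \<theta> within {0..2 * pi})" for \<theta>
      by (rule has_field_derivative_at_within[OF clk_deriv])
  qed (use assms in auto)
  then show ?thesis by (simp add: clk_2pi integral_unique)
qed

lemma integral_K: "integral {0..P} K = mass q \<rho>"
  unfolding orbit_integral[OF K_cont] mass_def cyc_def by (simp add: K_def rate_def mult.commute)

lemma integral_L2: "integral {0..P} (\<lambda>x. (L x)\<^sup>2 / 2) = kinetic q \<rho>"
proof -
  have "integral {0..P} (\<lambda>x. (L x)\<^sup>2 / 2) = integral {0..2 * pi} (\<lambda>\<theta>. rate \<theta> * ((L (clk \<theta>))\<^sup>2 / 2))"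
    by (intro orbit_integral continuous_intros L_cont) auto
  also have "(\<lambda>\<theta>. rate \<theta> * ((L (clk \<theta>))\<^sup>2 / 2)) = (\<lambda>\<theta>. ((\<rho>\<^sup>2 - (- \<rho> * cos \<theta>)\<^sup>2) * uof q (- \<rho> * cos \<theta>)) / 2)"
    by (simp add: L_def rate_def power_mult_distrib sin_squared_eq algebra_simps fun_eq_iff)
  also have "integral {0..2 * pi} \<dots> = kinetic q \<rho>" by (simp add: kinetic_def cyc_def)
  finally show ?thesis .
qed

lemma cos_ang_inside:
  assumes "x \<in> {0<..<P}" shows "cos (ang x) \<noteq> 1"
proof
  have a: "0 < ang x" "ang x < 2 * pi"
    using ang_less[of 0 x] ang_less[of x P] ang_shift[of 0] assms by auto
  assume "cos (ang x) = 1"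
  then obtain n :: int where n: "ang x = of_int n * (2 * pi)" unfolding cos_one_2pi_int by auto
  then have "0 < n" "real_of_int n < 1" using a by (auto simp: zero_less_mult_iff)
  then show False by simp
qed

lemma K_pos_inside: "x \<in> {0<..<P} \<Longrightarrow> 0 < K x"
  unfolding K_pos_iff by (intro arg_gt cos_ang_inside)

lemma K_min_inside:
  assumes "x \<in> {0<..<P}" shows "K 0 < K x"
proof -
  have "- \<rho> * cos (ang 0) < - \<rho> * cos (ang x)"
    using cos_ang_inside[OF assms] rho cos_le_one[of "ang x"] by (simp add: order_le_less)
  then show ?thesis unfolding K_def using yof_strict_mono[OF q arg_ge] by blast
qed

lemma K_0: "K 0 = yof q (- \<rho>)" by (simp add: K_def)

lemma L_0 [simp]: "L 0 = 0" by (simp add: L_def)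

lemma L_P [simp]: "L P = 0" using ang_shift[of 0] by (simp add: L_def)

text \<open>A smaller period would repeat the minimum at 0 inside \<open>{0<..<P}\<close>, where
  \<open>K\<close> is strictly larger.\<close>

lemma K_least_period:
  assumes "\<rho> < rho0 q" shows "is_least_period K P"
  unfolding is_least_period_def periodic_with_def
proof (intro conjI allI impI P_pos K_periodic)
  fix S assume S: "0 < S \<and> S < P"
  then have "K 0 < K (0 + S)" using K_min_inside[of S] by simp
  then show "\<not> (\<forall>x. K (x + S) = K x)" by (metis less_irrefl)
qed

lemma K_pos: "\<rho> < rho0 q \<Longrightarrow> 0 < K x"
  unfolding K_pos_iff by (rule arg_gt')

end

text \<open>Functions built from a solution \<open>k\<close> and its velocity \<open>l\<close>. The equation makes this class closed under
  differentiation, which gives the smoothness of \<open>k\<close>.\<close>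

inductive_set ode_alg :: "real \<Rightarrow> (real \<Rightarrow> real) \<Rightarrow> (real \<Rightarrow> real) \<Rightarrow> (real \<Rightarrow> real) set"
  for q :: real and k l :: "real \<Rightarrow> real" where
  base: "k \<in> ode_alg q k l"
| vel: "l \<in> ode_alg q k l"
| force: "(\<lambda>x. frc q (k x)) \<in> ode_alg q k l"
| power: "(\<lambda>x. k x powr a) \<in> ode_alg q k l"
| const: "(\<lambda>x. c) \<in> ode_alg q k l"
| add: "f \<in> ode_alg q k l \<Longrightarrow> g \<in> ode_alg q k l \<Longrightarrow> (\<lambda>x. f x + g x) \<in> ode_alg q k l"
| mult: "f \<in> ode_alg q k l \<Longrightarrow> g \<in> ode_alg q k l \<Longrightarrow> (\<lambda>x. f x * g x) \<in> ode_alg q k l"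

text \<open>Here \<open>c\<close> is the Lagrange multiplier. The normalized orbits have
  \<open>B = 1\<close> and \<open>c = 0\<close>; dilating them by \<open>s\<close> leads to
  \<open>c = B * frc q s\<close>.\<close>

locale ode_sol =
  fixes q B c :: real and k l :: "real \<Rightarrow> real" and W :: "real set"
  assumes W: "open W" and pos: "x \<in> W \<Longrightarrow> 0 < k x"
    and k: "x \<in> W \<Longrightarrow> (k has_real_derivative l x) (at x)"
    and l: "x \<in> W \<Longrightarrow> (l has_real_derivative c - B * frc q (k x)) (at x)"
begin

lemma powr_deriv:
  "x \<in> W \<Longrightarrow> ((\<lambda>x. k x powr a) has_real_derivative a * k x powr (a - 1) * l x) (at x)"
  using DERIV_powr[OF k pos, of x "\<lambda>_. a" 0] pos[of x] by (auto simp: field_simps powr_diff)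

lemma frc_k_deriv:
  "x \<in> W \<Longrightarrow> ((\<lambda>x. frc q (k x)) has_real_derivative k x powr (q - 1) * l x) (at x)"
  by (rule DERIV_chain2[OF frc_deriv[OF pos] k])

lemma alg_deriv:
  assumes "f \<in> ode_alg q k l"
  shows "\<exists>f'\<in>ode_alg q k l. \<forall>x\<in>W. (f has_real_derivative f' x) (at x)"
  using assms
proof induction
  case base
  then show ?case using k ode_alg.vel by blast
next
  case vel
  have 1: "(\<lambda>x. c + (- B) * frc q (k x)) \<in> ode_alg q k l" by (intro ode_alg.intros)
  have 2: "\<forall>x\<in>W. (l has_real_derivative c + (- B) * frc q (k x)) (at x)" using l by simp
  show ?case by (rule bexI[where x = "\<lambda>x. c + (- B) * frc q (k x)"]) (fact 2, fact 1)
next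
  case force
  have "(\<lambda>x. k x powr (q - 1) * l x) \<in> ode_alg q k l" by (intro ode_alg.intros)
  then show ?case
    by (rule bexI[where x = "\<lambda>x. k x powr (q - 1) * l x", rotated]) (intro ballI frc_k_deriv)
next
  case (power a)
  have "(\<lambda>x. a * k x powr (a - 1) * l x) \<in> ode_alg q k l" by (intro ode_alg.intros)
  then show ?case
    by (rule bexI[where x = "\<lambda>x. a * k x powr (a - 1) * l x", rotated]) (intro ballI powr_deriv)
next
  case (const c)
  then show ?case using ode_alg.const[of 0] by (intro bexI[of _ "\<lambda>_. 0"]) auto
next
  case (add f g)
  then obtain f' g' where "f' \<in> ode_alg q k l" "g' \<in> ode_alg q k l"
    "\<forall>x\<in>W. (f has_real_derivative f' x) (at x)" "\<forall>x\<in>W. (g has_real_derivative g' x) (at x)" by blast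
  then show ?case
    by (intro bexI[of _ "\<lambda>x. f' x + g' x"]) (auto intro!: ode_alg.add derivative_eq_intros)
next
  case (mult f g)
  then obtain f' g' where "f' \<in> ode_alg q k l" "g' \<in> ode_alg q k l"
    "\<forall>x\<in>W. (f has_real_derivative f' x) (at x)" "\<forall>x\<in>W. (g has_real_derivative g' x) (at x)" by blast
  then show ?case using mult.hyps
    by (intro bexI[of _ "\<lambda>x. f x * g' x + f' x * g x"] ballI DERIV_mult')
      (auto intro!: ode_alg.add ode_alg.mult)
qed

lemma deriv_in_alg: "\<exists>f\<in>ode_alg q k l. \<forall>x\<in>W. (deriv ^^ n) k x = f x"
proof (induction n)
  case 0
  then show ?case using ode_alg.base by force
next
  case (Suc n)
  then obtain f where f: "f \<in> ode_alg q k l" "\<forall>x\<in>W. (deriv ^^ n) k x = f x" by blast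
  obtain f' where f': "f' \<in> ode_alg q k l" "\<forall>x\<in>W. (f has_real_derivative f' x) (at x)"
    using alg_deriv[OF f(1)] by blast
  have "(deriv ^^ Suc n) k x = f' x" if "x \<in> W" for x
  proof -
    have "deriv ((deriv ^^ n) k) x = deriv f x"
      using f(2) that by (intro deriv_cong_ev eventually_mono[OF eventually_nhds_in_open[OF W that]]) auto
    then show ?thesis using DERIV_imp_deriv f'(2) that by force
  qed
  then show ?case using f'(1) by blast
qed

lemma deriv_differentiable:
  assumes "x \<in> W" shows "(deriv ^^ n) k field_differentiable (at x)"
proof -
  obtain f where f: "f \<in> ode_alg q k l" "\<forall>x\<in>W. (deriv ^^ n) k x = f x" using deriv_in_alg by blast
  obtain f' where f': "\<forall>x\<in>W. (f has_real_derivative f' x) (at x)" using alg_deriv[OF f(1)] by blast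
  have "((deriv ^^ n) k has_real_derivative f' x) (at x)"
    using f'[rule_format, OF assms]
    by (subst DERIV_cong_ev[OF refl _ refl, where g = f])
      (use f(2) assms in \<open>auto intro: eventually_mono[OF eventually_nhds_in_open[OF W assms]]\<close>)
  then show ?thesis by (auto simp: field_differentiable_def)
qed

lemma Ck: "Ck_on j k W"
  unfolding Ck_on_def
  using deriv_differentiable
  by (auto intro!: continuous_at_imp_continuous_on field_differentiable_imp_continuous_at)

lemma deriv_1: "x \<in> W \<Longrightarrow> deriv k x = l x"
  using k by (rule DERIV_imp_deriv)

lemma deriv_2:
  assumes "x \<in> W" shows "(deriv ^^ 2) k x = c - B * frc q (k x)"
proof -
  have "deriv (deriv k) x = deriv l x"
    using deriv_1 by (intro deriv_cong_ev eventually_mono[OF eventually_nhds_in_open[OF W assms]]) auto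
  then show ?thesis using DERIV_imp_deriv[OF l[OF assms]] by (simp add: numeral_2_eq_2)
qed

lemma deriv_3:
  assumes "x \<in> W" shows "(deriv ^^ 3) k x = - B * k x powr (q - 1) * l x"
proof -
  have "deriv ((deriv ^^ 2) k) x = deriv (\<lambda>x. c - B * frc q (k x)) x"
    using deriv_2 by (intro deriv_cong_ev eventually_mono[OF eventually_nhds_in_open[OF W assms]]) auto
  also have "\<dots> = - B * k x powr (q - 1) * l x"
    by (rule DERIV_imp_deriv) (auto intro!: derivative_eq_intros frc_k_deriv assms)
  finally show ?thesis by (simp add: eval_nat_numeral)
qed

text \<open>Differentiating the second-order equation gives k''' = -B k^(q-1) k', and multiplying by
  k^n shows that the flux is identically zero.\<close>

lemma steady:
  assumes "q = m - n + 1" shows "steady_eq_on n m B k W"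
  unfolding steady_eq_on_def
proof
  fix x assume x: "x \<in> W"
  have "steady_flux n m B k y = 0" if y: "y \<in> W" for y
  proof -
    have "k y powr n * k y powr (q - 1) = k y powr m"
      using assms by (simp add: powr_add[symmetric])
    note e = this
    show ?thesis by (simp add: steady_flux_def deriv_1[OF y] deriv_3[OF y] e[symmetric])
  qed
  then have "\<forall>\<^sub>F y in nhds x. steady_flux n m B k y = 0"
    by (intro eventually_mono[OF eventually_nhds_in_open[OF W x]])
  then show "(steady_flux n m B k has_real_derivative 0) (at x)"
    by (subst DERIV_cong_ev[OF refl _ refl, where g = "\<lambda>_. 0"]) auto
qed

end

section \<open>Uniqueness and periodicity for the second-order equation\<close>

lemma frc_lipschitz:
  assumes "0 < a" "a \<le> x" "x \<le> b" "a \<le> y" "y \<le> b"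
  shows "\<bar>frc q x - frc q y\<bar> \<le> (a powr (q - 1) + b powr (q - 1)) * \<bar>x - y\<bar>"
proof -
  have *: "\<bar>frc q x - frc q y\<bar> \<le> (a powr (q - 1) + b powr (q - 1)) * \<bar>x - y\<bar>"
    if xy: "a \<le> x" "x < y" "y \<le> b" for x y
  proof -
    obtain z where z: "x < z" "z < y" "frc q y - frc q x = (y - x) * z powr (q - 1)"
      using MVT2[OF xy(2), of "frc q" "\<lambda>z. z powr (q - 1)"] frc_deriv[of _ q] assms(1) xy by force
    \<comment> \<open>The power is increasing or decreasing according to the sign of
      \<open>q - 1\<close>; the sum of its two end values is a bound in either case.\<close>
    have "z powr (q - 1) \<le> a powr (q - 1) + b powr (q - 1)"
    proof (cases "1 \<le> q")
      case True
      then have "z powr (q - 1) \<le> b powr (q - 1)" using z xy assms(1) by (intro powr_mono2) auto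
      then show ?thesis by (simp add: add_increasing)
    next
      case False
      then have "z powr (q - 1) \<le> a powr (q - 1)" using z xy assms(1) by (intro powr_mono2') auto
      then show ?thesis by (simp add: add_increasing2)
    qed
    then have "(y - x) * z powr (q - 1) \<le> (y - x) * (a powr (q - 1) + b powr (q - 1))"
      using xy by (intro mult_left_mono) auto
    moreover have "0 \<le> (y - x) * z powr (q - 1)" using xy by simp
    moreover have "\<bar>frc q x - frc q y\<bar> = (y - x) * z powr (q - 1)" using z(3) calculation(2) by linarith
    ultimately show ?thesis using xy by (simp add: mult.commute)
  qed
  show ?thesis
    using *[of x y] *[of y x] assms by (cases x y rule: linorder_cases) (auto simp: abs_minus_commute)
qed

lemma gronwall_zero:
  fixes w w' :: "real \<Rightarrow> real"
  assumes d: "\<And>x. (w has_real_derivative w' x) (at x)" and b: "\<And>x. \<bar>w' x\<bar> \<le> C * w x"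
    and n: "\<And>x. 0 \<le> w x" and "w 0 = 0"
  shows "w x = 0"
proof (cases "0 \<le> x")
  case True
  have "w x * exp (- C * x) \<le> w 0 * exp (- C * 0)"
  proof (rule DERIV_nonpos_imp_nonincreasing[OF True, of "\<lambda>x. w x * exp (- C * x)"])
    fix y
    have "((\<lambda>x. w x * exp (- C * x)) has_real_derivative (w' y - C * w y) * exp (- C * y)) (at y)"
      by (auto intro!: derivative_eq_intros d simp: algebra_simps)
    moreover have "(w' y - C * w y) * exp (- C * y) \<le> 0" using b[of y] by (simp add: mult_le_0_iff)
    ultimately show "\<exists>d. ((\<lambda>x. w x * exp (- C * x)) has_real_derivative d) (at y) \<and> d \<le> 0" by blast
  qed
  then show ?thesis using n[of x] assms(4) by (simp add: mult_le_0_iff)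
next
  case False
  then have "x \<le> 0" by simp
  have "w x * exp (C * x) \<le> w 0 * exp (C * 0)"
  proof (rule DERIV_nonneg_imp_nondecreasing[OF \<open>x \<le> 0\<close>, of "\<lambda>x. w x * exp (C * x)"])
    fix y
    have "((\<lambda>x. w x * exp (C * x)) has_real_derivative (w' y + C * w y) * exp (C * y)) (at y)"
      by (auto intro!: derivative_eq_intros d simp: algebra_simps)
    moreover have "0 \<le> (w' y + C * w y) * exp (C * y)" using b[of y] by simp
    ultimately show "\<exists>d. ((\<lambda>x. w x * exp (C * x)) has_real_derivative d) (at y) \<and> 0 \<le> d" by blast
  qed
  then show ?thesis using n[of x] assms(4) by (simp add: mult_le_0_iff)
qed

text \<open>The force is Lipschitz only on compact sets of positive heights, hence the common
  bounds. Gronwall's inequality is applied to the squared distance in phase space.\<close>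

lemma ode_unique:
  assumes 1: "ode_sol q 1 0 k1 l1 UNIV" and 2: "ode_sol q 1 0 k2 l2 UNIV"
    and bd: "0 < a" "\<And>x. k1 x \<in> {a..b}" "\<And>x. k2 x \<in> {a..b}"
    and init: "k1 0 = k2 0" "l1 0 = l2 0"
  shows "k1 x = k2 x"
proof -
  interpret s1: ode_sol q 1 0 k1 l1 UNIV by (rule 1)
  interpret s2: ode_sol q 1 0 k2 l2 UNIV by (rule 2)
  define M where "M = a powr (q - 1) + b powr (q - 1)"
  have M: "0 \<le> M" by (simp add: M_def)
  define w where "w = (\<lambda>x. (k1 x - k2 x)\<^sup>2 + (l1 x - l2 x)\<^sup>2)"
  define w' where "w' = (\<lambda>x. 2 * (k1 x - k2 x) * (l1 x - l2 x) - 2 * (l1 x - l2 x) * (frc q (k1 x) - frc q (k2 x)))"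
  have "w x = 0"
  proof (rule gronwall_zero[where w = w and w' = w' and C = "1 + M"])
    show "(w has_real_derivative w' x) (at x)" for x
      unfolding w_def w'_def
      by (rule derivative_eq_intros s1.k s1.l s2.k s2.l UNIV_I refl)+ (simp add: algebra_simps)
    show "\<bar>w' x\<bar> \<le> (1 + M) * w x" for x
    proof -
      define u v f where "u = k1 x - k2 x" and "v = l1 x - l2 x" and "f = frc q (k1 x) - frc q (k2 x)"
      have f: "\<bar>f\<bar> \<le> M * \<bar>u\<bar>" unfolding f_def u_def M_def
        using frc_lipschitz[OF bd(1), of "k1 x" b "k2 x" q] bd(2,3)[of x] by auto
      have uv: "2 * (\<bar>u\<bar> * \<bar>v\<bar>) \<le> u\<^sup>2 + v\<^sup>2"
        using zero_le_power2[of "\<bar>u\<bar> - \<bar>v\<bar>"] by (simp add: power2_diff)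
      have "\<bar>w' x\<bar> = \<bar>2 * u * v - 2 * v * f\<bar>" by (simp add: w'_def u_def v_def f_def)
      also have "\<dots> \<le> \<bar>2 * u * v\<bar> + \<bar>2 * v * f\<bar>" by (rule abs_triangle_ineq4)
      also have "\<dots> = 2 * (\<bar>u\<bar> * \<bar>v\<bar>) + 2 * (\<bar>v\<bar> * \<bar>f\<bar>)" by (simp add: abs_mult)
      also have "\<dots> \<le> 2 * (\<bar>u\<bar> * \<bar>v\<bar>) + 2 * (\<bar>v\<bar> * (M * \<bar>u\<bar>))"
        using f by (intro add_left_mono mult_left_mono) auto
      also have "\<dots> = (1 + M) * (2 * (\<bar>u\<bar> * \<bar>v\<bar>))" by (simp add: algebra_simps)
      also have "\<dots> \<le> (1 + M) * (u\<^sup>2 + v\<^sup>2)" using uv M by (intro mult_left_mono) auto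
      finally show ?thesis by (simp add: w_def u_def v_def)
    qed
  qed (use init in \<open>auto simp: w_def\<close>)
  then show ?thesis by (simp add: w_def add_nonneg_eq_0_iff)
qed

lemma periodic_of_int:
  assumes "periodic_with f T" shows "f (x + T * of_int n) = f x"
proof -
  have p: "f (x + T * of_nat m) = f x" for x and m :: nat
  proof (induction m)
    case (Suc m)
    have "f (x + T * of_nat (Suc m)) = f ((x + T * of_nat m) + T)" by (simp add: algebra_simps)
    then show ?case using assms Suc by (simp add: periodic_with_def)
  qed simp
  show ?thesis
  proof (cases "0 \<le> n")
    case True
    then show ?thesis using p[of x "nat n"] by simp
  next
    case False
    then show ?thesis using p[of "x + T * of_int n" "nat (- n)"] by simp
  qed
qed

lemma periodic_reduce:
  assumes "periodic_with f T" "0 < T"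
  shows "\<exists>y\<in>{0..<T}. f y = f x"
proof -
  define y where "y = x + T * of_int (- \<lfloor>x / T\<rfloor>)"
  have "of_int \<lfloor>x / T\<rfloor> \<le> x / T" "x / T < of_int \<lfloor>x / T\<rfloor> + 1" by linarith+
  then have "T * of_int \<lfloor>x / T\<rfloor> \<le> x" "x < T * of_int \<lfloor>x / T\<rfloor> + T"
    using mult_left_mono[of "of_int \<lfloor>x / T\<rfloor>" "x / T" T] mult_strict_left_mono[of "x / T" "of_int \<lfloor>x / T\<rfloor> + 1" T] assms(2)
    by (auto simp: distrib_left)
  then have "y \<in> {0..<T}" by (simp add: y_def)
  moreover have "f y = f x" unfolding y_def by (rule periodic_of_int[OF assms(1)])
  ultimately show ?thesis by blast
qed

lemma periodic_min_max:
  fixes f :: "real \<Rightarrow> real"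
  assumes "periodic_with f T" "0 < T" "continuous_on UNIV f"
  obtains x0 x1 where "x0 \<in> {0..T}" "\<And>x. f x0 \<le> f x" "\<And>x. f x \<le> f x1"
proof -
  have c: "continuous_on {0..T} f" using assms(3) by (rule continuous_on_subset) simp
  obtain x0 where x0: "x0 \<in> {0..T}" "\<forall>y\<in>{0..T}. f x0 \<le> f y"
    using continuous_attains_inf[OF _ _ c] assms(2) by fastforce
  obtain x1 where x1: "x1 \<in> {0..T}" "\<forall>y\<in>{0..T}. f y \<le> f x1"
    using continuous_attains_sup[OF _ _ c] assms(2) by fastforce
  have "f x0 \<le> f x \<and> f x \<le> f x1" for x
  proof -
    obtain y where "y \<in> {0..<T}" "f y = f x" using periodic_reduce[OF assms(1,2)] by blast
    then show ?thesis using x0(2) x1(2) by (metis atLeastLessThan_iff atLeastAtMost_iff less_imp_le)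
  qed
  then show ?thesis using x0(1) that by blast
qed

lemma least_period_unique: "is_least_period f S \<Longrightarrow> is_least_period f T \<Longrightarrow> S = T"
  unfolding is_least_period_def by (cases S T rule: linorder_cases) auto

lemma ode_sol_cont:
  assumes "ode_sol q B c k l UNIV" shows "continuous_on UNIV k"
proof -
  interpret ode_sol q B c k l UNIV by (rule assms)
  show ?thesis using k by (intro continuous_at_imp_continuous_on ballI DERIV_isCont) auto
qed

lemma ode_sol_unique_periodic:
  assumes 1: "ode_sol q 1 0 k1 l1 UNIV" and 2: "ode_sol q 1 0 k2 l2 UNIV"
    and p1: "periodic_with k1 S" "0 < S" and p2: "periodic_with k2 T" "0 < T"
    and init: "k1 0 = k2 0" "l1 0 = l2 0"
  shows "k1 = k2"
proof
  fix x
  obtain a1 b1 where bd1: "\<And>x. k1 a1 \<le> k1 x" "\<And>x. k1 x \<le> k1 b1"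
    using periodic_min_max[OF p1 ode_sol_cont[OF 1]] by metis
  obtain a2 b2 where bd2: "\<And>x. k2 a2 \<le> k2 x" "\<And>x. k2 x \<le> k2 b2"
    using periodic_min_max[OF p2 ode_sol_cont[OF 2]] by metis
  show "k1 x = k2 x"
  proof (rule ode_unique[OF 1 2])
    show "0 < min (k1 a1) (k2 a2)" using ode_sol.pos[OF 1] ode_sol.pos[OF 2] by simp
    show "k1 x \<in> {min (k1 a1) (k2 a2)..max (k1 b1) (k2 b2)}" for x
      using bd1[of x] by (auto simp: min_le_iff_disj le_max_iff_disj)
    show "k2 x \<in> {min (k1 a1) (k2 a2)..max (k1 b1) (k2 b2)}" for x
      using bd2[of x] by (auto simp: min_le_iff_disj le_max_iff_disj)
  qed (use init in auto)
qed

section \<open>Orbits as the normalized solutions k\<close>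

context orbit begin

lemma K_sol: "\<rho> < rho0 q \<Longrightarrow> ode_sol q 1 0 K L UNIV"
  by unfold_locales (auto simp: K_pos K_deriv L_deriv)

lemma K_periodic_with: "periodic_with K P" by (simp add: periodic_with_def K_periodic)

lemma K_is_k:
  assumes "\<rho> < rho0 q" shows "is_k q (yof q (- \<rho>)) K"
proof -
  interpret ode_sol q 1 0 K L UNIV by (rule K_sol[OF assms])
  have "(deriv ^^ 2) K x + frc q (K x) = 0" for x using deriv_2[of x] by simp
  then show ?thesis
    unfolding is_k_def frc_def[symmetric]
    using Ck pos P_pos K_periodic_with K_0 deriv_1[of 0] by auto
qed

lemma is_k_unique:
  assumes r: "\<rho> < rho0 q" and k: "is_k q (yof q (- \<rho>)) k" shows "k = K"
proof -
  have C: "Ck_on 2 k UNIV" using k by (auto simp: is_k_def)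
  have d: "(deriv ^^ j) k field_differentiable (at x)" if "j < 2" for j x
    using C that by (auto simp: Ck_on_def)
  obtain T where T: "0 < T" "periodic_with k T" using k by (auto simp: is_k_def)
  have e: "(deriv ^^ 2) k x = - frc q (k x)" for x
    using k unfolding is_k_def frc_def[symmetric] by (simp add: eq_neg_iff_add_eq_0)
  have "ode_sol q 1 0 k (deriv k) UNIV"
  proof
    show "(k has_real_derivative deriv k x) (at x)" for x
      using d[of 0 x] by (simp add: DERIV_deriv_iff_field_differentiable)
    show "(deriv k has_real_derivative 0 - 1 * frc q (k x)) (at x)" for x
      using d[of 1 x] e[of x] DERIV_deriv_iff_field_differentiable[of "deriv k" x]
      by (simp add: numeral_2_eq_2)
  qed (use k in \<open>auto simp: is_k_def\<close>)
  then show ?thesis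
    by (rule ode_sol_unique_periodic[OF _ K_sol[OF r] T(2,1) K_periodic_with P_pos])
      (use k K_0 in \<open>auto simp: is_k_def\<close>)
qed

text \<open>Uniqueness evaluates the descriptions in \<open>k_sol\<close> and \<open>P_fun\<close>:
  the solution with minimum \<open>\<alpha> = yof q (- \<rho>)\<close> is the orbit of amplitude
  \<open>\<rho>\<close>.\<close>

lemma E_fun_orbit:
  assumes r: "\<rho> < rho0 q"
  shows "E_fun q (yof q (- \<rho>)) = period q \<rho> powr (3 - q) * mass q \<rho> powr (q - 1)"
proof -
  have k: "k_sol q (yof q (- \<rho>)) = K"
    unfolding k_sol_def by (rule the_equality) (auto intro: K_is_k is_k_unique r)
  have p: "P_fun q (yof q (- \<rho>)) = P"
    unfolding P_fun_def k
    by (rule the_equality) (auto intro: K_least_period r least_period_unique)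
  show ?thesis unfolding E_fun_def A_fun_def p k integral_K by (simp add: P_def)
qed

end

text \<open>At a minimum k'' is nonnegative, so the force is nonpositive and the height at most 1.
  Height 1 would force the constant solution by uniqueness. The minimum thus has an amplitude
  \<open>- \<rho>\<close> in the admissible range, and uniqueness gives the rest.\<close>

lemma periodic_solution_is_orbit:
  assumes q: "-1 < q" and sol: "ode_sol q 1 0 k l UNIV"
    and per: "periodic_with k T" "0 < T" and min: "\<And>x. k 0 \<le> k x"
    and nonconst: "\<not> (\<exists>c. \<forall>x. k x = c)"
  obtains \<rho> where "0 < \<rho>" "\<rho> < rho0 q" "k = orbit.K q \<rho>"
proof -
  interpret ode_sol q 1 0 k l UNIV by (rule sol)
  have l0: "l 0 = 0" by (rule DERIV_local_min[OF k, of 0 1]) (use min in auto)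
  have "frc q (k 0) \<le> 0"
  proof (rule ccontr)
    assume "\<not> ?thesis"
    then have "\<exists>d>0. \<forall>h>0. h < d \<longrightarrow> l (0 + h) < l 0" using l[of 0] by (intro DERIV_neg_dec_right) auto
    then obtain d where d: "0 < d" "\<And>h. 0 < h \<Longrightarrow> h < d \<Longrightarrow> l h < 0" by (auto simp: l0)
    have "k (d / 2) < k 0"
    proof (rule DERIV_neg_imp_decreasing_open[of 0 "d / 2" k])
      show "\<exists>y. (k has_real_derivative y) (at x) \<and> y < 0" if "0 < x" "x < d / 2" for x
        using k[of x] d(2)[of x] that by auto
      show "continuous_on {0..d / 2} k" using ode_sol_cont[OF sol] by (rule continuous_on_subset) simp
    qed (use d in simp)
    then show False using min[of "d / 2"] by simp
  qed
  then have k1: "k 0 \<le> 1" using frc_pos[of "k 0" q] by (cases "1 < k 0") auto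
  have "k 0 \<noteq> 1"
  proof
    assume "k 0 = 1"
    moreover have "ode_sol q 1 0 (\<lambda>_. 1) (\<lambda>_. 0) UNIV" by unfold_locales auto
    ultimately have "k = (\<lambda>_. 1)"
      using ode_sol_unique_periodic[OF sol _ per, of "\<lambda>_. 1" "\<lambda>_. 0" 1] l0
      by (simp add: periodic_with_def)
    then show False using nonconst by auto
  qed
  then have k01: "0 < k 0" "k 0 < 1" using k1 pos by auto
  define \<rho> where "\<rho> = - amp q (k 0)"
  have \<rho>: "0 < \<rho>" "\<rho> < rho0 q"
    using amp_strict_mono[OF q, of 0 "k 0"] amp_strict_mono[OF q, of "k 0" 1] k01 amp_0[OF q]
    by (auto simp: \<rho>_def)
  interpret o: orbit q \<rho> using q \<rho> by unfold_locales auto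
  have "yof q (- \<rho>) = k 0" using yof_amp[OF q, of "k 0"] k01 by (simp add: \<rho>_def)
  then have "k 0 = o.K 0" by (simp only: o.K_0)
  then have "k = o.K"
    by (intro ode_sol_unique_periodic[OF sol o.K_sol[OF \<rho>(2)] per o.K_periodic_with o.P_pos]) (auto simp: l0)
  then show ?thesis using \<rho> that by blast
qed

text \<open>The hypothesis on \<^term>\<open>E_fun q\<close> and the Hessian bound both say that
  \<^term>\<open>period q \<rho> powr (3 - q) * mass q \<rho> powr (q - 1)\<close> decreases in \<open>\<rho>\<close>; this is the sign
  of its logarithmic derivative.\<close>

lemma log_derivative_sign:
  assumes cases: "(-1 < q \<and> q < 1) \<or> (2 \<le> q \<and> q < 3) \<or>
      (1 < q \<and> q < 2 \<and>
        (\<forall>\<alpha>. 0 < \<alpha> \<and> \<alpha> < 1 \<longrightarrow> (\<exists>D>0. (E_fun q has_real_derivative D) (at \<alpha>))))"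
    and rho: "0 < \<rho>" "\<rho> < rho0 q"
  shows "(3 - q) * dperiod q \<rho> / period q \<rho> + (q - 1) * dmass q \<rho> / mass q \<rho> < 0"
proof -
  have q: "-1 < q" using cases by auto
  interpret film_cycle q \<rho> using rho q by unfold_locales auto
  show ?thesis
  proof (cases "q < 1 \<or> 2 \<le> q")
    case True
    have "0 \<le> (q - 1) * (q - 2)" using True by (auto intro: mult_nonpos_nonpos)
    then show ?thesis using log_derivative_negative cases True by auto
  next
    case False
    define f where "f = (\<lambda>\<rho>. period q \<rho> powr (3 - q) * mass q \<rho> powr (q - 1))"
    define \<alpha> where "\<alpha> = yof q (- \<rho>)"
    have "0 < \<alpha>" "\<alpha> < 1"
      using yof_pos[OF q, of "- \<rho>"] yof_strict_mono[OF q, of "- \<rho>" 0] yof_0[OF q] rho by (auto simp: \<alpha>_def)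
    then obtain D where D: "0 < D" "(E_fun q has_real_derivative D) (at \<alpha>)" using cases False by auto
    \<comment> \<open>The minimum \<open>\<alpha> = yof q (- \<rho>)\<close> decreases as the
      amplitude grows, so a function increasing in \<open>\<alpha>\<close> decreases in
      \<open>\<rho>\<close>.\<close>
    have "((\<lambda>r. yof q (- r)) has_real_derivative uof q (- \<rho>) * - 1) (at \<rho>)"
      by (rule DERIV_chain2[OF yof_deriv[OF q]]) (use rho in \<open>auto intro!: derivative_eq_intros\<close>)
    then have "((\<lambda>r. E_fun q (yof q (- r))) has_real_derivative D * (uof q (- \<rho>) * - 1)) (at \<rho>)"
      using D(2) unfolding \<alpha>_def by (rule DERIV_chain2[rotated])
    moreover have "\<forall>\<^sub>F r in nhds \<rho>. E_fun q (yof q (- r)) = f r"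
    proof (rule eventually_mono[OF eventually_nhds_in_open[of "{0<..<rho0 q}"]])
      fix r assume r: "r \<in> {0<..<rho0 q}"
      interpret o: orbit q r using r q by unfold_locales auto
      show "E_fun q (yof q (- r)) = f r" using o.E_fun_orbit r by (simp add: f_def)
    qed (use rho in auto)
    ultimately have 1: "(f has_real_derivative D * (uof q (- \<rho>) * - 1)) (at \<rho>)"
      by (subst (asm) DERIV_cong_ev[OF refl _ refl])
    have N: "f \<rho> > 0" using per_pos area_pos by (simp add: f_def)
    define N where "N = (3 - q) * dperiod q \<rho> / period q \<rho> + (q - 1) * dmass q \<rho> / mass q \<rho>"
    have a: "((\<lambda>r. period q r powr (3 - q)) has_real_derivative
        (3 - q) * period q \<rho> powr (3 - q) * (\<rho> * dperiod q \<rho> / period q \<rho>)) (at \<rho>)"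
      using DERIV_powr[OF period_deriv per_pos, of "\<lambda>_. 3 - q" 0] per_pos
      by (simp add: field_simps)
    have b: "((\<lambda>r. mass q r powr (q - 1)) has_real_derivative
        (q - 1) * mass q \<rho> powr (q - 1) * (\<rho> * dmass q \<rho> / mass q \<rho>)) (at \<rho>)"
      using DERIV_powr[OF mass_deriv area_pos, of "\<lambda>_. q - 1" 0] area_pos
      by (simp add: field_simps)
    have "(f has_real_derivative f \<rho> * \<rho> * N) (at \<rho>)"
    proof -
      have "f \<rho> * \<rho> * N = period q \<rho> powr (3 - q) * ((q - 1) * mass q \<rho> powr (q - 1) * (\<rho> * dmass q \<rho> / mass q \<rho>))
          + (3 - q) * period q \<rho> powr (3 - q) * (\<rho> * dperiod q \<rho> / period q \<rho>) * mass q \<rho> powr (q - 1)"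
        by (simp add: f_def N_def algebra_simps diff_divide_distrib)
      then show ?thesis using DERIV_mult'[OF a b] by (simp add: f_def)
    qed
    then have "f \<rho> * \<rho> * N = D * (uof q (- \<rho>) * - 1)" using 1 by (rule DERIV_unique)
    moreover have "0 < uof q (- \<rho>)" using uof_pos[OF q] rho by simp
    ultimately have "f \<rho> * \<rho> * N < 0" using D(1) by simp
    then show ?thesis using N rho by (simp add: mult_less_0_iff N_def)
  qed
qed

section \<open>Families of fixed area\<close>

text \<open>Continuity of \<open>g\<close> on the closed interval suffices, so this reaches
  \<open>rho0 q\<close>, where \<open>uof q\<close> is known to be continuous but the derivative
  formulas stop.\<close>

lemma cyc_cont:
  assumes "0 \<le> R" "continuous_on {-R..R} g"
  shows "continuous_on {0..R} (\<lambda>\<rho>. cyc \<rho> g)"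
proof -
  have "continuous_on {0..R} (\<lambda>\<rho>. integral (cbox 0 (2 * pi)) (\<lambda>t. g (- \<rho> * cos t)))"
  proof (rule integral_continuous_on_param)
    have s: "- r * cos t \<in> {-R..R}" if "r \<in> {0..R}" for r t
    proof -
      have "- r \<le> - r * cos t \<and> - r * cos t \<le> r"
        using neg_rho_cos[of r t] that unfolding atLeastAtMost_iff by blast
      then show ?thesis using that unfolding atLeastAtMost_iff by linarith
    qed
    show "continuous_on ({0..R} \<times> cbox 0 (2 * pi)) (\<lambda>(r, t). g (- r * cos t))"
      unfolding case_prod_beta
      by (rule continuous_on_compose2[OF assms(2)]) (use s in \<open>auto intro!: continuous_intros\<close>)
  qed
  then show ?thesis by (simp add: cyc_def)
qed

lemma uof_cont_Icc: "-1 < q \<Longrightarrow> continuous_on {- rho0 q..rho0 q} (uof q)"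
  by (rule continuous_on_subset[OF uof_cont]) auto

lemma yof_cont_Icc: "-1 < q \<Longrightarrow> continuous_on {- rho0 q..rho0 q} (yof q)"
  by (rule continuous_on_subset[OF yof_cont]) auto

lemma period_cont: "-1 < q \<Longrightarrow> continuous_on {0..rho0 q} (period q)"
  unfolding period_def[abs_def] by (intro cyc_cont uof_cont_Icc less_imp_le rho0_pos)

lemma mass_cont: "-1 < q \<Longrightarrow> continuous_on {0..rho0 q} (mass q)"
  unfolding mass_def[abs_def]
  by (intro cyc_cont uof_cont_Icc yof_cont_Icc less_imp_le rho0_pos continuous_on_mult)

lemma kinetic_cont:
  assumes q: "-1 < q" shows "continuous_on {0..rho0 q} (kinetic q)"
proof -
  have c: "continuous_on {- r..r} (uof q)" if "r \<in> {0..rho0 q}" for r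
    using that by (intro continuous_on_subset[OF uof_cont_Icc[OF q]]) auto
  have e: "kinetic q r = (r\<^sup>2 * period q r - cyc r (\<lambda>s. s\<^sup>2 * uof q s)) / 2" if r: "r \<in> {0..rho0 q}" for r
  proof -
    have "cyc r (\<lambda>s. r\<^sup>2 * uof q s - s\<^sup>2 * uof q s) = cyc r (\<lambda>s. r\<^sup>2 * uof q s) - cyc r (\<lambda>s. s\<^sup>2 * uof q s)"
      using r by (intro cyc_diff continuous_intros c) auto
    then show ?thesis by (simp add: kinetic_def period_def cyc_cmult left_diff_distrib)
  qed
  have "continuous_on {0..rho0 q} (\<lambda>r. (r\<^sup>2 * period q r - cyc r (\<lambda>s. s\<^sup>2 * uof q s)) / 2)"
    using rho0_pos[OF q]
    by (intro continuous_intros period_cont[OF q] cyc_cont uof_cont_Icc[OF q]) auto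
  then show ?thesis by (rule continuous_on_eq) (simp add: e)
qed

lemma level_cont: "continuous_on S (level q)"
  unfolding level_def[abs_def] by (intro continuous_intros) auto

lemma mass_pos:
  assumes q: "-1 < q" and r: "0 < \<rho>" "\<rho> \<le> rho0 q" shows "0 < mass q \<rho>"
  unfolding mass_def
proof (rule cyc_pos[of \<rho> _ 0])
  show "continuous_on {-\<rho>..\<rho>} (\<lambda>s. yof q s * uof q s)"
    using r by (intro continuous_on_mult continuous_on_subset[OF yof_cont[OF q]]
      continuous_on_subset[OF uof_cont[OF q]]) auto
  show "0 \<le> yof q s * uof q s" if "s \<in> {-\<rho>..\<rho>}" for s
    using yof_nonneg[OF q, of s] uof_nonneg[OF q, of s] that r by auto
  show "yof q 0 * uof q 0 \<noteq> 0" using uof_pos[OF q, of 0] rho0_pos[OF q] yof_0[OF q] by simp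
qed (use r in auto)

lemma tendsto_rho0:
  assumes q: "-1 < q" and c: "continuous_on {0..rho0 q} f"
  shows "(f \<longlongrightarrow> f (rho0 q)) (at_left (rho0 q))"
proof -
  have "(f \<longlongrightarrow> f (rho0 q)) (at (rho0 q) within {0..rho0 q})"
    using c rho0_pos[OF q] by (auto simp: continuous_on_def)
  then show ?thesis by (simp add: at_within_Icc_at_left rho0_pos[OF q])
qed

text \<open>The proof of \<open>area_act\<close> differentiates on the open amplitude interval; the
  droplet amplitude is obtained as a limit of the identity.\<close>

lemma mass_kinetic:
  assumes q: "-1 < q" and r: "0 < \<rho>" "\<rho> \<le> rho0 q"
  shows "mass q \<rho> = (q + 3) * kinetic q \<rho> - (q + 1) * level q \<rho> * period q \<rho>"
proof -
  define d where "d = (\<lambda>\<rho>. (q + 3) * kinetic q \<rho> - (q + 1) * level q \<rho> * period q \<rho> - mass q \<rho>)"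
  have in0: "d r = 0" if "0 < r" "r < rho0 q" for r
  proof -
    interpret film_cycle q r using that q by unfold_locales
    show ?thesis using area_act by (simp add: d_def)
  qed
  have "(d \<longlongrightarrow> d (rho0 q)) (at_left (rho0 q))"
    unfolding d_def
    by (intro tendsto_rho0[OF q] continuous_intros kinetic_cont[OF q] level_cont period_cont[OF q] mass_cont[OF q])
  moreover have "\<forall>\<^sub>F r in at_left (rho0 q). d r = 0"
    using in0 rho0_pos[OF q] by (auto simp: eventually_at_left_field intro!: exI[of _ 0])
  ultimately have "((\<lambda>r. 0) \<longlongrightarrow> d (rho0 q)) (at_left (rho0 q))" by (rule Lim_transform_eventually)
  then have "d (rho0 q) = 0" by (simp add: tendsto_const_iff)
  then have "d \<rho> = 0" using in0[of \<rho>] r by (cases "\<rho> = rho0 q") auto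
  then show ?thesis by (simp add: d_def)
qed

text \<open>The steady states with coefficient \<open>B\<close> and area \<open>c / sqrt B\<close> are \<open>x \<mapsto> s k (x / r)\<close> with \<open>s = size_of q c \<rho>\<close>
  and \<open>B r\<^sup>2 = s powr (1 - q)\<close>. Their length is \<open>length_of q c \<rho> / sqrt B\<close>, and their energy is
  \<open>sqrt B * energy_of q c \<rho>\<close> when \<open>H = B * pot q\<close>.\<close>

definition size_of :: "real \<Rightarrow> real \<Rightarrow> real \<Rightarrow> real" where
  "size_of q c \<rho> = (c / mass q \<rho>) powr (2 / (3 - q))"

definition length_of :: "real \<Rightarrow> real \<Rightarrow> real \<Rightarrow> real" where
  "length_of q c \<rho> = size_of q c \<rho> powr ((1 - q) / 2) * period q \<rho>"

definition energy_of :: "real \<Rightarrow> real \<Rightarrow> real \<Rightarrow> real" where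
  "energy_of q c \<rho> = size_of q c \<rho> powr ((3 + q) / 2) * (2 * kinetic q \<rho> - level q \<rho> * period q \<rho>)
     - c * frc q (size_of q c \<rho>)"

section \<open>Monotonicity of length and energy at fixed area\<close>

locale family =
  fixes q c :: real
  assumes qb: "-1 < q" "q < 3" and c: "0 < c"
    and sign: "\<And>\<rho>. 0 < \<rho> \<Longrightarrow> \<rho> < rho0 q \<Longrightarrow>
      (3 - q) * dperiod q \<rho> / period q \<rho> + (q - 1) * dmass q \<rho> / mass q \<rho> < 0"
begin

abbreviation "s \<equiv> size_of q c"

lemma size_pos: "0 < \<rho> \<Longrightarrow> \<rho> \<le> rho0 q \<Longrightarrow> 0 < s \<rho>"
  using mass_pos[of q \<rho>] qb c by (simp add: size_of_def)

lemma size_mass: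
  assumes "0 < \<rho>" "\<rho> \<le> rho0 q" shows "s \<rho> powr ((3 - q) / 2) * mass q \<rho> = c"
proof -
  have "2 / (3 - q) * ((3 - q) / 2) = 1" using qb by simp
  then have "s \<rho> powr ((3 - q) / 2) = (c / mass q \<rho>) powr 1"
    by (simp only: size_of_def powr_powr)
  then have "s \<rho> powr ((3 - q) / 2) = c / mass q \<rho>"
    using c mass_pos[OF qb(1) assms] by simp
  then show ?thesis using mass_pos[OF qb(1) assms] by simp
qed

lemma size_cont:
  assumes "0 < a" shows "continuous_on {a..rho0 q} s"
proof -
  have "mass q x \<noteq> 0" if "x \<in> {a..rho0 q}" for x using mass_pos[OF qb(1), of x] that assms by auto
  then show ?thesis unfolding size_of_def[abs_def]
    by (intro continuous_intros continuous_on_subset[OF mass_cont[OF qb(1)]]) (use assms c in auto)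
qed

lemma size_ne: "0 < a \<Longrightarrow> x \<in> {a..rho0 q} \<Longrightarrow> s x \<noteq> 0"
  using size_pos[of x] by auto

lemma length_cont:
  assumes "0 < a" shows "continuous_on {a..rho0 q} (length_of q c)"
  unfolding length_of_def[abs_def]
  by (intro continuous_intros size_cont continuous_on_subset[OF period_cont[OF qb(1)]])
    (use assms size_ne[OF assms] in auto)

lemma frc_cont: "continuous_on {0<..} (frc q)"
  by (rule DERIV_continuous_on, rule has_field_derivative_at_within[OF frc_deriv]) auto

lemma energy_cont:
  assumes "0 < a" shows "continuous_on {a..rho0 q} (energy_of q c)"
proof -
  have "continuous_on {a..rho0 q} (\<lambda>\<rho>. frc q (s \<rho>))"
    by (rule continuous_on_compose2[OF frc_cont size_cont[OF assms]]) (use assms size_pos in force)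
  then show ?thesis
    unfolding energy_of_def[abs_def]
    by (intro continuous_intros size_cont level_cont continuous_on_subset[OF period_cont[OF qb(1)]]
      continuous_on_subset[OF kinetic_cont[OF qb(1)]]) (use assms size_ne[OF assms] in auto)
qed

context
  fixes \<rho> :: real assumes rho: "0 < \<rho>" "\<rho> < rho0 q"
begin

interpretation film_cycle q \<rho> using rho qb by unfold_locales

text \<open>\<open>\<rho> * N\<close> is the logarithmic derivative in \<open>\<rho>\<close> of
  \<open>period q \<rho> powr (3 - q) * mass q \<rho> powr (q - 1)\<close>.\<close>

definition "N = (3 - q) * pk / per + (q - 1) * ak / area"
text \<open>The logarithmic derivative of the size, read off from the constancy of
  \<open>s \<rho> powr ((3 - q) / 2) * mass q \<rho>\<close>.\<close>

definition "\<sigma> = - 2 * \<rho> * ak / ((3 - q) * area)"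

lemma size_deriv: "(s has_real_derivative s \<rho> * \<sigma>) (at \<rho>)"
proof -
  have "((\<lambda>\<rho>. c / mass q \<rho>) has_real_derivative - (c / area) * (\<rho> * ak / area)) (at \<rho>)"
    using area_pos by (auto intro!: derivative_eq_intros mass_deriv)
  from DERIV_powr[OF this, of "\<lambda>_. 2 / (3 - q)" 0]
  have "(s has_real_derivative s \<rho> * (- (c / area) * (\<rho> * ak / area) * (2 / (3 - q)) / (c / area))) (at \<rho>)"
    using area_pos c unfolding size_of_def[abs_def] by auto
  moreover have e: "- (c / area) * (\<rho> * ak / area) * (2 / e) / (c / area) = - 2 * \<rho> * ak / (e * area)" for e
    using area_pos c by (simp add: field_simps)
  ultimately show ?thesis by (simp only: \<sigma>_def e)
qed

lemma size_powr_deriv: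
  "((\<lambda>\<rho>. s \<rho> powr a) has_real_derivative a * s \<rho> powr a * \<sigma>) (at \<rho>)"
  using DERIV_powr[OF size_deriv, of "\<lambda>_. a" 0] size_pos[of \<rho>] rho by (auto simp: mult_ac)

text \<open>At fixed area, length to the power \<open>3 - q\<close> is a constant multiple of
  \<open>period q \<rho> powr (3 - q) * mass q \<rho> powr (q - 1)\<close>; this is the
  infinitesimal form of that relation.\<close>

lemma mean_period_rate: "per * (\<rho> * N / (3 - q)) = \<rho> * pk + (1 - q) / 2 * \<sigma> * per"
proof -
  have "per * (\<rho> * (e * pk / per + (q - 1) * ak / area) / e)
      = \<rho> * pk + (1 - q) / 2 * (- 2 * \<rho> * ak / (e * area)) * per" if "e \<noteq> 0" for e
    using per_pos area_pos that by (simp add: field_simps)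
  then show ?thesis using qb by (simp add: N_def \<sigma>_def)
qed

lemma length_deriv:
  "(length_of q c has_real_derivative length_of q c \<rho> * (\<rho> * N / (3 - q))) (at \<rho>)"
proof -
  have "length_of q c \<rho> * (\<rho> * N / (3 - q)) = s \<rho> powr ((1 - q) / 2) * (\<rho> * pk)
      + (1 - q) / 2 * s \<rho> powr ((1 - q) / 2) * \<sigma> * per"
  proof -
    define Z where "Z = s \<rho> powr ((1 - q) / 2)"
    have "Z * (per * (\<rho> * N / (3 - q))) = Z * (\<rho> * pk + (1 - q) / 2 * \<sigma> * per)"
      unfolding mean_period_rate ..
    then show ?thesis unfolding length_of_def Z_def[symmetric] by (simp add: algebra_simps)
  qed
  then show ?thesis
    using DERIV_mult'[OF size_powr_deriv[of "(1 - q) / 2"] period_deriv]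
    by (simp add: length_of_def[abs_def])
qed

text \<open>The value is \<open>- s \<rho> powr (q + 1) * kap\<close> times the derivative of the
  length, so with \<open>kap < 0\<close> both move in the same direction. In \<open>en\<close> the
  kinetic term is traded by \<open>mass_kinetic\<close> for mass, level and period, whose
  derivatives are at hand.\<close>

lemma energy_deriv:
  "(energy_of q c has_real_derivative
     - (s \<rho> powr ((3 + q) / 2) * kap * \<rho> * per * N / (3 - q))) (at \<rho>)"
proof -
  define Z where "Z = s \<rho> powr ((3 + q) / 2)"
  define en where "en = (\<lambda>\<rho>. s \<rho> powr ((3 + q) / 2) * ((2 * mass q \<rho> + (q - 1) * (level q \<rho> * period q \<rho>)) / (q + 3))
     - c * frc q (s \<rho>))"
  have sp: "0 < s \<rho>" using size_pos rho by simp
  have dl: "(level q has_real_derivative \<rho>) (at \<rho>)"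
    unfolding level_def[abs_def] by (auto intro!: derivative_eq_intros)
  \<comment> \<open>The area constraint \<open>size_mass\<close> gives the multiplier term the same
    power of the size as the other terms.\<close>
  have cZ: "c * (s \<rho> powr (q - 1) * (s \<rho> * \<sigma>)) = Z * area * \<sigma>"
  proof -
    have "s \<rho> powr ((3 - q) / 2) * (s \<rho> powr (q - 1) * s \<rho>) = Z"
    proof -
      have "s \<rho> powr (q - 1) * s \<rho> = s \<rho> powr q" using sp by (simp add: powr_diff)
      moreover have "(3 - q) / 2 + q = (3 + q) / 2" by (simp add: field_simps)
      ultimately show ?thesis by (simp only: Z_def powr_add[symmetric])
    qed
    moreover have "c * (s \<rho> powr (q - 1) * (s \<rho> * \<sigma>))
        = area * \<sigma> * (s \<rho> powr ((3 - q) / 2) * (s \<rho> powr (q - 1) * s \<rho>))"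
      using size_mass[of \<rho>] rho by (simp add: mult_ac)
    ultimately show ?thesis by (simp add: mult_ac)
  qed
  have "((\<lambda>\<rho>. (2 * mass q \<rho> + (q - 1) * (level q \<rho> * period q \<rho>)) / (q + 3)) has_real_derivative
      (2 * (\<rho> * ak) + (q - 1) * (\<rho> * per + kap * (\<rho> * pk))) / (q + 3)) (at \<rho>)"
    using qb by (auto intro!: derivative_eq_intros mass_deriv period_deriv dl simp: mult.commute)
  from DERIV_diff[OF DERIV_mult'[OF size_powr_deriv[of "(3 + q) / 2"] this]
      DERIV_cmult[OF DERIV_chain2[OF frc_deriv[OF sp, of q] size_deriv], of c]]
  have "(en has_real_derivative
      Z * ((2 * (\<rho> * ak) + (q - 1) * (\<rho> * per + kap * (\<rho> * pk))) / (q + 3))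
      + (3 + q) / 2 * Z * \<sigma> * ((2 * area + (q - 1) * (kap * per)) / (q + 3)) - Z * area * \<sigma>) (at \<rho>)"
    unfolding cZ en_def Z_def .
  moreover have "Z * ((2 * (\<rho> * ak) + (q - 1) * (\<rho> * per + kap * (\<rho> * pk))) / (q + 3))
      + (3 + q) / 2 * Z * \<sigma> * ((2 * area + (q - 1) * (kap * per)) / (q + 3)) - Z * area * \<sigma>
      = - (Z * kap * \<rho> * per * N / (3 - q))"
  proof -
    have q3: "q + 3 \<noteq> 0" "3 - q \<noteq> 0" using qb by auto
    \<comment> \<open>Inserting the definition of \<open>dmass\<close> makes the terms with
      \<open>per\<close> cancel: this is where the area derivative enters the energy
      balance.\<close>
    have 1: "2 * (\<rho> * ak) + (q - 1) * (\<rho> * per + kap * (\<rho> * pk)) = - ((q + 3) * (kap * \<rho> * pk))"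
      by (simp add: dmass_def field_simps)
    have 2: "(3 + q) / 2 * Z * \<sigma> * ((2 * area + (q - 1) * (kap * per)) / (q + 3))
        = Z * \<sigma> * area + Z * \<sigma> * ((q - 1) / 2 * (kap * per))"
    proof -
      have h: "(3 + q) / 2 * Z * \<sigma> * (x / (q + 3)) = Z * \<sigma> * (x / 2)" for x
        using q3 by (simp add: field_simps)
      show ?thesis unfolding h by (simp add: field_simps)
    qed
    have 3: "- ((q + 3) * (kap * \<rho> * pk)) / (q + 3) = - (kap * \<rho> * pk)" using q3 by simp
    have "\<sigma> * ((q - 1) / 2 * (kap * per)) - kap * \<rho> * pk = - kap * (\<rho> * pk + (1 - q) / 2 * \<sigma> * per)"
      by (simp add: field_simps)
    also have "\<dots> = - (kap * \<rho> * per * N / (3 - q))"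
      unfolding mean_period_rate[symmetric] by (simp add: mult_ac)
    finally have "\<sigma> * ((q - 1) / 2 * (kap * per)) - kap * \<rho> * pk = - (kap * \<rho> * per * N / (3 - q))" .
    then have "Z * (\<sigma> * ((q - 1) / 2 * (kap * per)) - kap * \<rho> * pk) = Z * - (kap * \<rho> * per * N / (3 - q))"
      by simp
    then show ?thesis unfolding 1 2 3 by (simp add: algebra_simps)
  qed
  ultimately have en: "(en has_real_derivative - (Z * kap * \<rho> * per * N / (3 - q))) (at \<rho>)" by simp
  have ev: "\<forall>\<^sub>F r in nhds \<rho>. energy_of q c r = en r"
  proof (rule eventually_mono[OF eventually_nhds_in_open[of "{0<..<rho0 q}"]])
    fix r assume r: "r \<in> {0<..<rho0 q}"
    have "2 * mass q r + (q - 1) * (level q r * period q r)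
        = (q + 3) * (2 * kinetic q r - level q r * period q r)"
      using mass_kinetic[OF qb(1), of r] r by (simp add: algebra_simps)
    then show "energy_of q c r = en r" using qb by (simp add: energy_of_def en_def)
  qed (use rho in auto)
  show ?thesis using en unfolding Z_def by (subst DERIV_cong_ev[OF refl ev refl])
qed

lemma length_deriv_neg: "length_of q c \<rho> * (\<rho> * N / (3 - q)) < 0"
proof -
  have N: "N < 0" using sign[OF rho] by (simp add: N_def)
  have "0 < length_of q c \<rho>" using size_pos[of \<rho>] rho per_pos by (simp add: length_of_def)
  moreover have "\<rho> * N / (3 - q) < 0" using N rho qb by (intro divide_neg_pos mult_pos_neg) auto
  ultimately show ?thesis by (rule mult_pos_neg)
qed

lemma energy_deriv_neg: "- (s \<rho> powr ((3 + q) / 2) * kap * \<rho> * per * N / (3 - q)) < 0"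
proof -
  have N: "N < 0" using sign[OF rho] by (simp add: N_def)
  have "s \<rho> powr ((3 + q) / 2) * kap < 0" using size_pos[of \<rho>] rho kap_neg by (intro mult_pos_neg) auto
  then have "s \<rho> powr ((3 + q) / 2) * kap * \<rho> * per < 0"
    by (rule mult_neg_pos[OF mult_neg_pos[OF _ rho(1)] per_pos])
  then have "0 < s \<rho> powr ((3 + q) / 2) * kap * \<rho> * per * N" using N by (rule mult_neg_neg)
  then show ?thesis using qb by simp
qed

end

lemma length_less:
  assumes rho: "0 < \<rho>" "\<rho> < rho0 q" shows "length_of q c (rho0 q) < length_of q c \<rho>"
proof (rule DERIV_neg_imp_decreasing_open[OF rho(2)])
  show "\<exists>y. (length_of q c has_real_derivative y) (at x) \<and> y < 0" if "\<rho> < x" "x < rho0 q" for x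
    using length_deriv[of x] length_deriv_neg[of x] that rho by auto
qed (rule length_cont[OF rho(1)])

lemma energy_less:
  assumes rho: "0 < \<rho>" "\<rho> < rho0 q" shows "energy_of q c (rho0 q) < energy_of q c \<rho>"
proof (rule DERIV_neg_imp_decreasing_open[OF rho(2)])
  show "\<exists>y. (energy_of q c has_real_derivative y) (at x) \<and> y < 0" if "\<rho> < x" "x < rho0 q" for x
    using energy_deriv[of x] energy_deriv_neg[of x] that rho by auto
qed (rule energy_cont[OF rho(1)])

end

section \<open>Steady states and droplets\<close>

text \<open>Two integrations leave an affine ambiguity, and continuity carries the formula to
  \<open>y = 0\<close>. The slope \<open>c1\<close> multiplies the area and the constant
  \<open>c2\<close> the circumference, both shared by the two states compared, so neither affects
  the comparison.\<close>

lemma energy_potential_explicit: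
  assumes H: "energy_potential B q H" and q: "-1 < q"
  obtains c1 c2 where "\<And>y. 0 \<le> y \<Longrightarrow> H y = B * pot q y + c1 * y + c2"
proof -
  obtain H' where Hc: "continuous_on {0..} H"
    and H1: "\<And>y. 0 < y \<Longrightarrow> (H has_real_derivative H' y) (at y)"
    and H2: "\<And>y. 0 < y \<Longrightarrow> (H' has_real_derivative B * y powr (q - 1)) (at y)"
    using H by (auto simp: energy_potential_def)
  define c1 where "c1 = H' 1"
  define d where "d = (\<lambda>y. H y - B * pot q y - c1 * y)"
  have const: "f y = f 1" if "0 < y" "\<And>x. 0 < x \<Longrightarrow> (f has_real_derivative 0) (at x)" for f :: "real \<Rightarrow> real" and y
  proof -
    have "\<exists>c. \<forall>x\<in>{0<..}. f x = c"
    proof (rule has_field_derivative_zero_constant)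
      show "(f has_field_derivative 0) (at x within {0<..})" if "x \<in> {0<..}" for x
        by (rule has_field_derivative_at_within, rule \<open>\<And>x. 0 < x \<Longrightarrow> (f has_real_derivative 0) (at x)\<close>)
          (use that in simp)
    qed simp
    then show ?thesis using that(1) by auto
  qed
  have c1: "H' y = B * frc q y + c1" if "0 < y" for y
  proof -
    have "H' y - B * frc q y = H' 1 - B * frc q 1"
      by (rule const[OF that, of "\<lambda>y. H' y - B * frc q y"])
        (auto intro!: derivative_eq_intros H2 frc_deriv)
    then show ?thesis by (simp add: c1_def)
  qed
  have d1: "d y = d 1" if "0 < y" for y
    by (rule const[OF that]) (auto intro!: derivative_eq_intros H1 pot_deriv q simp: d_def c1)
  have dc: "continuous_on {0..} d"
    unfolding d_def by (intro continuous_intros Hc pot_cont[OF q])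
  have "d 0 = d 1"
  proof -
    have "(d \<longlongrightarrow> d 0) (at 0 within {0..})" using dc by (auto simp: continuous_on_def)
    then have "(d \<longlongrightarrow> d 0) (at_right 0)" by (simp add: at_within_Ici_at_right)
    moreover have "\<forall>\<^sub>F y in at_right 0. d y = d 1"
      using eventually_at_right_less[of "0::real"] by eventually_elim (rule d1)
    ultimately have "((\<lambda>_::real. d 1) \<longlongrightarrow> d 0) (at_right 0)"
      by (rule Lim_transform_eventually)
    then show ?thesis by (simp add: tendsto_const_iff)
  qed
  then have d: "d y = d 1" if "0 \<le> y" for y using d1[of y] that by (cases "y = 0") (simp, linarith)
  have "H y = B * pot q y + c1 * y + d 1" if "0 \<le> y" for y using d[OF that] unfolding d_def by linarith
  then show ?thesis by (rule that)
qed

lemma integral_periodic_shift: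
  fixes f :: "real \<Rightarrow> real"
  assumes c: "continuous_on UNIV f" and p: "periodic_with f T" and x: "x \<in> {0..T}"
  shows "integral {x..x + T} f = integral {0..T} f"
proof -
  have i: "f integrable_on {a..b}" for a b
    by (intro integrable_continuous_interval continuous_on_subset[OF c]) simp
  have "integral {T..x + T} f = integral {0 + T..x + T} f" by simp
  also have "\<dots> = integral {0..x} (f \<circ> (\<lambda>x. x + T))"
    by (rule integral_shift[symmetric]) (rule continuous_on_subset[OF c subset_UNIV])
  also have "\<dots> = integral {0..x} f" using p by (simp add: periodic_with_def o_def)
  finally have "integral {T..x + T} f = integral {0..x} f" .
  moreover have "integral {x..T} f + integral {T..x + T} f = integral {x..x + T} f"
    using x by (intro Henstock_Kurzweil_Integration.integral_combine i) auto
  moreover have "integral {0..x} f + integral {x..T} f = integral {0..T} f"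
    using x by (intro Henstock_Kurzweil_Integration.integral_combine i) auto
  ultimately show ?thesis by simp
qed

lemma integral_affine:
  fixes f :: "real \<Rightarrow> real"
  assumes c: "continuous_on UNIV f" and r: "0 < r" and P: "0 \<le> P"
  shows "integral {x0..x0 + r * P} (\<lambda>x. f ((x - x0) / r)) = r * integral {0..P} f"
proof -
  have h: "((\<lambda>u. r *\<^sub>R f ((r * u + x0 - x0) / r)) has_integral
      integral {r * 0 + x0..r * P + x0} (\<lambda>x. f ((x - x0) / r))) {0..P}"
  proof (rule has_integral_substitution)
    show "(\<lambda>u. r * u + x0) ` {0..P} \<subseteq> {x0..r * P + x0}" using r by (auto simp: mult_left_mono)
    show "continuous_on {x0..r * P + x0} (\<lambda>x. f ((x - x0) / r))"
      by (rule continuous_on_compose2[OF c]) (use r in \<open>auto intro!: continuous_intros\<close>)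
  qed (use r P in \<open>auto intro!: derivative_eq_intros\<close>)
  show ?thesis using integral_unique[OF h] r by (simp add: add.commute)
qed

section \<open>Dilated orbits and their energy\<close>

context orbit begin

definition "scaled s r x = s * K (x / r)"
definition "scaled' s r x = s / r * L (x / r)"

lemma scaled_cont: "continuous_on S (scaled s r)"
  unfolding scaled_def divide_inverse
  by (rule continuous_on_subset[OF _ subset_UNIV],
      rule continuous_on_mult, rule continuous_on_const, rule continuous_on_compose2[OF K_cont])
    (auto intro!: continuous_intros)

lemma scaled'_cont: "continuous_on S (scaled' s r)"
  unfolding scaled'_def divide_inverse
  by (rule continuous_on_subset[OF _ subset_UNIV],
      rule continuous_on_mult, rule continuous_on_const, rule continuous_on_compose2[OF L_cont])
    (auto intro!: continuous_intros)

lemma scaled_deriv: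
  assumes "0 < r" "0 < K (x / r)"
  shows "(scaled s r has_real_derivative scaled' s r x) (at x)"
proof -
  have "((\<lambda>x. K (x / r)) has_real_derivative L (x / r) * (1 / r)) (at x)"
    by (rule DERIV_chain2[where f = K and g = "\<lambda>x. x / r", OF K_deriv[OF assms(2)]]) (use assms in \<open>auto intro!: derivative_eq_intros\<close>)
  from DERIV_cmult[OF this, of s] show ?thesis by (simp add: scaled_def[abs_def] scaled'_def)
qed

text \<open>By \<open>frc_scale\<close> the dilation creates the multiplier
  \<open>B * frc q s\<close>; the relation between \<open>r\<close> and \<open>s\<close> is what
  makes the coefficient of the force equal to \<open>B\<close>.\<close>

lemma scaled'_deriv:
  assumes r: "0 < r" "r\<^sup>2 * B = s powr (1 - q)" and s: "0 < s" and B: "0 < B" and K: "0 < K (x / r)"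
  shows "(scaled' s r has_real_derivative B * frc q s - B * frc q (scaled s r x)) (at x)"
proof -
  have "((\<lambda>x. L (x / r)) has_real_derivative - frc q (K (x / r)) * (1 / r)) (at x)"
    by (rule DERIV_chain2[where f = L and g = "\<lambda>x. x / r", OF L_deriv[OF K]]) (use r in \<open>auto intro!: derivative_eq_intros\<close>)
  from DERIV_cmult[OF this, of "s / r"]
  have 1: "(scaled' s r has_real_derivative s / r * (- frc q (K (x / r)) * (1 / r))) (at x)"
    by (simp add: scaled'_def[abs_def])
  have "s powr (1 - q) * s powr q = s" using s by (simp add: powr_add[symmetric])
  then have "s / r\<^sup>2 = B * s powr q" using r(1) by (simp add: r(2)[symmetric] field_simps)
  moreover have "s / r * (- frc q (K (x / r)) * (1 / r)) = - (s / r\<^sup>2) * frc q (K (x / r))"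
    by (simp add: power2_eq_square)
  ultimately have "s / r * (- frc q (K (x / r)) * (1 / r)) = B * frc q s - B * frc q (scaled s r x)"
    using frc_scale[OF s K, of q] by (simp add: scaled_def algebra_simps)
  then show ?thesis using 1 by simp
qed

lemma scaled_mass:
  assumes "0 < r" shows "integral {0..r * P} (scaled s r) = r * s * mass q \<rho>"
  using integral_affine[OF continuous_on_mult[OF continuous_on_const K_cont, of _ s] assms, of P 0] P_pos integral_K
  by (simp add: scaled_def[abs_def])

lemma scaled_energy:
  assumes r: "0 < r" "r\<^sup>2 * B = s powr (1 - q)" and s: "0 < s" and B: "0 < B"
    and H: "\<And>y. 0 \<le> y \<Longrightarrow> H y = B * pot q y + c1 * y + c2"
  defines "m \<equiv> r * s * mass q \<rho>"
  shows "integral {0..r * P} (\<lambda>x. 1 / 2 * (scaled' s r x)\<^sup>2 - H (scaled s r x))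
    = sqrt B * (s powr ((3 + q) / 2) * (2 * kinetic q \<rho> - level q \<rho> * period q \<rho>) - sqrt B * m * frc q s)
      - c1 * m - c2 * (r * P)"
proof -
  \<comment> \<open>The relation for \<open>r\<close> gives \<open>a = B * s powr (q + 1)\<close>,
    so kinetic and potential terms scale alike and conservation of energy can eliminate the
    potential. The constant \<open>b\<close> below collects what is linear in \<open>K\<close>: the
    multiplier term of \<open>pot_scale\<close> and the slope of \<open>H\<close>.\<close>
  define a where "a = (s / r)\<^sup>2"
  define b where "b = B * s * frc q s + c1 * s"
  have aB: "a = B * s powr (q + 1)"
  proof -
    have "s powr (1 - q) * s powr (q + 1) = s powr 2" by (simp add: powr_add[symmetric])
    also have "\<dots> = s\<^sup>2" using s by (simp add: powr_numeral)
    finally have "s\<^sup>2 = r\<^sup>2 * B * s powr (q + 1)" using r(2) by simp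
    then show ?thesis using r(1) by (simp add: a_def power_divide)
  qed
  have ra: "r * a = sqrt B * s powr ((3 + q) / 2)"
  proof -
    have "r = s powr ((1 - q) / 2) / sqrt B"
    proof (rule power2_eq_imp_eq)
      have "(s powr ((1 - q) / 2))\<^sup>2 = s powr ((1 - q) / 2 + (1 - q) / 2)"
        unfolding power2_eq_square by (rule powr_add[symmetric])
      then have "(s powr ((1 - q) / 2))\<^sup>2 = s powr (1 - q)" by (simp only: field_sum_of_halves)
      then show "r\<^sup>2 = (s powr ((1 - q) / 2) / sqrt B)\<^sup>2" using B r(2) by (simp add: power_divide field_simps)
    qed (use r s B in auto)
    moreover have "s powr ((1 - q) / 2) * s powr (q + 1) = s powr ((3 + q) / 2)"
    proof -
      have "(1 - q) / 2 + (q + 1) = (3 + q) / 2" by (simp add: field_simps)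
      then show ?thesis by (simp only: powr_add[symmetric])
    qed
    moreover have "B / sqrt B = sqrt B" using B by (simp add: real_div_sqrt)
    ultimately show ?thesis unfolding aB by (metis (no_types, lifting) mult.assoc mult.commute times_divide_eq_left)
  qed
  define f where "f = (\<lambda>x. 2 * a * ((L x)\<^sup>2 / 2) - a * level q \<rho> - b * K x - c2)"
  have e: "1 / 2 * (scaled' s r x)\<^sup>2 - H (scaled s r x) = f ((x - 0) / r)" for x
  proof -
    define y where "y = x / r"
    have "H (s * K y) = a * pot q (K y) + b * K y + c2"
      using H[of "s * K y"] K_nonneg[of y] s pot_scale[OF s K_nonneg[of y], of q]
      by (simp add: aB b_def algebra_simps)
    moreover have "pot q (K y) = level q \<rho> - (L y)\<^sup>2 / 2" using KL_level[of y] by simp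
    moreover have "(s / r * L y)\<^sup>2 = a * (L y)\<^sup>2" by (simp add: a_def power_mult_distrib power_divide)
    ultimately show ?thesis
      by (simp add: scaled_def scaled'_def f_def y_def[symmetric] algebra_simps)
  qed
  have fc: "continuous_on UNIV f" unfolding f_def by (intro continuous_intros L_cont K_cont) auto
  have LI: "((\<lambda>x. (L x)\<^sup>2 / 2) has_integral kinetic q \<rho>) {0..P}"
    unfolding integral_L2[symmetric]
    by (intro integrable_integral integrable_continuous_interval continuous_intros L_cont) auto
  have KI: "(K has_integral mass q \<rho>) {0..P}"
    unfolding integral_K[symmetric]
    by (intro integrable_integral integrable_continuous_interval K_cont)
  have cI: "((\<lambda>x. d) has_integral d * P) {0..P}" for d :: real
    using has_integral_const_real[of d 0 P] P_pos by (simp add: mult.commute)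
  have "(f has_integral 2 * a * kinetic q \<rho> - a * level q \<rho> * P - b * mass q \<rho> - c2 * P) {0..P}"
    unfolding f_def
    by (intro has_integral_diff has_integral_mult_right LI KI cI)
  then have fI: "integral {0..P} f = 2 * a * kinetic q \<rho> - a * level q \<rho> * P - b * mass q \<rho> - c2 * P"
    by (rule integral_unique)
  have "integral {0..r * P} (\<lambda>x. 1 / 2 * (scaled' s r x)\<^sup>2 - H (scaled s r x))
      = integral {0..0 + r * P} (\<lambda>x. f ((x - 0) / r))" unfolding e by simp
  also have "\<dots> = r * integral {0..P} f" by (rule integral_affine[OF fc r(1)]) (use P_pos in simp)
  also have "\<dots> = (r * a) * (2 * kinetic q \<rho> - level q \<rho> * P) - r * b * mass q \<rho> - c2 * (r * P)"
    unfolding fI by (simp add: algebra_simps)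
  also have "\<dots> = sqrt B * (s powr ((3 + q) / 2) * (2 * kinetic q \<rho> - level q \<rho> * P) - sqrt B * m * frc q s)
      - c1 * m - c2 * (r * P)"
  proof -
    have "r * b * mass q \<rho> = sqrt B * (sqrt B * m * frc q s) + c1 * m"
      using B by (simp add: b_def m_def algebra_simps)
    then show ?thesis unfolding ra by (simp add: algebra_simps)
  qed
  finally show ?thesis by (simp add: P_def)
qed

end

section \<open>The droplet as a truncated orbit\<close>

context orbit begin

definition "droplet s r x = (if x \<in> {0<..<r * P} then scaled s r x else 0)"

context
  fixes s r B :: real
  assumes full: "\<rho> = rho0 q" and s: "0 < s" and r: "0 < r" "r\<^sup>2 * B = s powr (1 - q)" and B: "0 < B"
begin

lemma K_end: "K 0 = 0" "K P = 0"
proof -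
  have "yof q (- \<rho>) = 0" using yof_left[OF q] by (simp add: full)
  then show "K 0 = 0" by (simp add: K_0)
  then show "K P = 0" using K_periodic[of 0] by simp
qed

lemma K_inside: "x \<in> {0<..<r * P} \<Longrightarrow> 0 < K (x / r)"
  using r by (intro K_pos_inside) (auto simp: field_simps)

lemma droplet_eq: "x \<in> {0..r * P} \<Longrightarrow> droplet s r x = scaled s r x"
  using r K_end by (cases "x = 0 \<or> x = r * P") (auto simp: droplet_def scaled_def)

lemma scaled_interior_sol: "ode_sol q B (B * frc q s) (droplet s r) (scaled' s r) {0<..<r * P}"
proof
  fix x assume x: "x \<in> {0<..<r * P}"
  have ev: "\<forall>\<^sub>F y in nhds x. droplet s r y = scaled s r y"
    by (rule eventually_mono[OF eventually_nhds_in_open[of "{0<..<r * P}"]]) (use x in \<open>auto simp: droplet_def\<close>)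
  show "0 < droplet s r x" using x K_inside[OF x] s by (simp add: droplet_def scaled_def)
  show "(droplet s r has_real_derivative scaled' s r x) (at x)"
    using scaled_deriv[OF r(1) K_inside[OF x], of s] by (subst DERIV_cong_ev[OF refl ev refl])
  show "(scaled' s r has_real_derivative B * frc q s - B * frc q (droplet s r x)) (at x)"
    using scaled'_deriv[OF r s B K_inside[OF x]] x by (simp add: droplet_def)
qed auto

text \<open>At the contact points \<^term>\<open>yof q\<close> is not known to be differentiable; there the one-sided derivative
  comes from the fundamental theorem of calculus.\<close>

lemma droplet_deriv_within:
  assumes t: "t \<in> {0..r * P}"
  shows "(droplet s r has_real_derivative scaled' s r t) (at t within {0..r * P})"
proof -
  have e: "droplet s r x = integral {0..x} (scaled' s r)" if x: "x \<in> {0..r * P}" for x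
  proof -
    have "(scaled' s r has_integral scaled s r x - scaled s r 0) {0..x}"
    proof (rule fundamental_theorem_of_calculus_interior)
      fix y assume "y \<in> {0<..<x}"
      then have "0 < K (y / r)" using x by (intro K_inside) auto
      then show "(scaled s r has_vector_derivative scaled' s r y) (at y)"
        using scaled_deriv[OF r(1)] by (simp add: has_real_derivative_iff_has_vector_derivative)
    qed (use x scaled_cont in auto)
    then show ?thesis using droplet_eq[OF x] by (simp add: scaled_def K_end integral_unique)
  qed
  have "((\<lambda>x. integral {0..x} (scaled' s r)) has_real_derivative scaled' s r t) (at t within {0..r * P})"
    by (rule integral_has_real_derivative[OF scaled'_cont t])
  then show ?thesis
    by (rule has_field_derivative_transform_within[of _ _ _ _ 1]) (use e t in auto)
qed

lemma scaled'_end: "scaled' s r 0 = 0" "scaled' s r (r * P) = 0"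
  using r by (simp_all add: scaled'_def)

lemma droplet_steady:
  assumes "q = m - n + 1" shows "droplet_steady_state n m B (droplet s r) 0 (r * P)"
proof -
  interpret o: ode_sol q B "B * frc q s" "droplet s r" "scaled' s r" "{0<..<r * P}"
    by (rule scaled_interior_sol)
  have "\<exists>h'. (\<forall>x\<in>{0..r * P}. (droplet s r has_real_derivative h' x) (at x within {0..r * P})) \<and>
      continuous_on {0..r * P} h' \<and> 0 \<le> h' 0 \<and> h' 0 = - h' (r * P)"
    using droplet_deriv_within scaled'_cont scaled'_end by (intro exI[of _ "scaled' s r"]) auto
  then show ?thesis
    unfolding droplet_steady_state_def
    using r P_pos o.pos o.Ck o.steady[OF assms] by (auto simp: droplet_def)
qed

lemma droplet_contact: "zero_contact_angle (droplet s r) 0 (r * P)"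
  unfolding zero_contact_angle_def
  using droplet_deriv_within[of 0] droplet_deriv_within[of "r * P"] scaled'_end r P_pos by simp

lemma droplet_integral: "integral {0..r * P} (droplet s r) = r * s * mass q \<rho>"
proof -
  have "integral {0..r * P} (droplet s r) = integral {0..r * P} (scaled s r)"
    by (rule integral_cong) (rule droplet_eq)
  then show ?thesis using scaled_mass[OF r(1)] by simp
qed

text \<open>\<open>energy\<close> uses the two-sided derivative, about which nothing is claimed at
  \<open>0\<close>, at the contact point \<open>r * P\<close> and at \<open>X\<close>; these
  finitely many points do not change the integral. On the dry part the density is the constant
  \<open>- H 0\<close>.\<close>

lemma droplet_energy:
  assumes X: "r * P < X" and H: "continuous_on {0..} H"
  shows "energy H X (on_circle X 0 (droplet s r))
    = integral {0..r * P} (\<lambda>x. 1 / 2 * (scaled' s r x)\<^sup>2 - H (scaled s r x)) - H 0 * (X - r * P)"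
proof -
  define b where "b = r * P"
  define l where "l = on_circle X 0 (droplet s r)"
  define e where "e = (\<lambda>x. 1 / 2 * (deriv l x)\<^sup>2 - H (l x))"
  have b: "0 < b" "b < X" using r P_pos X by (auto simp: b_def)
  have l: "l x = droplet s r x" if "x \<in> {0<..<X}" for x
  proof -
    have "\<lfloor>x / X\<rfloor> = 0" using that by (simp add: floor_eq_iff)
    then show ?thesis by (simp add: l_def on_circle_def)
  qed
  have l': "deriv l x = deriv (droplet s r) x" if "x \<in> {0<..<X}" for x
    using that l by (intro deriv_cong_ev eventually_mono[OF eventually_nhds_in_open[of "{0<..<X}"]]) auto
  have 1: "(e has_integral integral {0..b} (\<lambda>x. 1 / 2 * (scaled' s r x)\<^sup>2 - H (scaled s r x))) {0..b}"
  proof (rule has_integral_spike_finite[of "{0, b}"])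
    fix x assume x: "x \<in> {0..b} - {0, b}"
    have d: "deriv (droplet s r) x = scaled' s r x"
      using ode_sol.deriv_1[OF scaled_interior_sol, of x] x by (auto simp: b_def)
    show "e x = 1 / 2 * (scaled' s r x)\<^sup>2 - H (scaled s r x)"
      using x b l[of x] l'[of x] d by (auto simp: e_def droplet_def b_def)
  next
    have "scaled s r ` {0..b} \<subseteq> {0..}" using s K_nonneg by (auto simp: scaled_def)
    then have "continuous_on {0..b} (\<lambda>x. 1 / 2 * (scaled' s r x)\<^sup>2 - H (scaled s r x))"
      by (intro continuous_intros scaled'_cont continuous_on_compose2[OF H scaled_cont])
    then show "((\<lambda>x. 1 / 2 * (scaled' s r x)\<^sup>2 - H (scaled s r x)) has_integral
        integral {0..b} (\<lambda>x. 1 / 2 * (scaled' s r x)\<^sup>2 - H (scaled s r x))) {0..b}"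
      by (intro integrable_integral integrable_continuous_interval)
  qed simp
  have 2: "(e has_integral - H 0 * (X - b)) {b..X}"
  proof (rule has_integral_spike_finite[of "{b, X}"])
    fix x assume x: "x \<in> {b..X} - {b, X}"
    have "deriv (droplet s r) x = deriv (\<lambda>_. 0) x"
      using x by (intro deriv_cong_ev eventually_mono[OF eventually_nhds_in_open[of "{b<..}"]])
        (auto simp: droplet_def b_def)
    then show "e x = - H 0" using x b l[of x] l'[of x] by (auto simp: e_def droplet_def b_def)
  next
    show "((\<lambda>x. - H 0) has_integral - H 0 * (X - b)) {b..X}"
      using has_integral_const_real[of "- H 0" b X] b by (simp add: mult.commute)
  qed simp
  have "(e has_integral integral {0..b} (\<lambda>x. 1 / 2 * (scaled' s r x)\<^sup>2 - H (scaled s r x)) + - H 0 * (X - b)) {0..X}"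
    by (rule has_integral_combine[OF _ _ 1 2]) (use b in auto)
  then have "integral {0..X} e = integral {0..b} (\<lambda>x. 1 / 2 * (scaled' s r x)\<^sup>2 - H (scaled s r x)) + - H 0 * (X - b)"
    by (rule integral_unique)
  then show ?thesis by (simp add: energy_def l_def[symmetric] e_def b_def)
qed

end

end

section \<open>Reduction of periodic steady states to dilated orbits\<close>

lemma periodic_steady_state_ode:
  assumes st: "positive_periodic_steady_state n m B h" and q: "q = m - n + 1"
  obtains c where "ode_sol q B c h (deriv h) UNIV"
proof -
  have C: "(deriv ^^ j) h field_differentiable (at x)" if "j < 4" for j x
    using st that by (auto simp: positive_periodic_steady_state_def Ck_on_def)
  have pos: "0 < h x" for x using st by (auto simp: positive_periodic_steady_state_def)
  obtain T where T: "0 < T" "periodic_with h T" using st by (auto simp: positive_periodic_steady_state_def)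
  have d1: "(h has_real_derivative deriv h x) (at x)" for x
    using C[of 0 x] by (simp add: DERIV_deriv_iff_field_differentiable)
  have d2: "(deriv h has_real_derivative (deriv ^^ 2) h x) (at x)" for x
    using C[of 1 x] DERIV_deriv_iff_field_differentiable[of "deriv h" x] by (simp add: numeral_2_eq_2)
  have d3: "((deriv ^^ 2) h has_real_derivative (deriv ^^ 3) h x) (at x)" for x
    using C[of 2 x] DERIV_deriv_iff_field_differentiable[of "(deriv ^^ 2) h" x]
    by (simp add: numeral_2_eq_2 numeral_3_eq_3)
  have "(steady_flux n m B h has_real_derivative 0) (at x)" for x
    using st by (auto simp: positive_periodic_steady_state_def steady_eq_on_def)
  then have fl: "steady_flux n m B h x = steady_flux n m B h 0" for x
    by (rule DERIV_isconst_all[rule_format])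
  define C0 where "C0 = steady_flux n m B h 0"
  \<comment> \<open>The flux divided by \<open>h powr n\<close> is the derivative of
    \<open>w\<close>, by \<open>q = m - n + 1\<close>.\<close>
  define w where "w = (\<lambda>x. (deriv ^^ 2) h x + B * frc q (h x))"
  have dw: "(w has_real_derivative C0 * h x powr (- n)) (at x)" for x
  proof -
    have "((\<lambda>x. frc q (h x)) has_real_derivative h x powr (q - 1) * deriv h x) (at x)"
      by (rule DERIV_chain2[OF frc_deriv[OF pos] d1])
    then have "(w has_real_derivative (deriv ^^ 3) h x + B * (h x powr (q - 1) * deriv h x)) (at x)"
      unfolding w_def by (auto intro!: derivative_eq_intros d3)
    moreover have "(deriv ^^ 3) h x + B * (h x powr (q - 1) * deriv h x) = C0 * h x powr (- n)"
    proof -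
      have p: "h x powr n * h x powr (- n) = 1" "h x powr m * h x powr (- n) = h x powr (q - 1)"
        using pos[of x] q by (simp_all add: powr_add[symmetric])
      have "C0 * h x powr (- n) = steady_flux n m B h x * h x powr (- n)" by (simp only: C0_def fl[of x])
      also have "\<dots> = (deriv ^^ 3) h x * (h x powr n * h x powr (- n))
          + B * deriv h x * (h x powr m * h x powr (- n))"
        by (simp add: steady_flux_def algebra_simps)
      finally show ?thesis unfolding p by (simp add: mult_ac)
    qed
    ultimately show ?thesis by simp
  qed
  have per': "periodic_with (deriv f) T" if "\<And>x. (f has_real_derivative deriv f x) (at x)" "periodic_with f T"
    for f :: "real \<Rightarrow> real"
    unfolding periodic_with_def
  proof
    fix x
    have "((\<lambda>x. f (x + T)) has_real_derivative deriv f (x + T)) (at x)"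
      using that(1)[of "x + T"] by (simp add: DERIV_shift)
    moreover have "(\<lambda>x. f (x + T)) = f" using that(2) by (auto simp: periodic_with_def)
    ultimately show "deriv f (x + T) = deriv f x" using that(1)[of x] by (metis DERIV_unique)
  qed
  have h1: "periodic_with (deriv h) T" by (rule per'[OF d1 T(2)])
  have "periodic_with (deriv (deriv h)) T"
    by (rule per'[OF _ h1]) (use d2 in \<open>simp add: numeral_2_eq_2\<close>)
  then have h2: "periodic_with ((deriv ^^ 2) h) T" by (simp add: numeral_2_eq_2)
  \<comment> \<open>\<open>w\<close> is periodic, while its derivative has the sign of the constant
    flux \<open>C0\<close> everywhere. Hence \<open>C0 = 0\<close>, and \<open>w\<close> is the
    constant multiplier.\<close>
  have "w T = w 0"
    using h2[unfolded periodic_with_def, rule_format, of 0] T(2)[unfolded periodic_with_def, rule_format, of 0]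
    by (simp add: w_def)
  moreover have "w 0 < w T" if "0 < C0"
    by (rule DERIV_pos_imp_increasing[OF T(1)]) (use dw that pos in \<open>metis mult_pos_pos powr_gt_zero less_irrefl\<close>)
  moreover have "w T < w 0" if "C0 < 0"
    by (rule DERIV_neg_imp_decreasing[OF T(1)]) (use dw that pos in \<open>metis mult_neg_pos powr_gt_zero less_irrefl\<close>)
  ultimately have "C0 = 0" by (cases C0 "0::real" rule: linorder_cases) auto
  then have "(w has_real_derivative 0) (at x)" for x using dw[of x] by simp
  then have wc: "w x = w 0" for x by (rule DERIV_isconst_all[rule_format])
  have "ode_sol q B (w 0) h (deriv h) UNIV"
  proof
    show "(deriv h has_real_derivative w 0 - B * frc q (h x)) (at x)" for x
    proof -
      have "w 0 - B * frc q (h x) = (deriv ^^ 2) h x" using wc[of x] by (simp add: w_def)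
      then show ?thesis using d2[of x] by simp
    qed
  qed (use pos d1 in auto)
  then show ?thesis by (rule that)
qed

text \<open>The dilation factor \<open>s\<close> is the equilibrium height, where the force balances
  the multiplier \<open>c\<close>. The second derivative is nonnegative at a minimum and nonpositive
  at a maximum, which puts \<open>c\<close> between the values of \<open>B * frc q\<close> there,
  and the intermediate value theorem provides \<open>s\<close>.\<close>

lemma rescale_to_unit:
  assumes q: "-1 < q" and B: "0 < B" and sol: "ode_sol q B c h l UNIV"
    and per: "periodic_with h T" "0 < T" and nonconst: "\<not> (\<exists>c. \<forall>x. h x = c)"
  obtains s r \<rho> x0 where "0 < s" "0 < r" "r\<^sup>2 * B = s powr (1 - q)" "0 < \<rho>" "\<rho> < rho0 q" "x0 \<in> {0..T}"
    "\<And>x. h x = orbit.scaled q \<rho> s r (x - x0)"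
proof -
  interpret ode_sol q B c h l UNIV by (rule sol)
  obtain x0 x1 where x0: "x0 \<in> {0..T}" and mn: "\<And>x. h x0 \<le> h x" and mx: "\<And>x. h x \<le> h x1"
    using periodic_min_max[OF per ode_sol_cont[OF sol]] by metis
  have lmin: "l x0 = 0" by (rule DERIV_local_min[OF k, of x0 1]) (use mn in auto)
  have lmax: "l x1 = 0" by (rule DERIV_local_max[OF k, of x1 1]) (use mx in auto)
  have hc: "continuous_on UNIV h" by (rule ode_sol_cont[OF sol])
  have c1: "B * frc q (h x0) \<le> c"
  proof (rule ccontr)
    assume "\<not> ?thesis"
    then have "\<exists>d>0. \<forall>e>0. e < d \<longrightarrow> l (x0 + e) < l x0" using l[of x0] by (intro DERIV_neg_dec_right) auto
    then obtain d where d: "0 < d" "\<And>e. 0 < e \<Longrightarrow> e < d \<Longrightarrow> l (x0 + e) < 0" by (auto simp: lmin)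
    have "h (x0 + d / 2) < h x0"
    proof (rule DERIV_neg_imp_decreasing_open[of x0 "x0 + d / 2" h])
      show "\<exists>y. (h has_real_derivative y) (at x) \<and> y < 0" if "x0 < x" "x < x0 + d / 2" for x
        using k[of x] d(1) d(2)[of "x - x0"] that by auto
      show "continuous_on {x0..x0 + d / 2} h" using hc by (rule continuous_on_subset) simp
    qed (use d in simp)
    then show False using mn[of "x0 + d / 2"] by simp
  qed
  have c2: "c \<le> B * frc q (h x1)"
  proof (rule ccontr)
    assume "\<not> ?thesis"
    then have "\<exists>d>0. \<forall>e>0. e < d \<longrightarrow> l x1 < l (x1 + e)" using l[of x1] by (intro DERIV_pos_inc_right) auto
    then obtain d where d: "0 < d" "\<And>e. 0 < e \<Longrightarrow> e < d \<Longrightarrow> 0 < l (x1 + e)" by (auto simp: lmax)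
    have "h x1 < h (x1 + d / 2)"
    proof (rule DERIV_pos_imp_increasing_open[of x1 "x1 + d / 2" h])
      show "\<exists>y. (h has_real_derivative y) (at x) \<and> 0 < y" if "x1 < x" "x < x1 + d / 2" for x
        using k[of x] d(1) d(2)[of "x - x1"] that by auto
      show "continuous_on {x1..x1 + d / 2} h" using hc by (rule continuous_on_subset) simp
    qed (use d in simp)
    then show False using mx[of "x1 + d / 2"] by simp
  qed
  have "\<exists>s. h x0 \<le> s \<and> s \<le> h x1 \<and> B * frc q s = c"
  proof (rule IVT'[OF c1 c2 mn])
    have "continuous_on {h x0..h x1} (frc q)"
      by (rule DERIV_continuous_on, rule has_field_derivative_at_within[OF frc_deriv])
        (use pos[of x0] in auto)
    then show "continuous_on {h x0..h x1} (\<lambda>s. B * frc q s)" by (intro continuous_intros)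
  qed
  then obtain s where s': "h x0 \<le> s" and s: "B * frc q s = c" by blast
  have sp: "0 < s" using s' pos[of x0] by simp
  define r where "r = sqrt (s powr (1 - q) / B)"
  have r: "0 < r" "r\<^sup>2 * B = s powr (1 - q)" using sp B by (simp_all add: r_def)
  define k where "k = (\<lambda>x. h (r * x + x0) / s)"
  define k' where "k' = (\<lambda>x. r / s * l (r * x + x0))"
  have kp: "0 < k x" for x using pos[of "r * x + x0"] sp by (simp add: k_def)
  have "ode_sol q 1 0 k k' UNIV"
  proof
    fix x :: real
    have a: "((\<lambda>x. r * x + x0) has_real_derivative r) (at x)" by (auto intro!: derivative_eq_intros)
    have "((\<lambda>x. h (r * x + x0)) has_real_derivative l (r * x + x0) * r) (at x)"
      by (rule DERIV_chain2[where f = h and g = "\<lambda>x. r * x + x0", OF ode_sol.k[OF sol UNIV_I] a])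
    from DERIV_cdivide[OF this, of s] show "(k has_real_derivative k' x) (at x)"
      by (simp add: k_def[abs_def] k'_def mult.commute)
    have "((\<lambda>x. l (r * x + x0)) has_real_derivative (c - B * frc q (h (r * x + x0))) * r) (at x)"
      by (rule DERIV_chain2[where f = l and g = "\<lambda>x. r * x + x0", OF ode_sol.l[OF sol UNIV_I] a])
    from DERIV_cmult[OF this, of "r / s"]
    have "(k' has_real_derivative r / s * ((c - B * frc q (h (r * x + x0))) * r)) (at x)"
      by (simp add: k'_def[abs_def])
    moreover have "r / s * ((c - B * frc q (h (r * x + x0))) * r) = - frc q (k x)"
    proof -
      have "frc q (h (r * x + x0)) = s powr q * frc q (k x) + frc q s"
        using frc_scale[OF sp kp[of x], of q] sp by (simp add: k_def)
      then have "c - B * frc q (h (r * x + x0)) = - (B * s powr q * frc q (k x))"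
        by (simp add: s[symmetric] algebra_simps)
      then have "r / s * ((c - B * frc q (h (r * x + x0))) * r) = - (r\<^sup>2 * B * s powr q / s) * frc q (k x)"
        by (simp add: power2_eq_square)
      also have "r\<^sup>2 * B * s powr q = s" unfolding r(2) using sp by (simp add: powr_add[symmetric])
      finally show ?thesis using sp by simp
    qed
    ultimately show "(k' has_real_derivative 0 - 1 * frc q (k x)) (at x)" by simp
  qed (use kp in auto)
  moreover have "periodic_with k (T / r)"
    using per(1) r by (simp add: periodic_with_def k_def distrib_left add.assoc add.commute[of T])
      (metis add.assoc add.commute)
  moreover have "k 0 \<le> k x" for x using mn sp by (simp add: k_def divide_right_mono)
  moreover have "\<not> (\<exists>c. \<forall>x. k x = c)"
  proof
    assume "\<exists>c. \<forall>x. k x = c"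
    then obtain d where d: "\<And>x. k x = d" by blast
    have "h x = s * d" for x using d[of "(x - x0) / r"] r sp by (simp add: k_def field_simps)
    then show False using nonconst by blast
  qed
  ultimately obtain \<rho> where \<rho>: "0 < \<rho>" "\<rho> < rho0 q" "k = orbit.K q \<rho>"
    using periodic_solution_is_orbit[OF q, of k k' "T / r"] per(2) r by (metis divide_pos_pos)
  interpret o: orbit q \<rho> using q \<rho> by unfold_locales auto
  have "h x = o.scaled s r (x - x0)" for x
    using r sp by (simp add: o.scaled_def \<rho>(3)[symmetric] k_def)
  then show ?thesis using that sp r \<rho>(1,2) x0 by blast
qed

context orbit begin

lemma scaled_least_period:
  assumes full: "\<rho> < rho0 q" and r: "0 < r" and s: "0 < s"
    and X: "is_least_period (\<lambda>x. scaled s r (x - x0)) X"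
  shows "X = r * P"
proof -
  have K: "K ((x - x0) / r) = scaled s r (x - x0) / s" for x using s by (simp add: scaled_def)
  have "periodic_with K (X / r)"
    unfolding periodic_with_def
  proof
    fix x
    have "scaled s r (r * x + x0 + X - x0) = scaled s r (r * x + x0 - x0)"
      using X unfolding is_least_period_def periodic_with_def by blast
    then show "K (x + X / r) = K x" using r s by (simp add: scaled_def add_divide_distrib)
  qed
  moreover have "0 < X / r" using X r by (simp add: is_least_period_def)
  ultimately have "P \<le> X / r"
    using K_least_period[OF full] unfolding is_least_period_def by (meson not_less)
  then have 1: "r * P \<le> X" using r by (simp add: field_simps)
  have "periodic_with (\<lambda>x. scaled s r (x - x0)) (r * P)"
    unfolding periodic_with_def
  proof
    fix x
    have "(x + r * P - x0) / r = (x - x0) / r + P" using r by (simp add: field_simps)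
    then show "scaled s r (x + r * P - x0) = scaled s r (x - x0)" by (simp add: scaled_def K_periodic)
  qed
  then have "\<not> r * P < X" using X r P_pos by (auto simp: is_least_period_def)
  then show ?thesis using 1 by simp
qed

lemma scaled_periodic: "0 < r \<Longrightarrow> scaled s r (x + r * P) = scaled s r x"
  using K_periodic[of "x / r"] by (simp add: scaled_def add_divide_distrib)

lemma scaled'_periodic: "0 < r \<Longrightarrow> scaled' s r (x + r * P) = scaled' s r x"
  using ang_shift[of "x / r"] by (simp add: scaled'_def L_def add_divide_distrib)

end

lemma integral_shifted_period:
  fixes f :: "real \<Rightarrow> real"
  assumes c: "continuous_on UNIV f" and p: "periodic_with f X" and x0: "x0 \<in> {0..X}"
  shows "integral {0..X} (\<lambda>x. f (x - x0)) = integral {0..X} f"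
proof -
  have "integral {0..X} (\<lambda>x. f (x - x0)) = integral {x0..x0 + X} (\<lambda>x. f (x - x0))"
  proof (rule integral_periodic_shift[symmetric, OF _ _ x0])
    show "continuous_on UNIV (\<lambda>x. f (x - x0))"
      by (rule continuous_on_compose2[OF c]) (auto intro!: continuous_intros)
    show "periodic_with (\<lambda>x. f (x - x0)) X"
      using p by (simp add: periodic_with_def) (metis add_diff_eq add.commute)
  qed
  also have "\<dots> = integral {0..X} f"
    using integral_affine[OF c, of 1 X x0] x0 by simp
  finally show ?thesis .
qed

theorem theorem7:
  fixes m n B q X A\<^sub>s\<^sub>s :: real and h\<^sub>s\<^sub>s H :: "real \<Rightarrow> real"
  assumes B: "0 < B"
    and q: "q = m - n + 1"
    and H: "energy_potential B q H"
    and steady: "positive_periodic_steady_state n m B h\<^sub>s\<^sub>s"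
    and nonconst: "\<not> (\<exists>c. \<forall>x. h\<^sub>s\<^sub>s x = c)"
    and X: "is_least_period h\<^sub>s\<^sub>s X"
    and A: "A\<^sub>s\<^sub>s = integral {0..X} h\<^sub>s\<^sub>s"
    and cases: "(-1 < q \<and> q < 1) \<or> (2 \<le> q \<and> q < 3) \<or>
      (1 < q \<and> q < 2 \<and>
        (\<forall>\<alpha>. 0 < \<alpha> \<and> \<alpha> < 1 \<longrightarrow> (\<exists>D>0. (E_fun q has_real_derivative D) (at \<alpha>))))"
  shows "\<exists>g a b. droplet_steady_state n m B g a b \<and> zero_contact_angle g a b \<and>
           b - a < X \<and> integral {a..b} g = A\<^sub>s\<^sub>s \<and>
           energy H X (on_circle X a g) < energy H X h\<^sub>s\<^sub>s"
proof -
  have q1: "-1 < q" and q3: "q < 3" using cases by auto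
  obtain c1 c2 where HH: "\<And>y. 0 \<le> y \<Longrightarrow> H y = B * pot q y + c1 * y + c2"
    using energy_potential_explicit[OF H q1] by blast
  have Hc: "continuous_on {0..} H" using H by (auto simp: energy_potential_def)
  obtain c where sol: "ode_sol q B c h\<^sub>s\<^sub>s (deriv h\<^sub>s\<^sub>s) UNIV"
    using periodic_steady_state_ode[OF steady q] by blast
  have Xp: "0 < X" and Xper: "periodic_with h\<^sub>s\<^sub>s X" using X by (auto simp: is_least_period_def)
  obtain s r \<rho> x0 where s: "0 < s" and r: "0 < r" "r\<^sup>2 * B = s powr (1 - q)"
    and \<rho>: "0 < \<rho>" "\<rho> < rho0 q" and x0: "x0 \<in> {0..X}"
    and h: "\<And>x. h\<^sub>s\<^sub>s x = orbit.scaled q \<rho> s r (x - x0)"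
    using rescale_to_unit[OF q1 B sol Xper Xp nonconst] by metis
  interpret o: orbit q \<rho> using q1 \<rho> by unfold_locales auto
  have heq: "h\<^sub>s\<^sub>s = (\<lambda>x. o.scaled s r (x - x0))" using h by auto
  have XP: "X = r * o.P" using o.scaled_least_period[OF \<rho>(2) r(1) s] X unfolding heq .
  have A': "A\<^sub>s\<^sub>s = r * s * mass q \<rho>"
  proof -
    have "A\<^sub>s\<^sub>s = integral {0..X} (o.scaled s r)" unfolding A heq
      by (rule integral_shifted_period[OF o.scaled_cont _ x0])
        (simp add: periodic_with_def XP o.scaled_periodic r)
    then show ?thesis unfolding XP o.scaled_mass[OF r(1)] .
  qed
  \<comment> \<open>The family keeps \<open>sqrt B * area\<close> fixed; with this normalization
    \<open>B\<close> enters lengths and energies only through explicit factors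
    \<open>sqrt B\<close>.\<close>
  define cc where "cc = sqrt B * A\<^sub>s\<^sub>s"
  have cc: "0 < cc" using B r s mass_pos[OF q1 \<rho>(1)] \<rho> by (simp add: cc_def A')
  interpret family q cc
    using q1 q3 cc log_derivative_sign[OF cases] by unfold_locales auto
  have scale: "r' = s' powr ((1 - q) / 2) / sqrt B" if "0 < r'" "r'\<^sup>2 * B = s' powr (1 - q)" "0 < s'" for r' s' :: real
  proof (rule power2_eq_imp_eq)
    have "(s' powr ((1 - q) / 2))\<^sup>2 = s' powr ((1 - q) / 2 + (1 - q) / 2)"
      unfolding power2_eq_square by (rule powr_add[symmetric])
    then have "(s' powr ((1 - q) / 2))\<^sup>2 = s' powr (1 - q)" by (simp only: field_sum_of_halves)
    then show "r'\<^sup>2 = (s' powr ((1 - q) / 2) / sqrt B)\<^sup>2" using B that by (simp add: power_divide field_simps)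
  qed (use that B in auto)
  have mass_scale: "sqrt B * (s' powr ((1 - q) / 2) / sqrt B * s' * M) = s' powr ((3 - q) / 2) * M"
    if "0 < s'" for s' M :: real
  proof -
    have "s' powr ((1 - q) / 2) * s' = s' powr ((1 - q) / 2 + 1)" using that by (simp add: powr_add)
    also have "(1 - q) / 2 + 1 = (3 - q) / 2" by (simp add: field_simps)
    finally show ?thesis using B by (simp add: mult.assoc[symmetric])
  qed
  \<comment> \<open>This identifies the given steady state as the member of the family with
    amplitude \<open>\<rho>\<close>; the droplet will be the member with amplitude
    \<open>rho0 q\<close>.\<close>
  have s_eq: "s = size_of q cc \<rho>"
  proof -
    have "cc = s powr ((3 - q) / 2) * mass q \<rho>"
      unfolding cc_def A' using scale[OF r s] mass_scale[OF s] by simp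
    then have "cc / mass q \<rho> = s powr ((3 - q) / 2)" using mass_pos[OF q1 \<rho>(1)] \<rho> by simp
    moreover have "(3 - q) / 2 * (2 / (3 - q)) = 1" using q3 by simp
    ultimately show ?thesis using s by (simp only: size_of_def powr_powr) simp
  qed

  define R where "R = rho0 q"
  have R: "0 < R" "R \<le> rho0 q" using rho0_pos[OF q1] by (auto simp: R_def)
  interpret d: orbit q R using q1 R by unfold_locales auto
  define s0 where "s0 = size_of q cc R"
  define r0 where "r0 = sqrt (s0 powr (1 - q) / B)"
  have s0: "0 < s0" unfolding s0_def by (rule size_pos[OF R])
  have r0: "0 < r0" "r0\<^sup>2 * B = s0 powr (1 - q)" using s0 B by (simp_all add: r0_def)
  have A0: "r0 * s0 * mass q R = A\<^sub>s\<^sub>s"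
  proof -
    have "sqrt B * (r0 * s0 * mass q R) = s0 powr ((3 - q) / 2) * mass q R"
      unfolding scale[OF r0 s0] by (rule mass_scale[OF s0])
    also have "\<dots> = sqrt B * A\<^sub>s\<^sub>s" unfolding s0_def size_mass[OF R] by (simp add: cc_def)
    finally show ?thesis using B by simp
  qed
  have len: "r' * period q \<rho>' = length_of q cc \<rho>' / sqrt B"
    if "0 < r'" "r'\<^sup>2 * B = s' powr (1 - q)" "0 < s'" "s' = size_of q cc \<rho>'" for r' s' \<rho>'
    using scale[OF that(1-3)] by (simp add: length_of_def that(4))
  have short: "r0 * d.P < X"
    unfolding XP d.P_def o.P_def len[OF r0 s0 s0_def] len[OF r s s_eq]
    using length_less[OF \<rho>] B by (simp add: R_def divide_strict_right_mono)

  have Eh: "energy H X h\<^sub>s\<^sub>s = sqrt B * energy_of q cc \<rho> - c1 * A\<^sub>s\<^sub>s - c2 * X"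
  proof -
    define f where "f = (\<lambda>x. 1 / 2 * (o.scaled' s r x)\<^sup>2 - H (o.scaled s r x))"
    have K: "0 < o.K x" for x by (rule o.K_pos[OF \<rho>(2)])
    have dh: "deriv h\<^sub>s\<^sub>s x = o.scaled' s r (x - x0)" for x
    proof -
      have "((\<lambda>x. o.scaled s r (x - x0)) has_real_derivative o.scaled' s r (x - x0) * 1) (at x)"
        by (rule DERIV_chain2[where f = "o.scaled s r" and g = "\<lambda>x. x - x0", OF o.scaled_deriv[OF r(1) K]])
          (auto intro!: derivative_eq_intros)
      then show ?thesis unfolding heq by (simp add: DERIV_imp_deriv)
    qed
    have "o.scaled s r ` UNIV \<subseteq> {0..}" using s o.K_nonneg by (auto simp: o.scaled_def)
    then have fc: "continuous_on UNIV f" unfolding f_def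
      by (intro continuous_intros o.scaled'_cont continuous_on_compose2[OF Hc o.scaled_cont])
    have "energy H X h\<^sub>s\<^sub>s = integral {0..X} (\<lambda>x. f (x - x0))"
      unfolding energy_def dh h f_def ..
    also have "\<dots> = integral {0..X} f"
      by (rule integral_shifted_period[OF fc _ x0])
        (simp add: periodic_with_def XP f_def o.scaled_periodic o.scaled'_periodic r)
    also have "\<dots> = sqrt B * (s powr ((3 + q) / 2) * (2 * kinetic q \<rho> - level q \<rho> * period q \<rho>)
        - sqrt B * (r * s * mass q \<rho>) * frc q s) - c1 * (r * s * mass q \<rho>) - c2 * (r * o.P)"
      unfolding XP f_def by (rule o.scaled_energy[OF r s B HH])
    finally show ?thesis unfolding A'[symmetric] XP[symmetric] energy_of_def s_eq[symmetric]
      by (simp add: cc_def)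
  qed
  have Ed: "energy H X (on_circle X 0 (d.droplet s0 r0)) = sqrt B * energy_of q cc R - c1 * A\<^sub>s\<^sub>s - c2 * X"
  proof -
    \<comment> \<open>The padding contributes \<open>- c2 * (X - r0 * d.P)\<close> and completes the
      droplet's own \<open>- c2 * (r0 * d.P)\<close> to \<open>- c2 * X\<close>, the same constant
      as for the periodic state.\<close>
    have "H 0 = c2" using HH[of 0] by simp
    moreover have "integral {0..r0 * d.P} (\<lambda>x. 1 / 2 * (d.scaled' s0 r0 x)\<^sup>2 - H (d.scaled s0 r0 x))
        = sqrt B * (s0 powr ((3 + q) / 2) * (2 * kinetic q R - level q R * period q R)
        - sqrt B * (r0 * s0 * mass q R) * frc q s0) - c1 * (r0 * s0 * mass q R) - c2 * (r0 * d.P)"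
      by (rule d.scaled_energy[OF r0 s0 B HH])
    ultimately show ?thesis
      unfolding d.droplet_energy[OF R_def s0 r0 B short Hc] A0 energy_of_def s0_def[symmetric]
      by (simp add: cc_def algebra_simps)
  qed
  have "energy H X (on_circle X 0 (d.droplet s0 r0)) < energy H X h\<^sub>s\<^sub>s"
    unfolding Eh Ed using energy_less[OF \<rho>] B by (simp add: R_def)
  then show ?thesis
    using d.droplet_steady[OF R_def s0 r0 B q] d.droplet_contact[OF R_def s0 r0 B]
      d.droplet_integral[OF R_def s0 r0 B] A0 short
    by (intro exI[of _ "d.droplet s0 r0"] exI[of _ 0] exI[of _ "r0 * d.P"]) simp
qed

end
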